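(* Let $0<T<\infty$, $L>0$, $\lambda\in\{1,-1\}$, and let $q(x,t)$ be a sufficiently smooth solution of $$iq_t+q_{xx}-2\lambda|q|^2q=0,\qquad 0<x<L,\ 0<t<T,$$ with vanishing initial data $q(x,0)=0$, $0\le x\le L$, and boundary values $g_0(t)=q(0,t)$, $h_0(t)=q(L,t)$, $g_1(t)=q_x(0,t)$, $h_1(t)=q_x(L,t)$. For the Dirichlet problem it is assumed that $g_0(t)$ and $h_0(t)$, $0\le t<T$, are sufficiently smooth and compatible with the initial data; for the Neumann problem it is assumed that $g_1(t)$ and $h_1(t)$, $0\le t<T$, are sufficiently smooth and compatible with the initial data. Let $L_j,M_j,\mathcal L_j,\mathcal M_j$, $j=1,2$, be the Gelfand–Levitan–Marchenko kernels and let hats denote the transform, both as defined in the context, and define $$\begin{aligned}F(t,k)=\;&\frac i2h_0(t)e^{2ikL}\hat{\mathcal M}_2-\frac i2g_0(t)\hat M_2\\&+\Big(\overline{\hat{\mathcal L}}_2-i\lambda\frac{h_0(t)}2\overline{\hat{\mathcal M}}_1+k\overline{\hat{\mathcal M}}_2\Big)\Big(\hat L_1-\frac i2g_0(t)\hat M_2+k\hat M_1\Big)\\&-e^{2ikL}\Big(\overline{\hat L}_2-i\lambda\frac{g_0(t)}2\overline{\hat M}_1+k\overline{\hat M}_2\Big)\Big(\hat{\mathcal L}_1-\frac i2h_0(t)\hat{\mathcal M}_2+k\hat{\mathcal M}_1\Big),\end{aligned}$$ where un-barred hatted functions are evaluated at $(t,k)$ and $\overline{\hat{\mathcal L}}_2$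 is short-hand for $\overline{\hat{\mathcal L}_2(t,\bar k)}$, etc. Then, for $0<t<T$: (a) For the Dirichlet problem, the unknown boundary values $g_1$ and $h_1$ are given by $$\begin{aligned}g_1(t)=\frac4{i\pi}\int_{\partial D_1^0}\Big\{&-\frac{2k^2}{\Delta}\Big[\hat{\mathcal M}_1(t,k)-\frac{h_0(t)}{2ik^2}\Big]+\frac{k^2\Sigma}{\Delta}\Big[\hat M_1(t,k)-\frac{g_0(t)}{2ik^2}\Big]\\&+\frac k\Delta\big(e^{-2ikL}F(t,k)\big)_-+\frac{ig_0(t)}2k\hat M_2(t,k)+\frac{kg_0(t)}{2i}\overline{\hat{\mathcal M}_2(t,\bar k)}\Big\}dk,\end{aligned}$$ $$\begin{aligned}h_1(t)=\frac4{i\pi}\int_{\partial D_1^0}\Big\{&\frac{2k^2}{\Delta}\Big[\hat M_1(t,k)-\frac{g_0(t)}{2ik^2}\Big]-\frac{k^2\Sigma}{\Delta}\Big[\hat{\mathcal M}_1(t,k)-\frac{h_0(t)}{2ik^2}\Big]\\&+\frac k\Delta\big(F(t,k)\big)_-+\frac{ih_0(t)}2k\hat{\mathcal M}_2(t,k)+\frac{kh_0(t)}{2i}\overline{\hat M_2(t,\bar k)}\Big\}dk.\end{aligned}$$ (b) For the Neumann problem, the unknown boundary values $g_0$ and $h_0$ are given by $$g_0(t)=\frac2\pi\int_{\partial D_1^0}\frac1{\Delta(k)}\Big\{\Sigma(k)\hat L_1(t,k)-2\hat{\mathcal L}_1(t,k)+\big(e^{-2ikL}F(t,k)\big)_+\Big\}dk,$$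 $$h_0(t)=\frac2\pi\int_{\partial D_1^0}\frac1{\Delta(k)}\Big\{-\Sigma(k)\hat{\mathcal L}_1(t,k)+2\hat L_1(t,k)+F_+(t,k)\Big\}dk.$$
   Context: Eigenfunctions. $(\Phi_1,\Phi_2)$ are the solutions, entire in $k$, of $$\Phi_1(t,k)=\int_0^te^{4ik^2(t'-t)}\big[-i\lambda|g_0|^2\Phi_1+(2kg_0+ig_1)\Phi_2\big](t',k)dt',\quad \Phi_2(t,k)=1+\lambda\int_0^t\big[(2k\bar g_0-i\bar g_1)\Phi_1+i|g_0|^2\Phi_2\big](t',k)dt',$$ and $(\varphi_1,\varphi_2)$ are the solutions of the same system with $(g_0,g_1)$ replaced by $(h_0,h_1)$. Transform. For a function $f(t,s)$, $\hat f(t,k)=\int_{-t}^te^{2ik^2(s-t)}f(t,s)\,ds$. GLM kernels. The functions $L_j(t,s),M_j(t,s),\mathcal L_j(t,s),\mathcal M_j(t,s)$, $-t<s<t$, $j=1,2$, are the functions for which the following representations hold: $$\Phi_1=\hat L_1-\tfrac i2g_0\hat M_2+k\hat M_1,\qquad \Phi_2=1+\hat L_2+\tfrac{i\lambda}2\bar g_0\hat M_1+k\hat M_2,$$ $$\varphi_1=\hat{\mathcal L}_1-\tfrac i2h_0\hat{\mathcal M}_2+k\hat{\mathcal M}_1,\qquad \varphi_2=1+\hat{\mathcal L}_2+\tfrac{i\lambda}2\bar h_0\hat{\mathcal M}_1+k\hat{\mathcal M}_2.$$ Equivalently, $L_j,M_j$ solve the Goursat system $$L_{1t}-L_{1s}=ig_1L_2+\alpha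 M_1+\beta M_2,\qquad L_{2t}+L_{2s}=-i\lambda\bar g_1L_1-\alpha M_2+\lambda\bar\beta M_1,$$ $$M_{1t}-M_{1s}=2g_0L_2+ig_1M_2,\qquad M_{2t}+M_{2s}=2\lambda\bar g_0L_1-i\lambda\bar g_1M_1,$$ with $\alpha=\frac\lambda2(g_0\bar g_1-\bar g_0g_1)$, $\beta=\frac12\big(i\frac{dg_0}{dt}-\lambda|g_0|^2g_0\big)$, and conditions $L_1(t,t)=\frac i2g_1(t)$, $M_1(t,t)=g_0(t)$, $L_2(t,-t)=M_2(t,-t)=0$; and $\mathcal L_j,\mathcal M_j$ solve the same problem with $(g_0,g_1)$ replaced by $(h_0,h_1)$. Notation. For a function $f$ of $k$: $f_+(k)=f(k)+f(-k)$, $f_-(k)=f(k)-f(-k)$; $(\cdot)_\pm$ is applied to the entire function of $k$ in the parentheses. $\Delta(k)=e^{2ikL}-e^{-2ikL}$, $\Sigma(k)=e^{2ikL}+e^{-2ikL}$. Contours. $D_1,\dots,D_4$ are the four open quadrants of the complex $k$-plane; $\partial D_j$ is oriented so that $D_j$ lies to its left. $\partial D_3^0$ is the contour obtained by deforming $\partial D_3$ (from $-i\infty$ to $0$ to $-\infty$) so that it passes below the zeros $\{-\frac{n\pi}{2L}:n=0,1,2,\dots\}$ of $\Delta$ in $(-\infty,0]$. $\partial D_1^0=-\partial D_3^0$ is its image under $k\mapsto-k$ (running from $i\infty$ to $+\infty$ and passing above the zeros $\frac{n\pi}{2L}$, $n\ge0$). Integrals along unbounded contours are understood as limits, as $R\to\infty$,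 of the integrals over the part of the contour in $|k|<R$. *)

theory Defs
  imports "HOL-Analysis.Analysis"
begin

section \<open>Smoothness up to the boundary\<close>

text \<open>
  The witness \<open>D i j\<close> is the partial derivative of order \<open>i\<close> in the first and \<open>j\<close> in the
  second variable; at boundary points of \<open>X\<close> and \<open>Y\<close> the derivatives are one-sided.
\<close>

definition Ck2_on :: "nat \<Rightarrow> real set \<Rightarrow> real set \<Rightarrow> (real \<Rightarrow> real \<Rightarrow> complex) \<Rightarrow> bool" where
  "Ck2_on N X Y f \<longleftrightarrow>
    (\<exists>D :: nat \<Rightarrow> nat \<Rightarrow> real \<Rightarrow> real \<Rightarrow> complex.
      (\<forall>x\<in>X. \<forall>y\<in>Y. D 0 0 x y = f x y) \<and>
      (\<forall>i j. i + j \<le> N \<longrightarrow> continuous_on (X \<times> Y) (\<lambda>(x, y). D i j x y)) \<and>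
      (\<forall>i j. i + j < N \<longrightarrow> (\<forall>x\<in>X. \<forall>y\<in>Y.
         ((\<lambda>\<xi>. D i j \<xi> y) has_vector_derivative D (Suc i) j x y) (at x within X) \<and>
         ((\<lambda>\<eta>. D i j x \<eta>) has_vector_derivative D i (Suc j) x y) (at y within Y))))"

text \<open>
  \<open>g\<close> is \<open>C\<^sup>N\<close> on \<open>[0,T)\<close> and compatible with vanishing initial data: since \<open>q(x,0) = 0\<close>, the
  equation forces all time derivatives of \<open>q\<close> and \<open>q\<^sub>x\<close> to vanish at \<open>t = 0\<close>, so the compatibility
  conditions at the corners say that the derivatives of the boundary datum vanish at \<open>0\<close>.
\<close>

definition smooth_compatible :: "nat \<Rightarrow> real \<Rightarrow> (real \<Rightarrow> complex) \<Rightarrow> bool" where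
  "smooth_compatible N T g \<longleftrightarrow>
    (\<exists>D :: nat \<Rightarrow> real \<Rightarrow> complex.
      (\<forall>t\<in>{0..<T}. D 0 t = g t) \<and>
      (\<forall>j\<le>N. continuous_on {0..<T} (D j)) \<and>
      (\<forall>j<N. \<forall>t\<in>{0..<T}. (D j has_vector_derivative D (Suc j) t) (at t within {0..<T})) \<and>
      (\<forall>j\<le>N. D j 0 = 0))"

section \<open>The equation and the boundary values\<close>

definition nls_solution :: "real \<Rightarrow> real \<Rightarrow> real \<Rightarrow> (real \<Rightarrow> real \<Rightarrow> complex) \<Rightarrow> bool" where
  "nls_solution T L lam q \<longleftrightarrow>
    (\<forall>x t. 0 < x \<and> x < L \<and> 0 < t \<and> t < T \<longrightarrow>
      \<i> * vector_derivative (\<lambda>\<tau>. q x \<tau>) (at t)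
      + vector_derivative (\<lambda>\<xi>. vector_derivative (\<lambda>y. q y t) (at \<xi>)) (at x)
      - 2 * of_real lam * of_real ((cmod (q x t))\<^sup>2) * q x t = 0)"

definition boundary_values ::
    "real \<Rightarrow> real \<Rightarrow> (real \<Rightarrow> real \<Rightarrow> complex) \<Rightarrow> (real \<Rightarrow> complex) \<Rightarrow> (real \<Rightarrow> complex) \<Rightarrow>
     (real \<Rightarrow> complex) \<Rightarrow> (real \<Rightarrow> complex) \<Rightarrow> bool" where
  "boundary_values T L q g0 g1 h0 h1 \<longleftrightarrow>
    (\<forall>t\<in>{0..<T}.
      g0 t = q 0 t \<and> h0 t = q L t \<and>
      ((\<lambda>x. q x t) has_vector_derivative g1 t) (at 0 within {0..L}) \<and>
      ((\<lambda>x. q x t) has_vector_derivative h1 t) (at L within {0..L}))"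

section \<open>Eigenfunctions\<close>

definition eigenfunctions ::
    "real \<Rightarrow> real \<Rightarrow> (real \<Rightarrow> complex) \<Rightarrow> (real \<Rightarrow> complex) \<Rightarrow>
     (real \<Rightarrow> complex \<Rightarrow> complex) \<Rightarrow> (real \<Rightarrow> complex \<Rightarrow> complex) \<Rightarrow> bool" where
  "eigenfunctions T lam g0 g1 Phi1 Phi2 \<longleftrightarrow>
    (\<forall>k. continuous_on {0..<T} (\<lambda>t. Phi1 t k) \<and> continuous_on {0..<T} (\<lambda>t. Phi2 t k)) \<and>
    (\<forall>t\<in>{0..<T}. Phi1 t holomorphic_on UNIV \<and> Phi2 t holomorphic_on UNIV) \<and>
    (\<forall>t\<in>{0..<T}. \<forall>k.
      Phi1 t k = integral {0..t} (\<lambda>t'. exp (4 * \<i> * k\<^sup>2 * of_real (t' - t)) *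
        (- \<i> * of_real lam * of_real ((cmod (g0 t'))\<^sup>2) * Phi1 t' k
         + (2 * k * g0 t' + \<i> * g1 t') * Phi2 t' k)) \<and>
      Phi2 t k = 1 + of_real lam * integral {0..t} (\<lambda>t'.
        (2 * k * cnj (g0 t') - \<i> * cnj (g1 t')) * Phi1 t' k
        + \<i> * of_real ((cmod (g0 t'))\<^sup>2) * Phi2 t' k))"

section \<open>Gelfand--Levitan--Marchenko kernels\<close>

definition hat :: "(real \<Rightarrow> real \<Rightarrow> complex) \<Rightarrow> real \<Rightarrow> complex \<Rightarrow> complex" where
  "hat f t k = integral {-t..t} (\<lambda>s. exp (2 * \<i> * k\<^sup>2 * of_real (s - t)) * f t s)"

text \<open>The Schwarz conjugate of the transform, holomorphic in \<open>k\<close>.\<close>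

definition hatc :: "(real \<Rightarrow> real \<Rightarrow> complex) \<Rightarrow> real \<Rightarrow> complex \<Rightarrow> complex" where
  "hatc f t k = cnj (hat f t (cnj k))"

record glm =
  L1 :: "real \<Rightarrow> real \<Rightarrow> complex"
  L2 :: "real \<Rightarrow> real \<Rightarrow> complex"
  M1 :: "real \<Rightarrow> real \<Rightarrow> complex"
  M2 :: "real \<Rightarrow> real \<Rightarrow> complex"

definition glm_representation ::
    "real \<Rightarrow> real \<Rightarrow> (real \<Rightarrow> complex) \<Rightarrow> (real \<Rightarrow> complex \<Rightarrow> complex) \<Rightarrow>
     (real \<Rightarrow> complex \<Rightarrow> complex) \<Rightarrow> glm \<Rightarrow> bool" where
  "glm_representation T lam g0 Phi1 Phi2 K \<longleftrightarrow>
    (\<forall>t k. 0 < t \<and> t < T \<longrightarrow>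
      Phi1 t k = hat (L1 K) t k - \<i> / 2 * g0 t * hat (M2 K) t k + k * hat (M1 K) t k \<and>
      Phi2 t k = 1 + hat (L2 K) t k + \<i> * of_real lam / 2 * cnj (g0 t) * hat (M1 K) t k
                 + k * hat (M2 K) t k)"

text \<open>\<open>C\<^sup>1\<close> on \<open>-t < s < t\<close>, \<open>0 < t < T\<close>, together with continuous boundary values of \<open>f\<close> and of its
  first partial derivatives \<open>ft\<close>, \<open>fs\<close>.\<close>

definition C1_triangle :: "real \<Rightarrow> (real \<Rightarrow> real \<Rightarrow> complex) \<Rightarrow> bool" where
  "C1_triangle T f \<longleftrightarrow>
    (\<exists>ft fs :: real \<Rightarrow> real \<Rightarrow> complex.
      (\<forall>u\<in>{f, ft, fs}.
        continuous_on {(t, s). 0 \<le> t \<and> t < T \<and> - t \<le> s \<and> s \<le> t} (\<lambda>(t, s). u t s)) \<and>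
      (\<forall>t s. 0 < t \<and> t < T \<and> - t < s \<and> s < t \<longrightarrow>
        ((\<lambda>\<tau>. f \<tau> s) has_vector_derivative ft t s) (at t) \<and>
        ((\<lambda>\<sigma>. f t \<sigma>) has_vector_derivative fs t s) (at s)))"

definition ddt :: "(real \<Rightarrow> real \<Rightarrow> complex) \<Rightarrow> real \<Rightarrow> real \<Rightarrow> complex" where
  "ddt f t s = vector_derivative (\<lambda>\<tau>. f \<tau> s) (at t)"

definition dds :: "(real \<Rightarrow> real \<Rightarrow> complex) \<Rightarrow> real \<Rightarrow> real \<Rightarrow> complex" where
  "dds f t s = vector_derivative (\<lambda>\<sigma>. f t \<sigma>) (at s)"

definition goursat ::
    "real \<Rightarrow> real \<Rightarrow> (real \<Rightarrow> complex) \<Rightarrow> (real \<Rightarrow> complex) \<Rightarrow> glm \<Rightarrow> bool" where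
  "goursat T lam g0 g1 K \<longleftrightarrow>
    (let \<alpha> = (\<lambda>t. of_real lam / 2 * (g0 t * cnj (g1 t) - cnj (g0 t) * g1 t));
         \<beta> = (\<lambda>t. 1 / 2 * (\<i> * vector_derivative g0 (at t)
                           - of_real lam * of_real ((cmod (g0 t))\<^sup>2) * g0 t))
     in
      (\<forall>t s. 0 < t \<and> t < T \<and> - t < s \<and> s < t \<longrightarrow>
        ddt (L1 K) t s - dds (L1 K) t s
          = \<i> * g1 t * L2 K t s + \<alpha> t * M1 K t s + \<beta> t * M2 K t s \<and>
        ddt (L2 K) t s + dds (L2 K) t s
          = - \<i> * of_real lam * cnj (g1 t) * L1 K t s - \<alpha> t * M2 K t s
            + of_real lam * cnj (\<beta> t) * M1 K t s \<and>
        ddt (M1 K) t s - dds (M1 K) t s = 2 * g0 t * L2 K t s + \<i> * g1 t * M2 K t s \<and>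
        ddt (M2 K) t s + dds (M2 K) t s
          = 2 * of_real lam * cnj (g0 t) * L1 K t s
            - \<i> * of_real lam * cnj (g1 t) * M1 K t s) \<and>
      (\<forall>t\<in>{0..<T}.
        L1 K t t = \<i> / 2 * g1 t \<and> M1 K t t = g0 t \<and> L2 K t (- t) = 0 \<and> M2 K t (- t) = 0))"

text \<open>
  The representation determines the four transforms (the transforms are even in \<open>k\<close>, so compare
  the even and odd parts), and hence the kernels among continuous functions; the Goursat problem is
  uniquely solvable, and its solution satisfies the representation.  Either of the last two
  conditions therefore singles out the same kernels.
\<close>

definition glm_kernels ::
    "real \<Rightarrow> real \<Rightarrow> (real \<Rightarrow> complex) \<Rightarrow> (real \<Rightarrow> complex) \<Rightarrow>
     (real \<Rightarrow> complex \<Rightarrow> complex) \<Rightarrow> (real \<Rightarrow> complex \<Rightarrow> complex) \<Rightarrow> glm \<Rightarrow> bool" where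
  "glm_kernels T lam g0 g1 Phi1 Phi2 K \<longleftrightarrow>
    C1_triangle T (L1 K) \<and> C1_triangle T (L2 K) \<and>
    C1_triangle T (M1 K) \<and> C1_triangle T (M2 K) \<and>
    glm_representation T lam g0 Phi1 Phi2 K \<and>
    goursat T lam g0 g1 K"

section \<open>The functions in the integrands\<close>

definition plus_part :: "(complex \<Rightarrow> complex) \<Rightarrow> complex \<Rightarrow> complex" where
  "plus_part f k = f k + f (- k)"

definition minus_part :: "(complex \<Rightarrow> complex) \<Rightarrow> complex \<Rightarrow> complex" where
  "minus_part f k = f k - f (- k)"

definition Del :: "real \<Rightarrow> complex \<Rightarrow> complex" where
  "Del L k = exp (2 * \<i> * k * of_real L) - exp (- 2 * \<i> * k * of_real L)"

definition Sig :: "real \<Rightarrow> complex \<Rightarrow> complex" where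
  "Sig L k = exp (2 * \<i> * k * of_real L) + exp (- 2 * \<i> * k * of_real L)"

text \<open>\<open>K\<close> and \<open>J\<close> are the kernels of the boundary \<open>x = 0\<close> and \<open>x = L\<close>, respectively.\<close>

definition Ffun ::
    "real \<Rightarrow> real \<Rightarrow> (real \<Rightarrow> complex) \<Rightarrow> (real \<Rightarrow> complex) \<Rightarrow> glm \<Rightarrow> glm \<Rightarrow>
     real \<Rightarrow> complex \<Rightarrow> complex" where
  "Ffun L lam g0 h0 K J t k =
     \<i> / 2 * h0 t * exp (2 * \<i> * k * of_real L) * hat (M2 J) t k
     - \<i> / 2 * g0 t * hat (M2 K) t k
     + (hatc (L2 J) t k - \<i> * of_real lam * (h0 t / 2) * hatc (M1 J) t k + k * hatc (M2 J) t k)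
       * (hat (L1 K) t k - \<i> / 2 * g0 t * hat (M2 K) t k + k * hat (M1 K) t k)
     - exp (2 * \<i> * k * of_real L)
       * (hatc (L2 K) t k - \<i> * of_real lam * (g0 t / 2) * hatc (M1 K) t k + k * hatc (M2 K) t k)
       * (hat (L1 J) t k - \<i> / 2 * h0 t * hat (M2 J) t k + k * hat (M1 J) t k)"

section \<open>The deformed contour and integrals along it\<close>

text \<open>
  \<open>contour_D1 L \<gamma>\<close>: \<open>\<gamma>\<close> parametrises (by the whole real line) a deformation of the boundary of the
  first quadrant, running from \<open>\<i>\<infinity>\<close> along the imaginary axis and then to \<open>+\<infinity>\<close>, that passes
  above the zeros \<open>n\<pi>/(2L)\<close>, \<open>n \<ge> 0\<close>, of \<open>\<Delta>\<close>.  A path in the closed quadrant that avoids these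
  zeros passes above them.

  The last three conditions make the limits of the truncated integrals meaningful.  Eventual
  monotonicity of the modulus makes the part of \<open>\<gamma>\<close> in \<open>|k| < R\<close> a single arc for large \<open>R\<close>.
  The factor \<open>exp (2\<i>k\<^sup>2(s - t))\<close> of the transforms, \<open>s < t\<close>, is oscillatory on the undeformed
  boundary but grows exponentially with \<open>Im (k\<^sup>2) = 2 Re k Im k\<close> inside the quadrant; hence this
  quantity has to stay bounded (a line parallel to the real axis is not admissible).  The distance
  to the zeros must not shrink faster than the order \<open>1/|k|\<close> which this bound allows.  Examples are
  the positive real axis with semicircular indentations of radius \<open>\<epsilon>/(n + 1)\<close> about \<open>n\<pi>/(2L)\<close>, and
  the curve \<open>x + \<i>\<epsilon>/(1 + x)\<close>, \<open>x \<ge> 0\<close>.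
\<close>

definition contour_D1 :: "real \<Rightarrow> (real \<Rightarrow> complex) \<Rightarrow> bool" where
  "contour_D1 L \<gamma> \<longleftrightarrow>
    (\<forall>a b. \<gamma> piecewise_C1_differentiable_on {a..b}) \<and>
    (\<forall>s. 0 \<le> Re (\<gamma> s) \<and> 0 \<le> Im (\<gamma> s)) \<and>
    (\<forall>s. \<forall>n::nat. \<gamma> s \<noteq> of_real (real n * pi / (2 * L))) \<and>
    (\<exists>S. \<forall>s\<le>S. Re (\<gamma> s) = 0) \<and>
    filterlim (\<lambda>s. Im (\<gamma> s)) at_top at_bot \<and>
    filterlim (\<lambda>s. Re (\<gamma> s)) at_top at_top \<and>
    (\<exists>S. antimono_on {..- S} (\<lambda>s. cmod (\<gamma> s)) \<and> mono_on {S..} (\<lambda>s. cmod (\<gamma> s))) \<and>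
    (\<exists>C. \<forall>s. Re (\<gamma> s) * Im (\<gamma> s) \<le> C) \<and>
    (\<exists>c>0. \<forall>s. \<forall>n::nat.
      c \<le> (1 + cmod (\<gamma> s)) * dist (\<gamma> s) (of_real (real n * pi / (2 * L))))"

definition has_lim_contour_integral ::
    "(complex \<Rightarrow> complex) \<Rightarrow> complex \<Rightarrow> (real \<Rightarrow> complex) \<Rightarrow> bool" where
  "has_lim_contour_integral f I \<gamma> \<longleftrightarrow>
    (\<exists>J :: real \<Rightarrow> complex.
      (\<forall>\<^sub>F R in at_top.
        ((\<lambda>s. f (\<gamma> s) * vector_derivative \<gamma> (at s)) has_integral J R) {s. cmod (\<gamma> s) < R}) \<and>
      (J \<longlongrightarrow> I) at_top)"

end

theory Submission
  imports Defs "HOL-Complex_Analysis.Cauchy_Integral_Theorem" "HOL-Probability.Sinc_Integral"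
    "HOL-Real_Asymp.Real_Asymp"
begin

text \<open>
  For fixed \<open>t\<close> the zero-curvature equation carries the eigenfunctions from \<open>x = 0\<close> to \<open>x = L\<close> by the
  spatial equation.  Hence \<open>c(k) = Phi1 phi2* - e\<^sup>2\<^sup>i\<^sup>k\<^sup>L phi1 Phi2*\<close> (star: Schwarz conjugate) is an entry of
  the spatial transfer matrix, and integration by parts gives
  \<open>c = (g0 - e\<^sup>2\<^sup>i\<^sup>k\<^sup>L h0) / (2ik) + (A - e\<^sup>2\<^sup>i\<^sup>k\<^sup>L B) / k\<^sup>2 + O(k\<^sup>-\<^sup>3)\<close> with \<open>A\<close>, \<open>B\<close> made of the boundary values
  and of \<open>\<integral> |q|\<^sup>2 dx\<close>; conservation of mass expresses the latter by the values of \<open>M2\<close> on the diagonal.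
  By the GLM representation, \<open>F\<close> is \<open>c\<close> minus linear terms in the transforms, so every integrand is a
  meromorphic expression in \<open>c\<close>, asymptotic to a multiple of \<open>1/k\<close>, plus terms \<open>k\<close> times a transform.
  The former are integrated by closing the contour with a large arc; the latter become Dirichlet
  integrals in \<open>k\<^sup>2\<close> and return a quarter of \<open>\<pi>\<close> times the value of the kernel on the diagonal.
\<close>

section \<open>Truncated integrals along the contour\<close>

text \<open>Each formula returns its boundary value in two halves: one comes from the arc at
  infinity, through the coefficient of 1/k, the other from the diagonal value of \<open>L1\<close>
  or \<open>M1\<close>. In the Dirichlet case the arc also returns a nonlocal multiple of
  \<integral> |q|^2 dx, and the two terms with \<open>M2\<close> in the integrand are what cancels
  it. Two difficulties fix the estimates. Both c(k) and c(-k) enter each integrand, so the expansion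
  of c must hold uniformly in all directions, with a remainder measured by the larger of 1 and
  |e^{2ikL}|. And the end of the truncated contour may come within a distance of order 1/R of a zero
  of \<Delta>, where 1/|1 - e^{4ikL}| is of order R; hence the remainder after division must carry a
  factor 1/R^2, which is why c is expanded up to O(k^-3) for the Dirichlet formulas, where it is
  multiplied by k. The end point is the delicate one for the transforms too: e^{2ik^2(s-t)} is only
  controlled there because the angle of the end point is O(1/R^2), so that Im k^2 stays
  bounded.\<close>

lemma mono_crossing:
  fixes f :: "real \<Rightarrow> real"
  assumes cont: "continuous_on UNIV f" and mono: "\<And>x y. S \<le> x \<Longrightarrow> x \<le> y \<Longrightarrow> f x \<le> f y"
    and lim: "filterlim f at_top at_top" and less: "f S < R"
  obtains s where "S < s" "f s = R" "\<And>x. S \<le> x \<Longrightarrow> f x < R \<longleftrightarrow> x < s"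
proof -
  \<comment> \<open>The level \<open>R\<close> may be kept on a whole interval; the infimum picks
    its left end, the point for which \<open>f x < R\<close> means exactly
    \<open>x < s\<close>.\<close>
  define X where "X = {x. S \<le> x \<and> R \<le> f x}"
  have "\<forall>\<^sub>F x in at_top. R \<le> f x \<and> S \<le> x"
    using lim unfolding filterlim_at_top by (intro eventually_conj eventually_ge_at_top) auto
  then have ne: "X \<noteq> {}"
    unfolding X_def eventually_at_top_linorder by auto
  have bdd: "bdd_below X" by (auto simp: X_def bdd_below_def)
  have "closed X" unfolding X_def
    by (intro closed_Collect_conj closed_Collect_le continuous_intros cont)
  then have sX: "Inf X \<in> X" using closed_contains_Inf ne bdd by blast
  define s where "s = Inf X"
  have low: "f x < R" if "S \<le> x" "x < s" for x
    using that cInf_lower[OF _ bdd, of x] unfolding s_def X_def by force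
  have s: "S \<le> s" "R \<le> f s" using sX by (auto simp: X_def s_def)
  obtain x where x: "S \<le> x" "x \<le> s" "f x = R"
    using IVT'[of f S R s] s less continuous_on_subset[OF cont] by auto
  have fs: "f s = R" using x low[of x] by (cases "x = s") auto
  show ?thesis
  proof
    show "S < s" using s less fs by (cases "S = s") auto
    show "f x < R \<longleftrightarrow> x < s" if "S \<le> x" for x
      using mono[of s x] s low that fs by (cases "x < s") auto
  qed (rule fs)
qed

text \<open>A crude form of Jordan's inequality, whose sharp constant is 2/\<pi>: up to \<pi>/3 the
  difference of the sides has derivative at least 1/4; beyond it the sine is at least sin(\<pi>/3) >
  0.8 while \<open>x / 4\<close> is below 1/2.\<close>

lemma sin_ge_quarter:
  fixes x :: real
  assumes "0 \<le> x" "x \<le> pi / 2"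
  shows "x / 4 \<le> sin x"
proof (cases "x \<le> pi / 3")
  case True
  have "sin 0 - 0 / 4 \<le> sin x - x / 4"
  proof (rule DERIV_nonneg_imp_nondecreasing[OF assms(1)])
    fix y assume "0 \<le> y" "y \<le> x"
    then have "cos (pi / 3) \<le> cos y" using True by (subst cos_mono_le_eq) auto
    then show "\<exists>d. ((\<lambda>y. sin y - y / 4) has_real_derivative d) (at y) \<and> 0 \<le> d"
      by (intro exI[of _ "cos y - 1 / 4"]) (auto intro!: derivative_eq_intros simp: cos_60)
  qed
  then show ?thesis by simp
next
  case False
  then have "sin (pi / 3) \<le> sin x" using assms by (intro sin_monotone_2pi_le) auto
  moreover have "(1.7::real) \<le> sqrt 3" by (rule real_le_rsqrt) (simp add: power2_eq_square)
  ultimately show ?thesis using assms pi_less_4 by (simp add: sin_60)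
qed

lemma contour_D1_continuous:
  assumes "contour_D1 L \<gamma>"
  shows "continuous_on UNIV \<gamma>"
proof -
  have "continuous_on {a..b} \<gamma>" for a b
    using assms by (auto simp: contour_D1_def piecewise_C1_differentiable_on_def)
  then have "isCont \<gamma> x" for x
    by (rule continuous_on_interior[of "{x - 1..x + 1}"]) simp_all
  then show ?thesis by (simp add: continuous_at_imp_continuous_on)
qed

text \<open>Outside a compact parameter interval the modulus is monotone on either side, so for
  \<open>R\<close> above its maximum on that interval the part |k| < R is cut out by one crossing on
  each side. The left crossing lies on the imaginary axis; at the right one the bound on Re k Im k
  forces the angle to be O(1/R^2).\<close>

lemma contour_D1_ends:
  assumes con: "contour_D1 L \<gamma>"
  obtains s1 s2 \<theta> :: "real \<Rightarrow> real" and C c :: real where "0 \<le> C" "0 < c"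
    "\<forall>\<^sub>F R in at_top. s1 R \<le> s2 R \<and> {s. cmod (\<gamma> s) < R} = {s1 R<..<s2 R} \<and>
       \<gamma> (s1 R) = \<i> * of_real R \<and> \<gamma> (s2 R) = of_real R * cis (\<theta> R) \<and>
       0 \<le> \<theta> R \<and> \<theta> R \<le> pi / 2 \<and> \<theta> R * R\<^sup>2 \<le> C \<and>
       (\<forall>n::nat. c \<le> (1 + R) * dist (of_real R * cis (\<theta> R)) (of_real (real n * pi / (2 * L))))"
proof -
  define f where "f s = cmod (\<gamma> s)" for s
  have cg: "continuous_on UNIV \<gamma>" by (rule contour_D1_continuous[OF con])
  have cf: "continuous_on UNIV f" unfolding f_def by (intro continuous_intros cg)
  have quad: "0 \<le> Re (\<gamma> s)" "0 \<le> Im (\<gamma> s)" for s using con by (auto simp: contour_D1_def)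
  from con obtain S0 where S0: "\<And>s. s \<le> S0 \<Longrightarrow> Re (\<gamma> s) = 0" by (auto simp: contour_D1_def)
  from con obtain Sm where Sm: "antimono_on {..- Sm} (\<lambda>s. cmod (\<gamma> s))" "mono_on {Sm..} (\<lambda>s. cmod (\<gamma> s))"
    by (auto simp: contour_D1_def)
  from con obtain C0 where C0: "\<And>s. Re (\<gamma> s) * Im (\<gamma> s) \<le> C0" by (auto simp: contour_D1_def)
  from con obtain c where c: "c > 0"
      "\<And>s n::nat. c \<le> (1 + cmod (\<gamma> s)) * dist (\<gamma> s) (of_real (real n * pi / (2 * L)))"
    by (auto simp: contour_D1_def)
  have limR: "filterlim (\<lambda>s. Re (\<gamma> s)) at_top at_top" and limI: "filterlim (\<lambda>s. Im (\<gamma> s)) at_top at_bot"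
    using con by (auto simp: contour_D1_def)
  have lim1: "filterlim f at_top at_top"
    by (rule filterlim_at_top_mono[OF limR]) (auto simp: f_def complex_Re_le_cmod)
  have lim2: "filterlim f at_top at_bot"
    by (rule filterlim_at_top_mono[OF limI]) (auto simp: f_def abs_Im_le_cmod order_trans[OF abs_ge_self])
  have lim3: "filterlim (\<lambda>s. f (- s)) at_top at_top"
    using lim2 by (simp add: filterlim_at_bot_mirror)
  define S where "S = Max {0, \<bar>S0\<bar>, \<bar>Sm\<bar>}"
  have S: "0 \<le> S" "- S \<le> S0" "Sm \<le> S" by (auto simp: S_def)
  have "compact (f ` {- S..S})"
    by (intro compact_continuous_image continuous_on_subset[OF cf]) auto
  then obtain B0 where "\<forall>y\<in>f ` {- S..S}. norm y \<le> B0"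
    by (metis compact_imp_bounded bounded_iff)
  then have B: "f s < B0 + 1" if "s \<in> {- S..S}" for s
    using that by force
  have ex1: "\<exists>s. S < s \<and> f s = R \<and> (\<forall>x\<ge>S. f x < R \<longleftrightarrow> x < s)" if "B0 + 1 < R" for R
  proof (rule mono_crossing[OF cf _ lim1, of S R])
    show "f x \<le> f y" if "S \<le> x" "x \<le> y" for x y
      using Sm(2) S that by (auto simp: f_def intro: mono_onD)
  qed (use B[of S] S that in auto)
  have ex2: "\<exists>s. s < -S \<and> f s = R \<and> (\<forall>x\<le>-S. f x < R \<longleftrightarrow> s < x)" if BR: "B0 + 1 < R" for R
  proof -
    have cf': "continuous_on UNIV (\<lambda>s. f (- s))"
      by (rule continuous_on_compose2[OF cf]) (auto intro!: continuous_intros)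
    obtain s where s: "S < s" "f (- s) = R" "\<And>x. S \<le> x \<Longrightarrow> f (- x) < R \<longleftrightarrow> x < s"
    proof (rule mono_crossing[OF cf' _ lim3, of S R])
      show "f (- x) \<le> f (- y)" if "S \<le> x" "x \<le> y" for x y
        using Sm(1) S that by (auto simp: f_def monotone_on_def)
    qed (use B[of "-S"] S BR in auto)
    show ?thesis
    proof (intro exI[of _ "- s"] conjI allI impI)
      show "f x < R \<longleftrightarrow> - s < x" if "x \<le> - S" for x
        using s(3)[of "- x"] that by auto
    qed (use s in auto)
  qed
  from ex1 obtain s2 where s2: "\<And>R. B0 + 1 < R \<Longrightarrow> S < s2 R \<and> f (s2 R) = R \<and> (\<forall>x\<ge>S. f x < R \<longleftrightarrow> x < s2 R)"
    by metis
  from ex2 obtain s1 where s1: "\<And>R. B0 + 1 < R \<Longrightarrow> s1 R < -S \<and> f (s1 R) = R \<and> (\<forall>x\<le>-S. f x < R \<longleftrightarrow> s1 R < x)"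
    by metis
  define \<theta> where "\<theta> R = Arg (\<gamma> (s2 R))" for R
  obtain X where X: "\<And>x. X \<le> x \<Longrightarrow> 1 \<le> Re (\<gamma> x)"
    using limR unfolding filterlim_at_top eventually_at_top_linorder by auto
  have "compact (f ` {- \<bar>X\<bar>..\<bar>X\<bar>})"
    by (intro compact_continuous_image continuous_on_subset[OF cf]) auto
  then obtain B'0 where "\<forall>y\<in>f ` {- \<bar>X\<bar>..\<bar>X\<bar>}. norm y \<le> B'0"
    by (metis compact_imp_bounded bounded_iff)
  then have B': "f s < B'0 + 1" if "s \<in> {- \<bar>X\<bar>..\<bar>X\<bar>}" for s
    using that by force
  \<comment> \<open>A factor 2 comes from Re k \<ge> R/2 at the right crossing, a factor 4 from
    \<open>\<theta> / 4 \<le> sin \<theta>\<close>.\<close>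
  define C where "C = 8 * \<bar>C0\<bar>"
  show ?thesis
  proof
    show "0 \<le> C" "0 < c" by (auto simp: C_def c)
    show "\<forall>\<^sub>F R in at_top. s1 R \<le> s2 R \<and> {s. cmod (\<gamma> s) < R} = {s1 R<..<s2 R} \<and>
       \<gamma> (s1 R) = \<i> * of_real R \<and> \<gamma> (s2 R) = of_real R * cis (\<theta> R) \<and>
       0 \<le> \<theta> R \<and> \<theta> R \<le> pi / 2 \<and> \<theta> R * R\<^sup>2 \<le> C \<and>
       (\<forall>n::nat. c \<le> (1 + R) * dist (of_real R * cis (\<theta> R)) (of_real (real n * pi / (2 * L))))"
      using eventually_gt_at_top[of "B0 + 1"] eventually_gt_at_top[of "B'0 + 1"] eventually_gt_at_top[of "2 + 2 * \<bar>C0\<bar>"]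
    proof eventually_elim
      case (elim R)
      note s1R = s1[OF elim(1)] and s2R = s2[OF elim(1)]
      have Rpos: "R > 2" "R > 2 * \<bar>C0\<bar>" using elim by auto
      have le: "s1 R \<le> s2 R" using s1R s2R S by auto
      have set: "cmod (\<gamma> s) < R \<longleftrightarrow> s1 R < s \<and> s < s2 R" for s
      proof -
        consider "s \<le> -S" | "-S \<le> s" "s \<le> S" | "S \<le> s" by linarith
        then show ?thesis
        proof cases
          case 1 then show ?thesis using s1R s2R S by (auto simp: f_def)
        next
          case 2 then show ?thesis using s1R s2R S B[of s] elim by (auto simp: f_def)
        next
          case 3 then show ?thesis using s1R s2R S by (auto simp: f_def)
        qed
      qed
      have g1: "\<gamma> (s1 R) = \<i> * of_real R"
      proof -
        have "Re (\<gamma> (s1 R)) = 0" using S0 s1R S by auto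
        moreover from this have "\<bar>Im (\<gamma> (s1 R))\<bar> = R" using s1R by (simp add: f_def cmod_def)
        ultimately show ?thesis using quad(2)[of "s1 R"] by (auto simp: complex_eq_iff)
      qed
      have nz: "\<gamma> (s2 R) \<noteq> 0" using s2R Rpos by (auto simp: f_def)
      have g2: "\<gamma> (s2 R) = of_real R * cis (\<theta> R)"
        using s2R rcis_cmod_Arg[of "\<gamma> (s2 R)"] by (simp add: f_def \<theta>_def rcis_def)
      have Re: "Re (\<gamma> (s2 R)) = R * cos (\<theta> R)" and Im: "Im (\<gamma> (s2 R)) = R * sin (\<theta> R)"
        by (simp_all add: g2)
      \<comment> \<open>The right crossing lies beyond \<open>X\<close>, since up to
        \<open>X\<close> the modulus stays below \<open>R\<close>. With Re k \<ge> 1 the bound on Re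
        k Im k becomes a bound on Im k alone.\<close>
      have Re1: "1 \<le> Re (\<gamma> (s2 R))"
      proof (rule X, rule ccontr)
        assume "\<not> X \<le> s2 R"
        then show False using B'[of "s2 R"] s2R S elim(2) by auto
      qed
      have th0: "0 \<le> \<theta> R"
        using quad(2)[of "s2 R"] unfolding \<theta>_def by (simp add: Arg_less_0)
      have th1: "\<theta> R \<le> pi / 2"
        using Arg_Re_nonneg[of "\<gamma> (s2 R)"] quad(1)[of "s2 R"] unfolding \<theta>_def by linarith
      have prod: "Re (\<gamma> (s2 R)) * Im (\<gamma> (s2 R)) \<le> \<bar>C0\<bar>" using C0[of "s2 R"] by linarith
      have "1 * Im (\<gamma> (s2 R)) \<le> Re (\<gamma> (s2 R)) * Im (\<gamma> (s2 R))"
        by (intro mult_right_mono Re1 quad)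
      then have Im_le: "Im (\<gamma> (s2 R)) \<le> R / 2" using prod Rpos by linarith
      have sq: "(Re (\<gamma> (s2 R)))\<^sup>2 + (Im (\<gamma> (s2 R)))\<^sup>2 = R\<^sup>2"
        using s2R by (metis cmod_power2 f_def)
      have "(Im (\<gamma> (s2 R)))\<^sup>2 \<le> (R / 2)\<^sup>2" by (intro power_mono Im_le quad)
      then have "(R / 2)\<^sup>2 \<le> (Re (\<gamma> (s2 R)))\<^sup>2" using sq zero_le_power2[of R] unfolding power_divide by (simp; linarith)
      then have Re_ge: "R / 2 \<le> Re (\<gamma> (s2 R))" using quad power2_le_imp_le by blast
      have "R / 2 * (R * sin (\<theta> R)) \<le> Re (\<gamma> (s2 R)) * Im (\<gamma> (s2 R))"
        unfolding Im[symmetric] by (intro mult_right_mono Re_ge quad)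
      then have "R\<^sup>2 * sin (\<theta> R) \<le> 2 * \<bar>C0\<bar>" using prod by (simp add: power2_eq_square)
      moreover have "\<theta> R / 4 * R\<^sup>2 \<le> sin (\<theta> R) * R\<^sup>2"
        by (intro mult_right_mono sin_ge_quarter th0 th1) auto
      ultimately have thR: "\<theta> R * R\<^sup>2 \<le> C" by (simp add: C_def mult.commute)
      have "c \<le> (1 + R) * dist (of_real R * cis (\<theta> R)) (of_real (real n * pi / (2 * L)))" for n :: nat
        using c(2)[of "s2 R" n] s2R unfolding g2[symmetric] f_def by simp
      then show ?case using le set g1 g2 th0 th1 thR by auto
    qed
  qed
qed

lemma has_lim_contour_integralI:
  assumes "\<forall>\<^sub>F R in at_top.
      ((\<lambda>s. f (\<gamma> s) * vector_derivative \<gamma> (at s)) has_integral F R) {s. cmod (\<gamma> s) < R}"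
    and "(F \<longlongrightarrow> I) at_top"
  shows "has_lim_contour_integral f I \<gamma>"
  unfolding has_lim_contour_integral_def by (intro exI[of _ F] conjI assms)

text \<open>With a single-valued primitive the truncated integrals depend only on their two end
  points. Asking the limit for every \<open>\<theta>\<close> that obeys the bounds at the ends frees
  the later limit arguments from the contour itself.\<close>

lemma has_lim_contour_integral_primitive:
  assumes con: "contour_D1 L \<gamma>"
    and P: "\<And>s. (P has_field_derivative f (\<gamma> s)) (at (\<gamma> s))"
    and lim: "\<And>\<theta> C c. 0 \<le> C \<Longrightarrow> 0 < c \<Longrightarrow>
      \<forall>\<^sub>F R in at_top. 0 \<le> \<theta> R \<and> \<theta> R \<le> pi / 2 \<and> \<theta> R * R\<^sup>2 \<le> C \<and>
       (\<forall>n::nat. c \<le> (1 + R) * dist (of_real R * cis (\<theta> R)) (of_real (real n * pi / (2 * L)))) \<Longrightarrow>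
      ((\<lambda>R. P (of_real R * cis (\<theta> R)) - P (\<i> * of_real R)) \<longlongrightarrow> I) at_top"
  shows "has_lim_contour_integral f I \<gamma>"
proof -
  obtain s1 s2 \<theta> :: "real \<Rightarrow> real" and C c :: real where C: "0 \<le> C" "0 < c" and ev:
    "\<forall>\<^sub>F R in at_top. s1 R \<le> s2 R \<and> {s. cmod (\<gamma> s) < R} = {s1 R<..<s2 R} \<and>
       \<gamma> (s1 R) = \<i> * of_real R \<and> \<gamma> (s2 R) = of_real R * cis (\<theta> R) \<and>
       0 \<le> \<theta> R \<and> \<theta> R \<le> pi / 2 \<and> \<theta> R * R\<^sup>2 \<le> C \<and>
       (\<forall>n::nat. c \<le> (1 + R) * dist (of_real R * cis (\<theta> R)) (of_real (real n * pi / (2 * L))))"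
    by (rule contour_D1_ends[OF con])
  have "((\<lambda>R. P (of_real R * cis (\<theta> R)) - P (\<i> * of_real R)) \<longlongrightarrow> I) at_top"
  proof (rule lim[of C c \<theta>, OF C])
    show "\<forall>\<^sub>F R in at_top. 0 \<le> \<theta> R \<and> \<theta> R \<le> pi / 2 \<and> \<theta> R * R\<^sup>2 \<le> C \<and>
       (\<forall>n::nat. c \<le> (1 + R) * dist (of_real R * cis (\<theta> R)) (of_real (real n * pi / (2 * L))))"
      using ev by eventually_elim (elim conjE, intro conjI)
  qed
  moreover have "\<forall>\<^sub>F R in at_top. ((\<lambda>s. f (\<gamma> s) * vector_derivative \<gamma> (at s)) has_integral
      (P (of_real R * cis (\<theta> R)) - P (\<i> * of_real R))) {s. cmod (\<gamma> s) < R}"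
    using ev
  proof eventually_elim
    case (elim R)
    have "((\<lambda>s. f (\<gamma> s) * vector_derivative \<gamma> (at s within {s1 R..s2 R})) has_integral
        (P (\<gamma> (s2 R)) - P (\<gamma> (s1 R)))) {s1 R..s2 R}"
    proof (rule contour_integral_primitive_lemma[where S = "range \<gamma>"])
      show "\<gamma> piecewise_differentiable_on {s1 R..s2 R}"
        using con by (simp add: contour_D1_def piecewise_C1_imp_differentiable)
      show "(P has_field_derivative f x) (at x within range \<gamma>)" if "x \<in> range \<gamma>" for x
        using that P by (auto intro: has_field_derivative_at_within)
    qed (use elim in simp_all)
    then have "((\<lambda>s. f (\<gamma> s) * vector_derivative \<gamma> (at s within {s1 R..s2 R})) has_integral
        (P (\<gamma> (s2 R)) - P (\<gamma> (s1 R)))) {s1 R<..<s2 R}"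
      by (simp add: has_integral_Icc_iff_Ioo)
    then have "((\<lambda>s. f (\<gamma> s) * vector_derivative \<gamma> (at s)) has_integral
        (P (\<gamma> (s2 R)) - P (\<gamma> (s1 R)))) {s1 R<..<s2 R}"
    proof (rule has_integral_eq[rotated])
      fix s assume "s \<in> {s1 R<..<s2 R}"
      then have "at s within {s1 R..s2 R} = at s" by (intro at_within_Icc_at) auto
      then show "f (\<gamma> s) * vector_derivative \<gamma> (at s within {s1 R..s2 R}) =
          f (\<gamma> s) * vector_derivative \<gamma> (at s)" by simp
    qed
    then show ?case using elim by (metis (no_types))
  qed
  ultimately show ?thesis by (rule has_lim_contour_integralI[rotated])
qed

section \<open>Linearity of the limit integral\<close>

lemma has_lim_contour_integralE:
  assumes "has_lim_contour_integral f I \<gamma>"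
  obtains F where "\<forall>\<^sub>F R in at_top.
      ((\<lambda>s. f (\<gamma> s) * vector_derivative \<gamma> (at s)) has_integral F R) {s. cmod (\<gamma> s) < R}"
    "(F \<longlongrightarrow> I) at_top"
  using assms unfolding has_lim_contour_integral_def by (elim exE conjE)

lemma has_lim_contour_integral_add:
  assumes "has_lim_contour_integral f I \<gamma>" "has_lim_contour_integral g J \<gamma>"
  shows "has_lim_contour_integral (\<lambda>k. f k + g k) (I + J) \<gamma>"
proof -
  obtain F where F: "\<forall>\<^sub>F R in at_top.
      ((\<lambda>s. f (\<gamma> s) * vector_derivative \<gamma> (at s)) has_integral F R) {s. cmod (\<gamma> s) < R}"
      "(F \<longlongrightarrow> I) at_top"
    by (rule has_lim_contour_integralE[OF assms(1)])
  obtain G where G: "\<forall>\<^sub>F R in at_top.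
      ((\<lambda>s. g (\<gamma> s) * vector_derivative \<gamma> (at s)) has_integral G R) {s. cmod (\<gamma> s) < R}"
      "(G \<longlongrightarrow> J) at_top"
    by (rule has_lim_contour_integralE[OF assms(2)])
  show ?thesis
  proof (rule has_lim_contour_integralI)
    show "\<forall>\<^sub>F R in at_top. ((\<lambda>s. (f (\<gamma> s) + g (\<gamma> s)) * vector_derivative \<gamma> (at s)) has_integral (F R + G R))
      {s. cmod (\<gamma> s) < R}"
      using F(1) G(1)
    proof eventually_elim
      case (elim R)
      then show ?case unfolding distrib_right by (rule has_integral_add)
    qed
    show "((\<lambda>R. F R + G R) \<longlongrightarrow> I + J) at_top" by (intro tendsto_add F G)
  qed
qed

lemma has_lim_contour_integral_mult:
  assumes "has_lim_contour_integral f I \<gamma>"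
  shows "has_lim_contour_integral (\<lambda>k. c * f k) (c * I) \<gamma>"
proof -
  obtain F where F: "\<forall>\<^sub>F R in at_top.
      ((\<lambda>s. f (\<gamma> s) * vector_derivative \<gamma> (at s)) has_integral F R) {s. cmod (\<gamma> s) < R}"
      "(F \<longlongrightarrow> I) at_top"
    by (rule has_lim_contour_integralE[OF assms])
  show ?thesis
  proof (rule has_lim_contour_integralI)
    show "\<forall>\<^sub>F R in at_top. ((\<lambda>s. (c * f (\<gamma> s)) * vector_derivative \<gamma> (at s)) has_integral (c * F R))
      {s. cmod (\<gamma> s) < R}"
      using F(1)
    proof eventually_elim
      case (elim R)
      then show ?case unfolding mult.assoc by (rule has_integral_mult_right)
    qed
    show "((\<lambda>R. c * F R) \<longlongrightarrow> c * I) at_top" by (intro tendsto_intros F)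
  qed
qed

text \<open>Equality is asked on the contour only: the integrands are rewritten by dividing by
  \<open>k\<close> and \<open>Del L k\<close>, which are nonzero there but have zeros
  elsewhere.\<close>

lemma has_lim_contour_integral_cong:
  assumes "\<And>s. f (\<gamma> s) = g (\<gamma> s)" "has_lim_contour_integral f I \<gamma>" "I = J"
  shows "has_lim_contour_integral g J \<gamma>"
  using assms by (simp add: has_lim_contour_integral_def)

section \<open>Oscillatory integrals\<close>

text \<open>Substituting \<open>l = k\<^sup>2\<close>, \<open>k dk = dl / 2\<close> turns integrals of \<open>k\<close> times a transform into Fourier
  integrals; \<open>\<sigma> = -1\<close> covers the Schwarz conjugates.\<close>

definition osc :: "real \<Rightarrow> real \<Rightarrow> (real \<Rightarrow> complex) \<Rightarrow> complex \<Rightarrow> complex" where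
  "osc \<sigma> t f l = integral {-t..t} (\<lambda>s. exp (2 * \<i> * of_real \<sigma> * l * of_real (s - t)) * f s)"

lemma continuous_on_Icc_norm_bound:
  fixes f :: "real \<Rightarrow> 'a::real_normed_vector"
  assumes "continuous_on {a..b} f"
  shows "\<exists>B\<ge>0. \<forall>x\<in>{a..b}. norm (f x) \<le> B"
proof -
  have "bounded (f ` {a..b})" by (intro compact_imp_bounded compact_continuous_image assms) simp
  then obtain B where "\<forall>y\<in>f ` {a..b}. norm y \<le> B" unfolding bounded_iff ..
  then have "norm (f x) \<le> \<bar>B\<bar>" if "x \<in> {a..b}" for x using that by (smt (verit) imageI)
  then show ?thesis by (intro exI[of _ "\<bar>B\<bar>"]) simp
qed

lemma has_vector_derivative_exp_linear:
  fixes w :: complex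
  assumes "w \<noteq> 0"
  shows "((\<lambda>s. exp (w * of_real (s - t)) / w) has_vector_derivative exp (w * of_real (s - t))) (at s within S)"
proof -
  have "((\<lambda>z. exp (w * (z - of_real t)) / w) has_field_derivative exp (w * (of_real s - of_real t))) (at (of_real s))"
    using assms by (auto intro!: derivative_eq_intros)
  from has_vector_derivative_real_field[OF this] show ?thesis by simp
qed

text \<open>Derivatives are asked at interior points only, because \<open>C1_triangle\<close>
  provides those of the kernels only inside the triangle.\<close>

lemma integral_by_parts_interior:
  fixes f g f' g' :: "real \<Rightarrow> complex"
  assumes "a \<le> b" "continuous_on {a..b} f" "continuous_on {a..b} g"
    "continuous_on {a..b} f'" "continuous_on {a..b} g'"
    "\<And>x. x \<in> {a<..<b} \<Longrightarrow> (f has_vector_derivative f' x) (at x)"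
    "\<And>x. x \<in> {a<..<b} \<Longrightarrow> (g has_vector_derivative g' x) (at x)"
  shows "integral {a..b} (\<lambda>x. f' x * g x) = f b * g b - f a * g a - integral {a..b} (\<lambda>x. f x * g' x)"
proof -
  have "((\<lambda>x. f x * g' x + f' x * g x) has_integral (f b * g b - f a * g a)) {a..b}"
    by (rule fundamental_theorem_of_calculus_interior)
      (use assms in \<open>auto intro!: continuous_intros has_vector_derivative_mult\<close>)
  moreover have "((\<lambda>x. f x * g' x) has_integral integral {a..b} (\<lambda>x. f x * g' x)) {a..b}"
    by (intro integrable_integral integrable_continuous_interval continuous_intros assms)
  ultimately have "((\<lambda>x. (f x * g' x + f' x * g x) - f x * g' x) has_integral
      (f b * g b - f a * g a - integral {a..b} (\<lambda>x. f x * g' x))) {a..b}"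
    by (rule has_integral_diff)
  then show ?thesis by (simp add: integral_unique)
qed

lemma osc_holomorphic:
  assumes "continuous_on {-t..t} f"
  shows "osc \<sigma> t f holomorphic_on UNIV"
proof -
  have "(\<lambda>l. integral (cbox (-t) t) (\<lambda>s. exp (2 * \<i> * of_real \<sigma> * l * of_real (s - t)) * f s)) holomorphic_on UNIV"
  proof (rule leibniz_rule_holomorphic)
    show "((\<lambda>l. exp (2 * \<i> * of_real \<sigma> * l * of_real (s - t)) * f s) has_field_derivative
        (2 * \<i> * of_real \<sigma> * of_real (s - t)) * exp (2 * \<i> * of_real \<sigma> * l * of_real (s - t)) * f s)
        (at l within UNIV)" for l s
      by (auto intro!: derivative_eq_intros)
    show "continuous_on (UNIV \<times> cbox (- t) t) (\<lambda>(l, s).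
        (2 * \<i> * of_real \<sigma> * of_real (s - t)) * exp (2 * \<i> * of_real \<sigma> * l * of_real (s - t)) * f s)"
      unfolding split_beta
      by (intro continuous_intros continuous_on_compose2[OF assms continuous_on_snd]) auto
    show "(\<lambda>s. exp (2 * \<i> * of_real \<sigma> * l * of_real (s - t)) * f s) integrable_on cbox (- t) t" for l
      by (intro integrable_continuous continuous_intros) (use assms in auto)
  qed auto
  then show ?thesis by (simp add: osc_def[abs_def])
qed

text \<open>One integration by parts gains the factor 1/|l|. On the strip the exponential stays
  below exp(4 |\<eta>| t), since t - s is at most 2t.\<close>

lemma osc_decay:
  assumes t: "0 < t" and \<sigma>: "\<bar>\<sigma>\<bar> = 1"
    and f: "continuous_on {-t..t} f" "continuous_on {-t..t} f'"
      "\<And>s. s \<in> {-t<..<t} \<Longrightarrow> (f has_vector_derivative f' s) (at s)"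
  shows "\<exists>C. \<forall>l. \<bar>Im l\<bar> \<le> \<eta> \<longrightarrow> l \<noteq> 0 \<longrightarrow> cmod (osc \<sigma> t f l) \<le> C / cmod l"
proof -
  obtain B0 where B00: "0 \<le> B0" "\<forall>s\<in>{-t..t}. cmod (f s) \<le> B0"
    using continuous_on_Icc_norm_bound[OF f(1)] by (elim exE conjE)
  have B0: "cmod (f s) \<le> B0" if "s \<in> {-t..t}" for s by (rule bspec[OF B00(2) that])
  obtain B1 where B10: "0 \<le> B1" "\<forall>s\<in>{-t..t}. cmod (f' s) \<le> B1"
    using continuous_on_Icc_norm_bound[OF f(2)] by (elim exE conjE)
  have B1: "cmod (f' s) \<le> B1" if "s \<in> {-t..t}" for s by (rule bspec[OF B10(2) that])
  define M where "M = exp (4 * \<bar>\<eta>\<bar> * t)"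
  have "cmod (osc \<sigma> t f l) \<le> (M * B0 + M * B1 * t) / cmod l" if l: "\<bar>Im l\<bar> \<le> \<eta>" "l \<noteq> 0" for l
  proof -
    define w where "w = 2 * \<i> * of_real \<sigma> * l"
    have w: "w \<noteq> 0" "cmod w = 2 * cmod l" using l \<sigma> by (auto simp: w_def norm_mult)
    define E where "E s = exp (w * of_real (s - t)) / w" for s :: real
    have E: "cmod (E s) \<le> M / (2 * cmod l)" if s: "s \<in> {-t..t}" for s
    proof -
      have "Re (w * of_real (s - t)) = 2 * (\<sigma> * Im l) * (t - s)"
        by (simp add: w_def algebra_simps)
      also have "\<dots> \<le> 2 * \<bar>\<sigma> * Im l\<bar> * (t - s)"
        using s by (intro mult_right_mono mult_left_mono) auto
      also have "\<dots> \<le> 2 * \<bar>\<eta>\<bar> * (2 * t)"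
        using s l \<sigma> by (intro mult_mono) (auto simp: abs_mult)
      finally show ?thesis
        unfolding E_def norm_divide norm_exp_eq_Re w M_def by (intro divide_right_mono) auto
    qed
    have eq: "integral {-t..t} (\<lambda>s. exp (w * of_real (s - t)) * f s) =
        E t * f t - E (-t) * f (-t) - integral {-t..t} (\<lambda>s. E s * f' s)"
    proof (rule integral_by_parts_interior)
      show "(E has_vector_derivative exp (w * of_real (s - t))) (at s)" for s
        unfolding E_def using w by (intro has_vector_derivative_exp_linear)
      show "continuous_on {-t..t} E" unfolding E_def using w by (intro continuous_intros) auto
    qed (use t f in \<open>auto intro!: continuous_intros\<close>)
    have "cmod (integral {-t..t} (\<lambda>s. E s * f' s)) \<le> M / (2 * cmod l) * B1 * (t - (- t))"
    proof (rule integral_bound)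
      show "continuous_on {- t..t} (\<lambda>s. E s * f' s)"
        unfolding E_def using w f by (intro continuous_intros) auto
      show "cmod (E s * f' s) \<le> M / (2 * cmod l) * B1" if "s \<in> {-t..t}" for s
        unfolding norm_mult using that by (intro mult_mono E B1) (auto simp: M_def)
    qed (use t in auto)
    moreover have Ef: "cmod (E s * f s) \<le> M / (2 * cmod l) * B0" if "s \<in> {-t..t}" for s
      unfolding norm_mult using that by (intro mult_mono E B0) (auto simp: M_def)
    moreover have "cmod (E t * f t) \<le> M / (2 * cmod l) * B0" "cmod (E (-t) * f (-t)) \<le> M / (2 * cmod l) * B0"
      using Ef[of t] Ef[of "-t"] t by simp_all
    ultimately have "cmod (integral {-t..t} (\<lambda>s. exp (w * of_real (s - t)) * f s)) \<le>
        M / (2 * cmod l) * B0 + M / (2 * cmod l) * B0 + M / (2 * cmod l) * B1 * (t - (- t))"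
      unfolding eq using norm_triangle_ineq4[of "E t * f t - E (-t) * f (-t)" "integral {-t..t} (\<lambda>s. E s * f' s)"]
        norm_triangle_ineq4[of "E t * f t" "E (-t) * f (-t)"] by linarith
    also have "\<dots> = (M * B0 + M * B1 * t) / cmod l" using l(2) by (simp add: field_simps)
    finally show ?thesis by (simp add: osc_def w_def)
  qed
  then show ?thesis by blast
qed

lemma Si_0 [simp]: "Si 0 = 0"
  by (simp add: Si_def zero_ereal_def)

text \<open>Integrating over \<open>x\<close> first gives the Dirichlet kernel 2X sinc(2X(t - s)),
  whose primitive in \<open>s\<close> is -Si(2X(t - s)); integration by parts in \<open>s\<close>
  follows. The sign \<open>\<sigma>\<close> disappears because the interval in \<open>x\<close> is
  symmetric.\<close>

lemma integral_osc:
  assumes t: "0 < t" and \<sigma>: "\<bar>\<sigma>\<bar> = 1" and X: "0 \<le> X"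
    and f: "continuous_on {-t..t} f" "continuous_on {-t..t} f'"
      "\<And>s. s \<in> {-t<..<t} \<Longrightarrow> (f has_vector_derivative f' s) (at s)"
  shows "integral {-X..X} (\<lambda>x. osc \<sigma> t f (of_real x)) =
    of_real (Si (4 * X * t)) * f (-t) + integral {-t..t} (\<lambda>s. of_real (Si (2 * X * (t - s))) * f' s)"
proof -
  have inner: "integral {-X..X} (\<lambda>x. exp (2 * \<i> * of_real \<sigma> * of_real x * of_real (s - t)) * f s) =
      of_real (2 * X * sinc (2 * X * (t - s))) * f s" for s
  proof (cases "s = t")
    case True
    then show ?thesis using X by (simp add: scaleR_conv_of_real)
  next
    case False
    define v where "v = 2 * \<i> * of_real \<sigma> * of_real (s - t)"
    have v: "v \<noteq> 0" using False \<sigma> by (auto simp: v_def)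
    have "((\<lambda>x. exp (v * of_real x) * f s) has_integral
        (exp (v * of_real X) / v * f s - exp (v * of_real (-X)) / v * f s)) {-X..X}"
      using X has_vector_derivative_mult_left[OF has_vector_derivative_exp_linear[OF v, of 0]]
      by (intro fundamental_theorem_of_calculus) simp_all
    then have "integral {-X..X} (\<lambda>x. exp (v * of_real x) * f s) =
       exp (v * of_real X) / v * f s - exp (v * of_real (-X)) / v * f s"
      by (rule integral_unique)
    then have eq1: "integral {-X..X} (\<lambda>x. exp (v * of_real x) * f s) =
       (exp (v * of_real X) - exp (v * of_real (-X))) / v * f s"
      by (simp only: diff_divide_distrib left_diff_distrib)
    have eq2: "exp (v * of_real X) - exp (v * of_real (-X)) =
        2 * \<i> * of_real (sin (2 * \<sigma> * (s - t) * X))"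
    proof -
      have "v * of_real y = \<i> * of_real (2 * \<sigma> * (s - t) * y)" for y by (simp add: v_def)
      then have "exp (v * of_real y) = cis (2 * \<sigma> * (s - t) * y)" for y by (simp only: cis_conv_exp)
      then show ?thesis by (simp only:) (simp add: complex_eq_iff)
    qed
    have eq3: "2 * \<i> * of_real (sin (2 * \<sigma> * (s - t) * X)) / v =
        of_real (2 * X * sinc (2 * X * (t - s)))"
    proof -
      have "\<sigma> = 1 \<or> \<sigma> = -1" using \<sigma> by linarith
      then have "sin (2 * \<sigma> * (s - t) * X) / (\<sigma> * (s - t)) = 2 * X * sinc (2 * X * (t - s))"
        using False
      proof (elim disjE)
        assume "\<sigma> = 1"
        then show ?thesis using False sin_minus[of "2 * X * (t - s)"]
          by (auto simp: field_simps)
      next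
        assume "\<sigma> = -1"
        then show ?thesis using False by (auto simp: field_simps)
      qed
      moreover have "2 * \<i> * of_real (sin (2 * \<sigma> * (s - t) * X)) / v =
          of_real (sin (2 * \<sigma> * (s - t) * X) / (\<sigma> * (s - t)))"
        by (simp add: v_def)
      ultimately show ?thesis by simp
    qed
    have "2 * \<i> * of_real \<sigma> * of_real x * of_real (s - t) = v * of_real x" for x by (simp add: v_def)
    then show ?thesis by (simp only: eq1 eq2 eq3)
  qed
  have "integral {-X..X} (\<lambda>x. osc \<sigma> t f (of_real x)) = integral (cbox (-X) X) (\<lambda>x. integral (cbox (-t) t)
      (\<lambda>s. exp (2 * \<i> * of_real \<sigma> * of_real x * of_real (s - t)) * f s))"
    by (simp add: osc_def)
  also have "\<dots> = integral (cbox (-t) t) (\<lambda>s. integral (cbox (-X) X)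
      (\<lambda>x. exp (2 * \<i> * of_real \<sigma> * of_real x * of_real (s - t)) * f s))"
    by (rule integral_swap_continuous)
      (auto simp: split_beta cbox_Pair_eq intro!: continuous_intros continuous_on_compose2[OF f(1) continuous_on_snd])
  also have "\<dots> = integral {-t..t} (\<lambda>s. of_real (2 * X * sinc (2 * X * (t - s))) * f s)"
    by (simp only: inner box_real)
  also have "\<dots> = (- of_real (Si (2 * X * (t - t)))) * f t - (- of_real (Si (2 * X * (t - (-t))))) * f (-t)
      - integral {-t..t} (\<lambda>s. (- of_real (Si (2 * X * (t - s)))) * f' s)"
  proof (rule integral_by_parts_interior)
    have d: "((\<lambda>s. - of_real (Si (2 * X * (t - s)))) has_vector_derivative
        (of_real (2 * X * sinc (2 * X * (t - s))) :: complex)) (at s)" for s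
    proof -
      have "((\<lambda>s. - Si (2 * X * (t - s))) has_real_derivative - (sinc (2 * X * (t - s)) * - (2 * X))) (at s)"
        by (rule derivative_eq_intros DERIV_chain2[OF DERIV_Si] refl | simp)+
      then have "((\<lambda>s. complex_of_real (- Si (2 * X * (t - s)))) has_vector_derivative
          of_real (- (sinc (2 * X * (t - s)) * - (2 * X)))) (at s)"
        by (intro has_vector_derivative_of_real) (simp add: has_real_derivative_iff_has_vector_derivative)
      then show ?thesis by (simp add: mult_ac)
    qed
    show "((\<lambda>s. - of_real (Si (2 * X * (t - s)))) has_vector_derivative
        (of_real (2 * X * sinc (2 * X * (t - s))) :: complex)) (at s)" for s by (rule d)
    show "continuous_on {-t..t} (\<lambda>s. - of_real (Si (2 * X * (t - s))) :: complex)"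
      by (rule continuous_on_vector_derivative) (rule has_vector_derivative_at_within[OF d])
    show "continuous_on {-t..t} (\<lambda>s. of_real (2 * X * sinc (2 * X * (t - s))) :: complex)"
      by (intro continuous_intros)
  qed (use t f in auto)
  finally show ?thesis by (simp add: algebra_simps)
qed

text \<open>The Dirichlet kernel concentrates at the end point s = t, so only half of its mass \<pi>
  falls into the interval. Si is bounded with limit \<pi>/2, hence dominated convergence applies,
  and the fundamental theorem turns the value at -t and the integral of \<open>f'\<close> into
  \<open>f t\<close>.\<close>

lemma integral_osc_tendsto:
  assumes t: "0 < t" and \<sigma>: "\<bar>\<sigma>\<bar> = 1"
    and f: "continuous_on {-t..t} f" "continuous_on {-t..t} f'"
      "\<And>s. s \<in> {-t<..<t} \<Longrightarrow> (f has_vector_derivative f' s) (at s)"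
  shows "((\<lambda>X. integral {-X..X} (\<lambda>x. osc \<sigma> t f (of_real x))) \<longlongrightarrow> of_real (pi / 2) * f t) at_top"
proof (rule tendsto_at_topI_sequentially)
  fix X :: "nat \<Rightarrow> real" assume X: "filterlim X at_top sequentially"
  have Si_lim: "(\<lambda>n. complex_of_real (Si (a * X n))) \<longlonglongrightarrow> of_real (pi / 2)" if "a > 0" for a
    using that by (intro tendsto_of_real filterlim_compose[OF Si_at_top]
      filterlim_tendsto_pos_mult_at_top[OF tendsto_const _ X])
  obtain B0 where B0: "\<And>T. \<bar>Si T\<bar> \<le> B0" using bounded_Si by blast
  have B0_nonneg: "0 \<le> B0" using order_trans[OF abs_ge_zero B0] .
  obtain B1 where B10: "0 \<le> B1" "\<forall>s\<in>{-t..t}. cmod (f' s) \<le> B1"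
    using continuous_on_Icc_norm_bound[OF f(2)] by (elim exE conjE)
  have B1: "cmod (f' s) \<le> B1" if "s \<in> {-t..t}" for s by (rule bspec[OF B10(2) that])
  have cSi: "continuous_on S Si" for S
    by (intro continuous_at_imp_continuous_on ballI isCont_Si)
  \<comment> \<open>The open interval leaves out s = t, where Si(0) = 0 for every n and the
    pointwise limit would fail.\<close>
  have "(\<lambda>n. integral {-t<..<t} (\<lambda>s. of_real (Si (2 * X n * (t - s))) * f' s)) \<longlonglongrightarrow>
      integral {-t<..<t} (\<lambda>s. of_real (pi / 2) * f' s)"
  proof (rule dominated_convergence)
    show "(\<lambda>s. of_real (Si (2 * X n * (t - s))) * f' s) integrable_on {-t<..<t}" for n
      unfolding integrable_on_Icc_iff_Ioo[symmetric]
      by (intro integrable_continuous_interval continuous_intros continuous_on_compose2[OF cSi] f) auto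
    show "(\<lambda>s. B0 * B1) integrable_on {-t<..<t}"
      unfolding integrable_on_Icc_iff_Ioo[symmetric] by (intro integrable_continuous_interval continuous_intros)
    show "cmod (of_real (Si (2 * X n * (t - s))) * f' s) \<le> B0 * B1" if "s \<in> {-t<..<t}" for n s
      using that by (auto simp: norm_mult intro!: mult_mono B0 B1 B0_nonneg)
    show "(\<lambda>n. of_real (Si (2 * X n * (t - s))) * f' s) \<longlonglongrightarrow> of_real (pi / 2) * f' s"
      if "s \<in> {-t<..<t}" for s
      using Si_lim[of "2 * (t - s)"] that by (intro tendsto_mult tendsto_const) (simp add: mult_ac)
  qed
  then have "(\<lambda>n. of_real (Si (4 * X n * t)) * f (-t) +
      integral {-t..t} (\<lambda>s. of_real (Si (2 * X n * (t - s))) * f' s)) \<longlonglongrightarrow>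
      of_real (pi / 2) * f (-t) + integral {-t..t} (\<lambda>s. of_real (pi / 2) * f' s)"
    unfolding integral_open_interval_real[symmetric]
    using Si_lim[of "4 * t"] t by (intro tendsto_add tendsto_mult tendsto_const) (simp_all add: mult_ac)
  moreover have "of_real (pi / 2) * f (-t) + integral {-t..t} (\<lambda>s. of_real (pi / 2) * f' s) = of_real (pi / 2) * f t"
  proof -
    have "(f' has_integral (f t - f (-t))) {-t..t}"
      using t f by (intro fundamental_theorem_of_calculus_interior) auto
    then have "integral {-t..t} f' = f t - f (-t)" by (rule integral_unique)
    then have ft: "f t = f (-t) + integral {-t..t} f'" by simp
    show ?thesis unfolding ft by (simp only: integral_mult_right distrib_left)
  qed
  ultimately have lim: "(\<lambda>n. of_real (Si (4 * X n * t)) * f (-t) +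
      integral {-t..t} (\<lambda>s. of_real (Si (2 * X n * (t - s))) * f' s)) \<longlonglongrightarrow> of_real (pi / 2) * f t" by (simp only:)
  have evX: "\<forall>\<^sub>F n in sequentially. 0 \<le> X n" using X by (simp add: filterlim_at_top)
  show "(\<lambda>n. integral {- X n..X n} (\<lambda>x. osc \<sigma> t f (of_real x))) \<longlonglongrightarrow> of_real (pi / 2) * f t"
  proof (rule Lim_transform_eventually[OF lim])
    show "\<forall>\<^sub>F n in sequentially. of_real (Si (4 * X n * t)) * f (-t) +
        integral {-t..t} (\<lambda>s. of_real (Si (2 * X n * (t - s))) * f' s) =
        integral {- X n..X n} (\<lambda>x. osc \<sigma> t f (of_real x))"
      using evX by eventually_elim (rule integral_osc[OF t \<sigma> _ f, symmetric], auto)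
  qed
qed

text \<open>Under l = k^2 the end points become R^2 e^{2i\<theta>} and -R^2. The difference of the
  primitive is the integral over the real interval from -R^2 to R^2 plus a short arc at its right
  end, which vanishes in the limit; k dk = dl/2 halves \<pi>/2.\<close>

lemma has_lim_contour_integral_osc:
  assumes con: "contour_D1 L \<gamma>" and t: "0 < t" and \<sigma>: "\<bar>\<sigma>\<bar> = 1"
    and f: "continuous_on {-t..t} f" "continuous_on {-t..t} f'"
      "\<And>s. s \<in> {-t<..<t} \<Longrightarrow> (f has_vector_derivative f' s) (at s)"
  shows "has_lim_contour_integral (\<lambda>k. k * osc \<sigma> t f (k\<^sup>2)) (of_real (pi / 4) * f t) \<gamma>"
proof -
  obtain Q where Q: "\<And>l. (Q has_field_derivative osc \<sigma> t f l) (at l)"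
    using holomorphic_convex_primitive'[OF convex_UNIV open_UNIV osc_holomorphic[OF f(1)], of \<sigma>] by auto
  show ?thesis
  proof (rule has_lim_contour_integral_primitive[OF con, where P = "\<lambda>k. Q (k\<^sup>2) / 2"])
    show "((\<lambda>k. Q (k\<^sup>2) / 2) has_field_derivative \<gamma> s * osc \<sigma> t f ((\<gamma> s)\<^sup>2)) (at (\<gamma> s))" for s
      by (auto intro!: derivative_eq_intros DERIV_chain2[OF Q])
  next
    fix \<theta> :: "real \<Rightarrow> real" and C c :: real
    assume C: "0 \<le> C" "0 < c" and ev: "\<forall>\<^sub>F R in at_top. 0 \<le> \<theta> R \<and> \<theta> R \<le> pi / 2 \<and> \<theta> R * R\<^sup>2 \<le> C \<and>
       (\<forall>n::nat. c \<le> (1 + R) * dist (of_real R * cis (\<theta> R)) (of_real (real n * pi / (2 * L))))"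
    \<comment> \<open>On the short arc |Im l| \<le> R^2 * 2\<theta> \<le> 2C, so the decay on the
      strip of half-width \<open>2 * C\<close> is available.\<close>
    obtain K where K: "\<And>l. \<bar>Im l\<bar> \<le> 2 * C \<Longrightarrow> l \<noteq> 0 \<Longrightarrow> cmod (osc \<sigma> t f l) \<le> K / cmod l"
      using osc_decay[OF t \<sigma> f] by metis
    have ev2: "\<forall>\<^sub>F R in at_top. cmod (Q (of_real (R\<^sup>2) * cis (2 * \<theta> R)) - Q (of_real (R\<^sup>2))) \<le> \<bar>K\<bar> * (2 * C) / R\<^sup>2"
      using ev eventually_gt_at_top[of 0]
    proof eventually_elim
      case (elim R)
      \<comment> \<open>In the variable w = log(l / R^2) the arc is a segment of length 2\<theta> =
        O(1/R^2); the derivative along it is \<open>osc \<sigma> t f l * l\<close>, which the decay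
        bounds by a constant.\<close>
      define S where "S = closed_segment 0 (\<i> * of_real (2 * \<theta> R))"
      have "cmod (Q (of_real (R\<^sup>2) * exp (\<i> * of_real (2 * \<theta> R))) - Q (of_real (R\<^sup>2) * exp 0)) \<le>
          \<bar>K\<bar> * cmod (\<i> * of_real (2 * \<theta> R) - 0)"
      proof (rule field_differentiable_bound[where S = S])
        show "((\<lambda>w. Q (of_real (R\<^sup>2) * exp w)) has_field_derivative
            osc \<sigma> t f (of_real (R\<^sup>2) * exp w) * (of_real (R\<^sup>2) * exp w)) (at w within S)" for w
          by (auto intro!: derivative_eq_intros DERIV_chain2[OF Q])
        show "cmod (osc \<sigma> t f (of_real (R\<^sup>2) * exp w) * (of_real (R\<^sup>2) * exp w)) \<le> \<bar>K\<bar>" if w: "w \<in> S" for w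
        proof -
          obtain u where u: "0 \<le> u" "u \<le> 1" "w = \<i> * of_real (u * (2 * \<theta> R))"
            using w unfolding S_def closed_segment_def by (auto simp: scaleR_conv_of_real)
          define l where "l = of_real (R\<^sup>2) * exp w"
          have l: "cmod l = R\<^sup>2" using u by (simp add: l_def norm_mult norm_power)
          have "\<bar>sin (u * (2 * \<theta> R))\<bar> \<le> \<bar>u * (2 * \<theta> R)\<bar>" by (rule abs_sin_x_le_abs_x)
          also have "\<dots> \<le> 1 * (2 * \<theta> R)" using u elim by (simp add: mult_left_le_one_le)
          finally have "R\<^sup>2 * \<bar>sin (u * (2 * \<theta> R))\<bar> \<le> R\<^sup>2 * (2 * \<theta> R)" by (intro mult_left_mono) auto
          also have "\<dots> \<le> 2 * C" using elim by (simp add: mult.commute)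
          also have "R\<^sup>2 * \<bar>sin (u * (2 * \<theta> R))\<bar> = \<bar>Im l\<bar>"
            using u by (simp add: l_def Im_exp abs_mult)
          finally have "cmod (osc \<sigma> t f l) \<le> K / cmod l" using l elim by (intro K) auto
          then have "cmod (osc \<sigma> t f l * l) \<le> K" using l elim by (simp add: norm_mult field_simps)
          then show ?thesis by (simp add: l_def)
        qed
      qed (auto simp: S_def)
      also have "cmod (\<i> * of_real (2 * \<theta> R) - 0) = 2 * \<theta> R" using elim by (simp add: norm_mult)
      also have "\<bar>K\<bar> * (2 * \<theta> R) \<le> \<bar>K\<bar> * (2 * (C / R\<^sup>2))"
        using elim by (intro mult_left_mono) (auto simp: field_simps)
      finally show ?case by (simp add: cis_conv_exp)
    qed
    have "((\<lambda>R::real. \<bar>K\<bar> * (2 * C) / R\<^sup>2) \<longlongrightarrow> 0) at_top" by real_asymp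
    then have 1: "((\<lambda>R. Q (of_real (R\<^sup>2) * cis (2 * \<theta> R)) - Q (of_real (R\<^sup>2))) \<longlongrightarrow> 0) at_top"
      by (rule Lim_null_comparison[OF ev2])
    have Qint: "integral {-X..X} (\<lambda>x. osc \<sigma> t f (of_real x)) = Q (of_real X) - Q (of_real (-X))" if "0 \<le> X" for X
    proof (rule integral_unique[OF fundamental_theorem_of_calculus])
      show "((\<lambda>x. Q (of_real x)) has_vector_derivative osc \<sigma> t f (of_real x)) (at x within {-X..X})" for x
        by (rule has_vector_derivative_real_field[OF Q])
    qed (use that in auto)
    have lim_int: "((\<lambda>X. integral {-X..X} (\<lambda>x. osc \<sigma> t f (of_real x))) \<longlongrightarrow> of_real (pi / 2) * f t) at_top"
      by (rule integral_osc_tendsto[OF t \<sigma> f])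
    have "filterlim (\<lambda>R::real. R\<^sup>2) at_top at_top" by real_asymp
    from filterlim_compose[OF lim_int this]
    have 2: "((\<lambda>R. Q (of_real (R\<^sup>2)) - Q (of_real (-(R\<^sup>2)))) \<longlongrightarrow> of_real (pi / 2) * f t) at_top"
      by (simp add: Qint)
    have sq: "(complex_of_real R * cis \<phi>)\<^sup>2 = of_real (R\<^sup>2) * cis (2 * \<phi>)" for R \<phi>
      using Complex.DeMoivre[of \<phi> 2] by (simp add: power_mult_distrib)
    have "((\<lambda>R. ((Q (of_real (R\<^sup>2) * cis (2 * \<theta> R)) - Q (of_real (R\<^sup>2))) + (Q (of_real (R\<^sup>2)) - Q (of_real (-(R\<^sup>2))))) / 2)
        \<longlongrightarrow> (0 + of_real (pi / 2) * f t) / 2) at_top"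
      by (intro tendsto_intros 1 2) simp
    then show "((\<lambda>R. Q ((of_real R * cis (\<theta> R))\<^sup>2) / 2 - Q ((\<i> * of_real R)\<^sup>2) / 2) \<longlongrightarrow> of_real (pi / 4) * f t) at_top"
      unfolding sq by (simp add: power_mult_distrib diff_divide_distrib)
  qed
qed

section \<open>Meromorphic integrands with simple real poles\<close>

text \<open>A quantitative form of the simplicity of the zeros 2\<pi>in. Shift w by the zero nearest
  in imaginary part, to z = x + iy with |y| \<le> \<pi>, and use |1 - e^z|^2 = (1 - e^x)^2 + 4 e^x
  sin^2(y/2). For x \<le> -1 the modulus is at least 1/2; otherwise |x| and |y| are at most 2 and 8
  times |1 - e^z|, and 16 leaves room for both.\<close>

lemma cmod_one_minus_exp_ge:
  assumes re: "Re w \<le> 0" and dist: "\<And>n::int. \<delta> \<le> cmod (w - 2 * of_int n * of_real pi * \<i>)" and \<delta>: "\<delta> \<le> 1"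
  shows "\<delta> / 16 \<le> cmod (1 - exp w)"
proof -
  define n where "n = round (Im w / (2 * pi))"
  define z where "z = w - 2 * of_int n * of_real pi * \<i>"
  define x y where "x = Re z" and "y = Im z"
  have "exp z = exp w / exp (2 * of_int n * of_real pi * \<i>)" by (simp add: z_def exp_diff)
  also have "exp (2 * of_int n * of_real pi * \<i>) = 1" unfolding exp_eq_1 by auto
  finally have ez: "exp z = exp w" by simp
  have x: "x \<le> 0" using re by (simp add: x_def z_def)
  have "y = 2 * pi * (Im w / (2 * pi) - of_int n)" by (simp add: y_def z_def field_simps)
  moreover have "\<bar>Im w / (2 * pi) - of_int n\<bar> \<le> 1 / 2"
    using of_int_round_abs_le[of "Im w / (2 * pi)"] by (simp add: n_def abs_minus_commute)
  ultimately have y: "\<bar>y\<bar> \<le> pi" by (simp add: abs_mult)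
  have sq: "(cmod (1 - exp z))\<^sup>2 = (1 - exp x)\<^sup>2 + 4 * exp x * (sin (y / 2))\<^sup>2"
  proof -
    have c: "cos y = 1 - 2 * (sin (y / 2))\<^sup>2" using cos_double_sin[of "y / 2"] by simp
    have "(cmod (1 - exp z))\<^sup>2 = (1 - exp x * cos y)\<^sup>2 + (exp x * sin y)\<^sup>2"
      by (simp add: cmod_power2 Re_exp Im_exp x_def y_def)
    also have "\<dots> = 1 - 2 * exp x * cos y + (exp x)\<^sup>2 * ((cos y)\<^sup>2 + (sin y)\<^sup>2)"
      by algebra
    also have "\<dots> = 1 - 2 * exp x * cos y + (exp x)\<^sup>2" by simp
    also have "\<dots> = (1 - exp x)\<^sup>2 + 4 * exp x * (sin (y / 2))\<^sup>2"
      unfolding c by (simp add: power2_eq_square algebra_simps)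
    finally show ?thesis .
  qed
  have one: "1 - exp x \<le> cmod (1 - exp z)"
    by (rule power2_le_imp_le) (auto simp: sq)
  have exp_x: "exp x * (1 - x) \<le> 1"
  proof -
    have "exp x * (1 - x) \<le> exp x * exp (- x)" using exp_ge_add_one_self[of "- x"] by (intro mult_left_mono) auto
    then show ?thesis by (simp add: exp_minus)
  qed
  show ?thesis
  proof (cases "x \<le> -1")
    case True
    have "exp x * 2 \<le> exp x * (1 - x)" using True by (intro mult_left_mono) auto
    then have "exp x \<le> 1 / 2" using exp_x by linarith
    then show ?thesis using one \<delta> by (simp add: ez)
  next
    case False
    have "- x / 2 \<le> - x / (1 - x)" using x False by (intro divide_left_mono) (auto simp: mult_nonneg_nonneg)
    also have "\<dots> = 1 - 1 / (1 - x)" using x by (simp add: field_simps)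
    also have "\<dots> \<le> 1 - exp x" using exp_x x by (simp add: field_simps)
    finally have A: "\<bar>x\<bar> \<le> 2 * cmod (1 - exp z)" using one x by linarith
    have "exp (-1) \<le> exp x" using False by simp
    moreover have "1 / 3 \<le> exp (-1 :: real)" using exp_le by (simp add: exp_minus field_simps)
    ultimately have "1 / 3 \<le> exp x" by linarith
    then have "1 * (sin (y / 2))\<^sup>2 \<le> 4 * exp x * (sin (y / 2))\<^sup>2" by (intro mult_right_mono) auto
    then have "\<bar>sin (y / 2)\<bar>\<^sup>2 \<le> (cmod (1 - exp z))\<^sup>2"
      unfolding sq power2_abs using zero_le_power2[of "1 - exp x"] by linarith
    then have "\<bar>sin (y / 2)\<bar> \<le> cmod (1 - exp z)" by (rule power2_le_imp_le) auto
    moreover have "\<bar>y / 2\<bar> / 4 \<le> \<bar>sin (y / 2)\<bar>"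
      using sin_ge_quarter[of "\<bar>y / 2\<bar>"] y by (auto simp: abs_if split: if_splits)
    ultimately have B: "\<bar>y\<bar> \<le> 8 * cmod (1 - exp z)" by simp
    have "\<delta> \<le> cmod z" unfolding z_def by (rule dist)
    also have "\<dots> \<le> \<bar>x\<bar> + \<bar>y\<bar>" unfolding x_def y_def by (rule cmod_le)
    finally show ?thesis using A B norm_ge_zero[of "1 - exp z"] by (simp add: ez)
  qed
qed

section \<open>The zeros of \<Delta> and their position relative to the contour and the arc\<close>

lemma exp_eq_1_real_multiple:
  assumes "L > 0" "exp (4 * \<i> * k * of_real L) = 1"
  obtains n :: int where "k = of_real (of_int n * pi / (2 * L))"
proof -
  from assms(2) obtain n :: int where n: "Re (4 * \<i> * k * of_real L) = 0"
      "Im (4 * \<i> * k * of_real L) = of_int (2 * n) * pi"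
    unfolding exp_eq_1 by auto
  show ?thesis by (rule that[of n]) (use n assms(1) in \<open>auto simp: complex_eq_iff field_simps\<close>)
qed

lemma contour_D1_exp_neq_1:
  assumes con: "contour_D1 L \<gamma>" and L: "L > 0"
  shows "exp (4 * \<i> * \<gamma> s * of_real L) \<noteq> 1"
proof
  assume "exp (4 * \<i> * \<gamma> s * of_real L) = 1"
  then obtain n :: int where n: "\<gamma> s = of_real (of_int n * pi / (2 * L))"
    by (rule exp_eq_1_real_multiple[OF L])
  have re: "0 \<le> Re (\<gamma> s)" and ne: "\<gamma> s \<noteq> of_real (real n * pi / (2 * L))" for n
    using con by (auto simp: contour_D1_def)
  have "0 \<le> of_int n * pi / (2 * L)" using re unfolding n by simp
  then have "0 \<le> n \<or> n \<le> 0 \<and> pi \<le> 0" using L by (simp add: zero_le_divide_iff zero_le_mult_iff)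
  then have "0 \<le> n" using pi_gt_zero by linarith
  then show False using ne[of "nat n"] n by simp
qed

text \<open>A segment from \<open>\<i>\<close> to a point of the closed upper half-plane meets the real axis at most in
  that point, so the set of points visible from \<open>\<i>\<close> past the real zeros contains the contour.\<close>

lemma starlike_avoiding_real_zeros:
  assumes "L > 0"
  defines "U \<equiv> {k::complex. \<forall>z\<in>closed_segment \<i> k. exp (4 * \<i> * z * of_real L) \<noteq> 1}"
  shows "open U" "starlike U" "U \<subseteq> {k. exp (4 * \<i> * k * of_real L) \<noteq> 1}"
    "\<And>k. 0 \<le> Im k \<Longrightarrow> exp (4 * \<i> * k * of_real L) \<noteq> 1 \<Longrightarrow> k \<in> U"
proof -
  have Im_pos: "exp (4 * \<i> * z * of_real L) \<noteq> 1" if "Im z > 0" for z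
  proof
    assume "exp (4 * \<i> * z * of_real L) = 1"
    then obtain n :: int where "z = of_real (of_int n * pi / (2 * L))"
      using exp_eq_1_real_multiple[OF assms(1)] by metis
    then show False using that by simp
  qed
  \<comment> \<open>The complement of \<open>U\<close> is the projection of a closed set along the
    compact interval \<open>{0..1}\<close>, hence closed.\<close>
  have "closed {k. \<exists>u. u \<in> {0..1::real} \<and>
      (u, k) \<in> {(u, k). exp (4 * \<i> * ((1 - of_real u) * \<i> + of_real u * k) * of_real L) = 1}}"
  proof (rule closed_compact_projection)
    show "closed {(u::real, k). exp (4 * \<i> * ((1 - of_real u) * \<i> + of_real u * k) * of_real L) = 1}"
      unfolding split_beta by (intro closed_Collect_eq continuous_intros)
  qed simp
  moreover have "U = - {k. \<exists>u. u \<in> {0..1::real} \<and>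
      (u, k) \<in> {(u, k). exp (4 * \<i> * ((1 - of_real u) * \<i> + of_real u * k) * of_real L) = 1}}"
    unfolding U_def closed_segment_def by (auto simp: scaleR_conv_of_real)
  ultimately show "open U" by auto
  show "starlike U" unfolding starlike_def
  proof (intro bexI ballI subsetI)
    show "\<i> \<in> U" unfolding U_def by (auto intro!: Im_pos)
    show "y \<in> U" if "x \<in> U" "y \<in> closed_segment \<i> x" for x y
      using that subset_closed_segment[of \<i> y \<i> x] unfolding U_def by auto
  qed
  show "U \<subseteq> {k. exp (4 * \<i> * k * of_real L) \<noteq> 1}" unfolding U_def by auto
  show "k \<in> U" if k: "0 \<le> Im k" "exp (4 * \<i> * k * of_real L) \<noteq> 1" for k
    unfolding U_def
  proof safe
    fix z assume z: "z \<in> closed_segment \<i> k" "exp (4 * \<i> * z * of_real L) = 1"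
    then obtain u where u: "0 \<le> u" "u \<le> 1" "z = (1 - u) *\<^sub>R \<i> + u *\<^sub>R k" by (auto simp: closed_segment_def)
    show False
    proof (cases "u = 1")
      case True then show False using u k z by simp
    next
      case False
      then have "Im z > 0" using u k by (auto intro!: add_pos_nonneg)
      then show False using Im_pos z by blast
    qed
  qed
qed

text \<open>By the law of cosines the distance from R e^{i\<phi>} to a positive real point grows
  with \<phi>, and a negative point is farther than its mirror image. Thus the distance condition at
  the end of the contour, stated for the zeros with n \<ge> 0, controls the whole arc and all
  zeros.\<close>

lemma dist_arc_real_ge:
  assumes "0 \<le> R" "0 \<le> \<theta>" "\<theta> \<le> \<phi>" "\<phi> \<le> pi / 2"
  shows "dist (of_real R * cis \<theta>) (of_real \<bar>p\<bar>) \<le> dist (of_real R * cis \<phi>) (of_real p)"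
proof (rule power2_le_imp_le)
  have sq: "(dist (of_real R * cis \<psi>) (of_real r))\<^sup>2 = R\<^sup>2 + r\<^sup>2 - 2 * R * r * cos \<psi>" for \<psi> r
  proof -
    have "(dist (of_real R * cis \<psi>) (of_real r))\<^sup>2 = (R * cos \<psi> - r)\<^sup>2 + (R * sin \<psi>)\<^sup>2"
      by (simp add: dist_norm cmod_power2)
    also have "\<dots> = R\<^sup>2 * ((cos \<psi>)\<^sup>2 + (sin \<psi>)\<^sup>2) + r\<^sup>2 - 2 * R * r * cos \<psi>"
      by algebra
    finally show ?thesis by simp
  qed
  have c: "cos \<phi> \<le> cos \<theta>" "0 \<le> cos \<phi>" using assms by (auto intro!: cos_monotone_0_pi_le cos_ge_zero)
  have "R * (p * cos \<phi>) \<le> R * (\<bar>p\<bar> * cos \<theta>)"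
    using c assms(1) by (intro mult_left_mono mult_mono) auto
  then show "(dist (of_real R * cis \<theta>) (of_real \<bar>p\<bar>))\<^sup>2 \<le> (dist (of_real R * cis \<phi>) (of_real p))\<^sup>2"
    unfolding sq by (simp add: mult.assoc)
qed simp

text \<open>The contour is closed by the arc \<open>|k| = R\<close>.  On its part of length \<open>O(1)\<close> next to the real axis
  \<open>1 / |1 - exp (4\<i>kL)|\<close> is only \<open>O(R)\<close>, which the decay \<open>O(1/R\<^sup>2)\<close> still compensates.\<close>

lemma has_lim_contour_integral_meromorphic:
  assumes con: "contour_D1 L \<gamma>" and L: "L > 0"
    and hol: "H holomorphic_on {k. exp (4 * \<i> * k * of_real L) \<noteq> 1}"
    and bound: "\<And>k. 0 \<le> Re k \<Longrightarrow> 0 \<le> Im k \<Longrightarrow> 1 \<le> cmod k \<Longrightarrow> exp (4 * \<i> * k * of_real L) \<noteq> 1 \<Longrightarrow>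
      cmod (H k - \<alpha> / k) \<le> C0 / ((cmod k)\<^sup>2 * cmod (1 - exp (4 * \<i> * k * of_real L)))"
  shows "has_lim_contour_integral H (- (\<i> * of_real pi / 2) * \<alpha>) \<gamma>"
proof -
  define U where "U = {k::complex. \<forall>z\<in>closed_segment \<i> k. exp (4 * \<i> * z * of_real L) \<noteq> 1}"
  note U = starlike_avoiding_real_zeros[OF L, folded U_def]
  have holU: "H holomorphic_on U" using hol U(3) by (rule holomorphic_on_subset)
  obtain P where P: "\<And>k. k \<in> U \<Longrightarrow> (P has_field_derivative H k) (at k)"
    using holomorphic_starlike_primitive[OF holomorphic_on_imp_continuous_on[OF holU] U(2,1) finite.emptyI]
      holomorphic_on_imp_differentiable_at[OF holU U(1)] by auto
  \<comment> \<open>The bound at k = 2i, which is no zero of the denominator, decides the sign of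
    \<open>C0\<close>.\<close>
  have C0: "0 \<le> C0"
  proof -
    have "0 < Im (2 * \<i>)" by simp
    then have "exp (4 * \<i> * (2 * \<i>) * of_real L) \<noteq> 1" using L
      by (auto simp: exp_eq_1)
    from order_trans[OF norm_ge_zero bound[OF _ _ _ this]] show ?thesis
      using \<open>exp (4 * \<i> * (2 * \<i>) * of_real L) \<noteq> 1\<close> by (simp add: zero_le_divide_iff zero_le_mult_iff norm_mult)
  qed
  show ?thesis
  proof (rule has_lim_contour_integral_primitive[OF con, where P = P])
    fix s
    have quad: "0 \<le> Re (\<gamma> s)" "0 \<le> Im (\<gamma> s)" using con by (auto simp: contour_D1_def)
    have "exp (4 * \<i> * \<gamma> s * of_real L) \<noteq> 1" by (rule contour_D1_exp_neq_1[OF con L])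
    then show "(P has_field_derivative H (\<gamma> s)) (at (\<gamma> s))" using quad U(4) P by blast
  next
    fix \<theta> :: "real \<Rightarrow> real" and C c :: real
    assume C: "0 \<le> C" "0 < c" and ev: "\<forall>\<^sub>F R in at_top. 0 \<le> \<theta> R \<and> \<theta> R \<le> pi / 2 \<and> \<theta> R * R\<^sup>2 \<le> C \<and>
       (\<forall>n::nat. c \<le> (1 + R) * dist (of_real R * cis (\<theta> R)) (of_real (real n * pi / (2 * L))))"
    \<comment> \<open>\<open>d\<close> bounds |1 - e^{4ikL}| from below where Im k \<ge> 1, and
      \<open>K2\<close> belongs to it. \<open>K1\<close> comes from the bound L c / (8 R), valid on
      the whole arc: it is 4 L c / (1 + R) / 16 with 1 + R replaced by 2R.\<close>
    define d where "d = 1 - exp (- (4 * L))"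
    have d: "0 < d" using L by (simp add: d_def)
    define K1 where "K1 = 8 * C0 / (L * c)"
    define K2 where "K2 = C0 / d"
    have K: "0 \<le> K1" "0 \<le> K2" using C0 C d L by (auto simp: K1_def K2_def)
    have ev2: "\<forall>\<^sub>F R in at_top. cmod (P (of_real R * cis (\<theta> R)) - P (\<i> * of_real R) - \<alpha> * (\<i> * of_real (\<theta> R) - \<i> * of_real (pi / 2)))
        \<le> K1 * (4 / R) + K2 / R * (pi / 2)"
      using ev eventually_gt_at_top[of 3] eventually_gt_at_top[of "4 * L * c"]
    proof eventually_elim
      case (elim R)
      then have R: "R > 3" "4 * L * c < R" and \<theta>: "0 \<le> \<theta> R" "\<theta> R \<le> pi / 2"
        and c: "\<And>n::nat. c \<le> (1 + R) * dist (of_real R * cis (\<theta> R)) (of_real (real n * pi / (2 * L)))" by auto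
      \<comment> \<open>With k = R e^w one has dk / k = dw, so subtracting
        \<open>\<alpha> * w\<close> removes exactly the contribution of \<alpha>/k. The derivative
        of the rest is (H k - \<alpha>/k) k.\<close>
      define F where "F w = P (of_real R * exp w) - \<alpha> * w" for w
      have low: "L * c / (8 * R) \<le> cmod (1 - exp (4 * \<i> * (of_real R * cis \<phi>) * of_real L))"
        if \<phi>: "\<theta> R \<le> \<phi>" "\<phi> \<le> pi / 2" for \<phi>
      proof -
        let ?\<delta> = "4 * L * c / (1 + R)"
        have "?\<delta> / 16 \<le> cmod (1 - exp (4 * \<i> * (of_real R * cis \<phi>) * of_real L))"
        proof (rule cmod_one_minus_exp_ge)
          have "0 \<le> sin \<phi>" using \<phi> \<theta> by (intro sin_ge_zero) auto
          then show "Re (4 * \<i> * (of_real R * cis \<phi>) * of_real L) \<le> 0" using R L by simp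
          show "?\<delta> \<le> 1" using R by (simp add: field_simps)
          fix n :: int
          define p where "p = of_int n * pi / (2 * L)"
          have absp: "\<bar>p\<bar> = real (nat \<bar>n\<bar>) * pi / (2 * L)" using L by (simp add: p_def abs_mult)
          have "dist (of_real R * cis (\<theta> R)) (of_real \<bar>p\<bar>) \<le> dist (of_real R * cis \<phi>) (of_real p)"
            using R \<theta> \<phi> by (intro dist_arc_real_ge) auto
          then have "(1 + R) * dist (of_real R * cis (\<theta> R)) (of_real \<bar>p\<bar>) \<le> (1 + R) * dist (of_real R * cis \<phi>) (of_real p)"
            using R by (intro mult_left_mono) auto
          then have "c \<le> (1 + R) * dist (of_real R * cis \<phi>) (of_real p)" using c[of "nat \<bar>n\<bar>"] unfolding absp by linarith
          then have "4 * L * c \<le> 4 * L * ((1 + R) * dist (of_real R * cis \<phi>) (of_real p))"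
            using L by (intro mult_left_mono) auto
          then have "?\<delta> \<le> 4 * L * dist (of_real R * cis \<phi>) (of_real p)" using R by (simp add: field_simps)
          also have "\<dots> = cmod (4 * \<i> * of_real L * (of_real R * cis \<phi> - of_real p))"
            using L by (simp add: norm_mult dist_norm)
          also have "4 * \<i> * of_real L * (of_real R * cis \<phi> - of_real p) =
              4 * \<i> * (of_real R * cis \<phi>) * of_real L - 2 * of_int n * of_real pi * \<i>"
            using L by (simp add: p_def field_simps)
          finally show "?\<delta> \<le> cmod (4 * \<i> * (of_real R * cis \<phi>) * of_real L - 2 * of_int n * of_real pi * \<i>)" .
        qed
        moreover have "L * c / (8 * R) \<le> ?\<delta> / 16"
        proof -
          have "L * c / (8 * R) = 4 * L * c / (R + R) / 16" by simp
          also have "\<dots> \<le> ?\<delta> / 16" using R L C by (intro divide_right_mono divide_left_mono) auto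
          finally show ?thesis .
        qed
        ultimately show ?thesis by linarith
      qed
      have deriv: "(F has_field_derivative (H k - \<alpha> / k) * k) (at (\<i> * of_real \<phi>) within S)"
        and nrm: "cmod ((H k - \<alpha> / k) * k) \<le> C0 / (R * cmod (1 - exp (4 * \<i> * k * of_real L)))"
        if k: "k = of_real R * cis \<phi>" and \<phi>: "\<theta> R \<le> \<phi>" "\<phi> \<le> pi / 2" for k \<phi> S
      proof -
        have "0 < L * c / (8 * R)" using L C R by simp
        then have ne: "exp (4 * \<i> * k * of_real L) \<noteq> 1" using low[OF \<phi>] unfolding k by auto
        have re: "0 \<le> Re k" "0 \<le> Im k" using \<phi> \<theta> R unfolding k by (auto intro!: mult_nonneg_nonneg cos_ge_zero sin_ge_zero)
        have cmk: "cmod k = R" using R by (simp add: k norm_mult)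
        have kz: "k \<noteq> 0" using cmk R by auto
        have kU: "k \<in> U" using U(4) re ne by blast
        have kexp: "of_real R * exp (\<i> * of_real \<phi>) = k" by (simp add: k cis_conv_exp)
        have "((\<lambda>w. P (of_real R * exp w)) has_field_derivative H k * k) (at (\<i> * of_real \<phi>) within S)"
          by (rule DERIV_chain2[where g = "\<lambda>w. of_real R * exp w"])
            (use P[OF kU] kexp in \<open>auto intro!: derivative_eq_intros\<close>)
        then show "(F has_field_derivative (H k - \<alpha> / k) * k) (at (\<i> * of_real \<phi>) within S)"
          unfolding F_def using kz by (auto intro!: derivative_eq_intros simp: left_diff_distrib)
        have "cmod ((H k - \<alpha> / k) * k) \<le> C0 / (R\<^sup>2 * cmod (1 - exp (4 * \<i> * k * of_real L))) * R"
          unfolding norm_mult cmk using bound[OF re _ ne] cmk R by (intro mult_right_mono) auto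
        also have "\<dots> = C0 / (R * cmod (1 - exp (4 * \<i> * k * of_real L)))" using R by (simp add: power2_eq_square)
        finally show "cmod ((H k - \<alpha> / k) * k) \<le> C0 / (R * cmod (1 - exp (4 * \<i> * k * of_real L)))" .
      qed
      have arc: "cmod (F (\<i> * of_real a) - F (\<i> * of_real b)) \<le> B * (b - a)"
        if ab: "\<theta> R \<le> a" "a \<le> b" "b \<le> pi / 2" and B: "0 \<le> B"
          "\<And>\<phi>. a \<le> \<phi> \<Longrightarrow> \<phi> \<le> b \<Longrightarrow> C0 / (R * cmod (1 - exp (4 * \<i> * (of_real R * cis \<phi>) * of_real L))) \<le> B" for a b B
      proof -
        have seg: "closed_segment (\<i> * of_real a) (\<i> * of_real b) \<subseteq> (\<lambda>\<phi>. \<i> * of_real \<phi>) ` {a..b}"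
        proof
          fix w assume "w \<in> closed_segment (\<i> * of_real a) (\<i> * of_real b)"
          then obtain u where u: "0 \<le> u" "u \<le> 1" "w = \<i> * of_real ((1 - u) * a + u * b)"
            by (auto simp: closed_segment_def scaleR_conv_of_real algebra_simps)
          have "(1 - u) * a + u * b \<in> {a..b}"
            using u ab convex_bound_le[of a b b "1 - u" u] convex_bound_le[of "-b" "-a" "-a" u "1 - u"] by auto
          then show "w \<in> (\<lambda>\<phi>. \<i> * of_real \<phi>) ` {a..b}" using u by blast
        qed
        have "cmod (F (\<i> * of_real a) - F (\<i> * of_real b)) \<le> B * cmod (\<i> * of_real a - \<i> * of_real b)"
        proof (rule field_differentiable_bound[where S = "closed_segment (\<i> * of_real a) (\<i> * of_real b)"
              and f' = "\<lambda>w. (H (of_real R * exp w) - \<alpha> / (of_real R * exp w)) * (of_real R * exp w)"])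
          fix w assume w: "w \<in> closed_segment (\<i> * of_real a) (\<i> * of_real b)"
          then obtain \<phi> where \<phi>: "w = \<i> * of_real \<phi>" "a \<le> \<phi>" "\<phi> \<le> b" using seg by auto
          have e: "of_real R * exp w = of_real R * cis \<phi>" by (simp add: \<phi> cis_conv_exp)
          show "(F has_field_derivative (H (of_real R * exp w) - \<alpha> / (of_real R * exp w)) * (of_real R * exp w))
              (at w within closed_segment (\<i> * of_real a) (\<i> * of_real b))"
            using deriv[OF e, of "closed_segment (\<i> * of_real a) (\<i> * of_real b)"] \<phi> ab by simp
          show "cmod ((H (of_real R * exp w) - \<alpha> / (of_real R * exp w)) * (of_real R * exp w)) \<le> B"
            using nrm[OF e] B(2)[of \<phi>] \<phi> ab unfolding e by simp
        qed auto
        also have "cmod (\<i> * of_real a - \<i> * of_real b) = b - a"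
          using ab by (simp add: norm_mult flip: right_diff_distrib of_real_diff)
        finally show ?thesis .
      qed
      \<comment> \<open>From the angle 4/R on, Im k = R sin \<phi> \<ge> 1. Before
        \<open>\<psi>\<close> a bounded integrand acts on an angle of at most 4/R, after it an
        integrand of order 1/R on a bounded angle; both contributions are O(1/R).\<close>
      define \<psi> where "\<psi> = max (\<theta> R) (4 / R)"
      have "4 / R \<le> pi / 2" using R pi_gt3 mult_strict_mono[of 3 R 3 pi] by (simp add: field_simps)
      then have \<psi>: "\<theta> R \<le> \<psi>" "4 / R \<le> \<psi>" "\<psi> \<le> pi / 2" "\<psi> - \<theta> R \<le> 4 / R"
        using \<theta> R by (auto simp: \<psi>_def max_def)
      have "cmod (F (\<i> * of_real (\<theta> R)) - F (\<i> * of_real \<psi>)) \<le> K1 * (\<psi> - \<theta> R)"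
      proof (rule arc)
        fix \<phi> assume \<phi>: "\<theta> R \<le> \<phi>" "\<phi> \<le> \<psi>"
        have pos: "0 < L * c / (8 * R)" using L C R by simp
        have lo: "L * c / (8 * R) \<le> cmod (1 - exp (4 * \<i> * (of_real R * cis \<phi>) * of_real L))"
          using \<phi> \<psi> by (intro low) auto
        have "C0 / (R * cmod (1 - exp (4 * \<i> * (of_real R * cis \<phi>) * of_real L))) \<le> C0 / (R * (L * c / (8 * R)))"
          using R C0 pos by (intro divide_left_mono mult_left_mono mult_pos_pos lo less_le_trans[OF pos lo]) auto
        also have "\<dots> = K1" using R by (simp add: K1_def)
        finally show "C0 / (R * cmod (1 - exp (4 * \<i> * (of_real R * cis \<phi>) * of_real L))) \<le> K1" .
      qed (use \<psi> K in auto)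
      also have "\<dots> \<le> K1 * (4 / R)" using \<psi> K by (intro mult_left_mono) auto
      finally have 1: "cmod (F (\<i> * of_real (\<theta> R)) - F (\<i> * of_real \<psi>)) \<le> K1 * (4 / R)" .
      have "cmod (F (\<i> * of_real \<psi>) - F (\<i> * of_real (pi / 2))) \<le> K2 / R * (pi / 2 - \<psi>)"
      proof (rule arc)
        fix \<phi> assume \<phi>: "\<psi> \<le> \<phi>" "\<phi> \<le> pi / 2"
        have "0 \<le> \<phi>" using \<phi> \<psi> \<theta> by linarith
        have "4 / R \<le> \<phi>" using \<phi> \<psi> by linarith
        then have "1 \<le> R * (\<phi> / 4)" using R by (simp add: field_simps)
        also have "\<dots> \<le> R * sin \<phi>" using \<phi> \<open>0 \<le> \<phi>\<close> R by (intro mult_left_mono sin_ge_quarter) auto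
        finally have "4 * L * 1 \<le> 4 * L * (R * sin \<phi>)" using L by (intro mult_left_mono) auto
        then have nE: "cmod (exp (4 * \<i> * (of_real R * cis \<phi>) * of_real L)) \<le> exp (- (4 * L))"
          by (simp add: norm_exp_eq_Re mult_ac)
        have "d \<le> cmod (1 - exp (4 * \<i> * (of_real R * cis \<phi>) * of_real L))"
          using nE norm_triangle_ineq2[of 1 "exp (4 * \<i> * (of_real R * cis \<phi>) * of_real L)"]
          unfolding d_def norm_one by linarith
        then have "C0 / (R * cmod (1 - exp (4 * \<i> * (of_real R * cis \<phi>) * of_real L))) \<le> C0 / (R * d)"
          using R d C0 by (intro divide_left_mono mult_left_mono mult_pos_pos) auto
        then show "C0 / (R * cmod (1 - exp (4 * \<i> * (of_real R * cis \<phi>) * of_real L))) \<le> K2 / R"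
          by (simp add: K2_def mult.commute)
      qed (use \<psi> K R in auto)
      also have "\<dots> \<le> K2 / R * (pi / 2)" using \<psi> \<theta> K R by (intro mult_left_mono) auto
      finally have "cmod (F (\<i> * of_real (\<theta> R)) - F (\<i> * of_real (pi / 2))) \<le> K1 * (4 / R) + K2 / R * (pi / 2)"
        using 1 norm_triangle_ineq[of "F (\<i> * of_real (\<theta> R)) - F (\<i> * of_real \<psi>)" "F (\<i> * of_real \<psi>) - F (\<i> * of_real (pi / 2))"]
        by simp
      moreover have "F (\<i> * of_real (\<theta> R)) - F (\<i> * of_real (pi / 2)) =
          P (of_real R * cis (\<theta> R)) - P (\<i> * of_real R) - \<alpha> * (\<i> * of_real (\<theta> R) - \<i> * of_real (pi / 2))"
        unfolding F_def cis_conv_exp[symmetric] cis_pi_half by (simp add: mult.commute right_diff_distrib)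
      ultimately show ?case by simp
    qed
    have "((\<lambda>R::real. K1 * (4 / R) + K2 / R * (pi / 2)) \<longlongrightarrow> 0) at_top" by real_asymp
    then have 1: "((\<lambda>R. P (of_real R * cis (\<theta> R)) - P (\<i> * of_real R) - \<alpha> * (\<i> * of_real (\<theta> R) - \<i> * of_real (pi / 2))) \<longlongrightarrow> 0) at_top"
      by (rule Lim_null_comparison[OF ev2])
    have ev3: "\<forall>\<^sub>F R in at_top. norm (\<theta> R) \<le> C / R\<^sup>2"
      using ev eventually_gt_at_top[of 0] by eventually_elim (simp add: field_simps)
    have "((\<lambda>R::real. C / R\<^sup>2) \<longlongrightarrow> 0) at_top" by real_asymp
    then have 2: "(\<theta> \<longlongrightarrow> 0) at_top" by (rule Lim_null_comparison[OF ev3])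
    have "((\<lambda>R. (P (of_real R * cis (\<theta> R)) - P (\<i> * of_real R) - \<alpha> * (\<i> * of_real (\<theta> R) - \<i> * of_real (pi / 2)))
        + \<alpha> * (\<i> * of_real (\<theta> R) - \<i> * of_real (pi / 2))) \<longlongrightarrow> 0 + \<alpha> * (\<i> * of_real 0 - \<i> * of_real (pi / 2))) at_top"
      by (intro tendsto_intros 1 2)
    then show "((\<lambda>R. P (of_real R * cis (\<theta> R)) - P (\<i> * of_real R)) \<longlongrightarrow> - (\<i> * of_real pi / 2) * \<alpha>) at_top"
      by (simp add: mult_ac)
  qed
qed

section \<open>Volterra equations with a parameter\<close>

text \<open>The hypothesis \<open>step\<close> bounds the derivative by the supremum over all parameters, so that a bound
  \<open>C (Kx)\<^sup>n / n!\<close> for all parameters improves to the next \<open>n\<close>.\<close>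

lemma gronwall_zero:
  fixes f :: "'p \<Rightarrow> real \<Rightarrow> 'e::real_normed_vector"
  assumes K: "0 \<le> K"
    and der: "\<And>p x. p \<in> P \<Longrightarrow> x \<in> {0..L} \<Longrightarrow> (f p has_vector_derivative f' p x) (at x within {0..L})"
    and init: "\<And>p. p \<in> P \<Longrightarrow> f p 0 = 0"
    and bdd: "\<And>p x. p \<in> P \<Longrightarrow> x \<in> {0..L} \<Longrightarrow> norm (f p x) \<le> C"
    and step: "\<And>p x S. p \<in> P \<Longrightarrow> x \<in> {0..L} \<Longrightarrow> (\<And>p. p \<in> P \<Longrightarrow> norm (f p x) \<le> S) \<Longrightarrow> norm (f' p x) \<le> K * S"
    and p: "p \<in> P" and x: "x \<in> {0..L}"
  shows "f p x = 0"
proof -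
  have C: "0 \<le> C" using order_trans[OF norm_ge_zero bdd[OF p x]] .
  have bound: "norm (f p x) \<le> C * (K * x) ^ n / fact n" if "p \<in> P" "x \<in> {0..L}" for n p x
    using that
  proof (induction n arbitrary: p x)
    case 0
    then show ?case using bdd by simp
  next
    case (Suc n)
    show ?case
    proof (cases "x = 0")
      case True
      then show ?thesis using init Suc.prems by simp
    next
      case False
      then have x: "0 < x" "x \<le> L" using Suc.prems by auto
      define \<phi> where "\<phi> y = C * (K * y) ^ Suc n / fact (Suc n)" for y
      have "norm (f p x - f p 0) \<le> \<phi> x - \<phi> 0"
      proof (rule differentiable_bound_general[OF x(1)])
        have "continuous_on {0..L} (f p)" using der[OF Suc.prems(1)] by (rule continuous_on_vector_derivative)
        then show "continuous_on {0..x} (f p)" by (rule continuous_on_subset) (use x in auto)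
        show "continuous_on {0..x} \<phi>" unfolding \<phi>_def by (intro continuous_intros) auto
        fix y assume y: "0 < y" "y < x"
        have "at y within {0..L} = at y" using y x by (intro at_within_Icc_at) auto
        then show "(f p has_vector_derivative f' p y) (at y)" using der[OF Suc.prems(1), of y] x y by simp
        have "(\<phi> has_real_derivative C * (real (Suc n) * (K * y) ^ n * K) / fact (Suc n)) (at y)"
          unfolding \<phi>_def by (rule derivative_eq_intros refl | simp)+
        moreover have "C * (real (Suc n) * (K * y) ^ n * K) / fact (Suc n) = K * (C * (K * y) ^ n / fact n)"
          by (simp add: field_simps del: of_nat_Suc)
        ultimately have "(\<phi> has_real_derivative K * (C * (K * y) ^ n / fact n)) (at y)" by (simp only:)
        then show "(\<phi> has_vector_derivative K * (C * (K * y) ^ n / fact n)) (at y)"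
          by (simp only: has_real_derivative_iff_has_vector_derivative)
        show "norm (f' p y) \<le> K * (C * (K * y) ^ n / fact n)"
          using x y by (intro step Suc.prems Suc.IH) auto
      qed
      then show ?thesis using init Suc.prems by (simp add: \<phi>_def)
    qed
  qed
  have "(\<lambda>n. C * (inverse (fact n) * (K * x) ^ n)) \<longlonglongrightarrow> C * 0"
    by (intro tendsto_intros summable_LIMSEQ_zero summable_exp)
  then have "norm (f p x) \<le> C * 0"
    by (rule LIMSEQ_le_const) (use bound[OF p x] in \<open>auto simp: divide_inverse mult_ac\<close>)
  then show ?thesis by simp
qed

text \<open>Trades the moving upper limit for a fixed interval, so that joint continuity in
  \<open>x\<close> and a further parameter becomes continuity of a parameter integral; in this form
  the identity also covers \<open>x = 0\<close>.\<close>

lemma integral_dilation: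
  fixes h :: "real \<Rightarrow> 'e::banach"
  assumes x: "0 \<le> x" and h: "continuous_on {0..x} h"
  shows "x *\<^sub>R integral {0..1} (\<lambda>s. h (s * x)) = integral {0..x} h"
proof -
  have "((\<lambda>s. x *\<^sub>R h (s * x)) has_integral (integral {0..1 * x} h - integral {0..0 * x} h)) {0..1}"
  proof (rule fundamental_theorem_of_calculus)
    fix s :: real assume s: "s \<in> {0..1}"
    have "((\<lambda>s. s * x) has_vector_derivative x) (at s within {0..1})"
      by (auto intro!: derivative_eq_intros)
    moreover have "((\<lambda>z. integral {0..z} h) has_vector_derivative h (s * x)) (at (s * x) within (\<lambda>s. s * x) ` {0..1})"
      using s x mult_left_le_one_le[of x]
      by (intro has_vector_derivative_within_subset[OF integral_has_vector_derivative[OF h]]) auto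
    ultimately show "((\<lambda>s. integral {0..s * x} h) has_vector_derivative x *\<^sub>R h (s * x)) (at s within {0..1})"
      using vector_diff_chain_within[of "\<lambda>s. s * x" x s "{0..1}" "\<lambda>z. integral {0..z} h"] by (simp add: o_def)
  qed simp
  then have "integral {0..1} (\<lambda>s. x *\<^sub>R h (s * x)) = integral {0..1 * x} h - integral {0..0 * x} h"
    by (rule integral_unique)
  then show ?thesis by simp
qed

text \<open>The contraction principle for the norm sup |e^{-2Kx} w|: the integral operator contracts
  by 1/2 however large the rectangle is. Solving for all \<open>t\<close> at once gives joint
  continuity, without any regularity in \<open>t\<close> beyond it.\<close>

lemma volterra_parametric:
  fixes A :: "real \<Rightarrow> real \<Rightarrow> 'e \<Rightarrow> 'e::banach" and w0 :: "real \<Rightarrow> 'e"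
  assumes L: "0 \<le> L" and \<tau>: "0 \<le> \<tau>" and K: "0 < K"
    and cont: "\<And>w. continuous_on ({0..L} \<times> {0..\<tau>}) (\<lambda>(x, t). w x t) \<Longrightarrow>
      continuous_on ({0..L} \<times> {0..\<tau>}) (\<lambda>(x, t). A x t (w x t))"
    and lip: "\<And>x t v v'. x \<in> {0..L} \<Longrightarrow> t \<in> {0..\<tau>} \<Longrightarrow> norm (A x t v - A x t v') \<le> K * norm (v - v')"
    and w0: "continuous_on {0..\<tau>} w0"
  obtains w where "continuous_on ({0..L} \<times> {0..\<tau>}) (\<lambda>(x, t). w x t)"
    "\<And>x t. x \<in> {0..L} \<Longrightarrow> t \<in> {0..\<tau>} \<Longrightarrow> w x t = w0 t + integral {0..x} (\<lambda>y. A y t (w y t))"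
proof -
  define R where "R = {0..L} \<times> {0..\<tau>}"
  have Rc: "cbox (0, 0) (L, \<tau>) = R" by (auto simp: R_def cbox_Pair_eq)
  \<comment> \<open>The fixed point \<open>f\<close> is sought in the bounded continuous functions;
    the solution is \<open>f\<close> times the weight e^{2Kx}.\<close>
  define wt where "wt f x t = exp (2 * K * x) *\<^sub>R apply_bcontfun f (x, t)" for f :: "(real \<times> real) \<Rightarrow>\<^sub>C 'e" and x t
  have wt_cont: "continuous_on R (\<lambda>(x, t). wt f x t)" for f
    unfolding wt_def split_beta
    by (intro continuous_intros continuous_on_compose2[OF continuous_on_apply_bcontfun[of UNIV]]) auto
  have A_cont: "continuous_on R (\<lambda>(x, t). A x t (wt f x t))" for f
    unfolding R_def by (rule cont) (use wt_cont in \<open>simp add: R_def\<close>)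
  define G where "G f p = exp (- 2 * K * fst p) *\<^sub>R (w0 (snd p) + fst p *\<^sub>R integral {0..1} (\<lambda>s. A (s * fst p) (snd p) (wt f (s * fst p) (snd p))))"
    for f and p :: "real \<times> real"
  have G_cont: "continuous_on R (G f)" for f
  proof -
    have "continuous_on (R \<times> cbox 0 1) (\<lambda>(p, s). A (s * fst p) (snd p) (wt f (s * fst p) (snd p)))"
      unfolding split_beta
      by (rule continuous_on_compose2[OF A_cont, of _ "\<lambda>z. (snd z * fst (fst z), snd (fst z))", unfolded split_beta fst_conv snd_conv])
        (auto simp: R_def intro!: continuous_intros mult_left_le_one_le order_trans[OF mult_left_le_one_le])
    from integral_continuous_on_param[OF this]
    have "continuous_on R (\<lambda>p. integral {0..1} (\<lambda>s. A (s * fst p) (snd p) (wt f (s * fst p) (snd p))))" by simp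
    moreover have "continuous_on R (\<lambda>p. w0 (snd p))"
      by (rule continuous_on_compose2[OF w0]) (auto simp: R_def intro!: continuous_intros)
    ultimately show ?thesis unfolding G_def by (intro continuous_intros)
  qed
  \<comment> \<open>Clamping to the rectangle extends its continuous functions to bounded continuous
    functions on the plane, which form a complete space.\<close>
  have "\<exists>g :: (real \<times> real) \<Rightarrow>\<^sub>C 'e. \<forall>p. apply_bcontfun g p = G f (clamp (0, 0) (L, \<tau>) p)" for f
    using continuous_on_cbox_bcontfunE[of "(0, 0)" "(L, \<tau>)" "G f"] G_cont unfolding Rc by metis
  then obtain T where T: "\<And>f p. apply_bcontfun (T f) p = G f (clamp (0, 0) (L, \<tau>) p)" by metis
  have lipG: "norm (G f p - G g p) \<le> 1 / 2 * dist f g" if p: "p \<in> R" for f g p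
  proof -
    obtain x t where xt: "p = (x, t)" "x \<in> {0..L}" "t \<in> {0..\<tau>}" using p by (auto simp: R_def)
    have sx: "s * x \<in> {0..L}" if "s \<in> {0..1}" for s
      using that xt by (auto intro: order_trans[OF mult_left_le_one_le])
    have ci: "continuous_on {0..1} (\<lambda>s. A (s * x) t (wt f (s * x) t))" for f
      by (rule continuous_on_compose2[OF A_cont, of _ "\<lambda>s. (s * x, t)", unfolded split_beta fst_conv snd_conv])
        (use sx xt in \<open>auto simp: R_def intro!: continuous_intros\<close>)
    have "norm (integral {0..1} (\<lambda>s. A (s * x) t (wt f (s * x) t)) - integral {0..1} (\<lambda>s. A (s * x) t (wt g (s * x) t)))
        = norm (integral {0..1} (\<lambda>s. A (s * x) t (wt f (s * x) t) - A (s * x) t (wt g (s * x) t)))"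
      by (subst integral_diff) (auto intro: integrable_continuous_interval ci)
    also have "\<dots> \<le> integral {0..1} (\<lambda>s. K * (exp (2 * K * (s * x)) * dist f g))"
    proof (rule integral_norm_bound_integral)
      show "(\<lambda>s. A (s * x) t (wt f (s * x) t) - A (s * x) t (wt g (s * x) t)) integrable_on {0..1}"
        by (intro integrable_continuous_interval continuous_intros ci)
      show "(\<lambda>s. K * (exp (2 * K * (s * x)) * dist f g)) integrable_on {0..1}"
        by (intro integrable_continuous_interval continuous_intros)
      fix s :: real assume s: "s \<in> {0..1}"
      have "norm (A (s * x) t (wt f (s * x) t) - A (s * x) t (wt g (s * x) t)) \<le> K * norm (wt f (s * x) t - wt g (s * x) t)"
        by (rule lip[OF sx[OF s] xt(3)])
      also have "norm (wt f (s * x) t - wt g (s * x) t) = exp (2 * K * (s * x)) * dist (apply_bcontfun f (s * x, t)) (apply_bcontfun g (s * x, t))"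
        unfolding wt_def scaleR_diff_right[symmetric] by (simp add: dist_norm)
      also have "K * \<dots> \<le> K * (exp (2 * K * (s * x)) * dist f g)"
        using K by (intro mult_left_mono dist_bounded) auto
      finally show "norm (A (s * x) t (wt f (s * x) t) - A (s * x) t (wt g (s * x) t)) \<le> K * (exp (2 * K * (s * x)) * dist f g)" by simp
    qed
    finally have le: "norm (integral {0..1} (\<lambda>s. A (s * x) t (wt f (s * x) t)) - integral {0..1} (\<lambda>s. A (s * x) t (wt g (s * x) t)))
        \<le> integral {0..1} (\<lambda>s. K * (exp (2 * K * (s * x)) * dist f g))" .
    have "((\<lambda>s. x * (K * (exp (2 * K * (s * x)) * dist f g))) has_integral
        (exp (2 * K * (1 * x)) * dist f g / 2 - exp (2 * K * (0 * x)) * dist f g / 2)) {0..1}"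
      by (rule fundamental_theorem_of_calculus)
        (auto intro!: derivative_eq_intros simp: has_real_derivative_iff_has_vector_derivative[symmetric])
    from integral_unique[OF this]
    have ev: "x * integral {0..1} (\<lambda>s. K * (exp (2 * K * (s * x)) * dist f g)) = exp (2 * K * x) * dist f g / 2 - dist f g / 2"
      by simp
    have "G f p - G g p = (exp (- 2 * K * x) * x) *\<^sub>R (integral {0..1} (\<lambda>s. A (s * x) t (wt f (s * x) t)) - integral {0..1} (\<lambda>s. A (s * x) t (wt g (s * x) t)))"
      unfolding G_def xt fst_conv snd_conv by (simp add: scaleR_right_diff_distrib scaleR_right_distrib)
    then have "norm (G f p - G g p) = exp (- 2 * K * x) * (x * norm (integral {0..1} (\<lambda>s. A (s * x) t (wt f (s * x) t)) - integral {0..1} (\<lambda>s. A (s * x) t (wt g (s * x) t))))"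
      using xt by simp
    also have "\<dots> \<le> exp (- 2 * K * x) * (x * integral {0..1} (\<lambda>s. K * (exp (2 * K * (s * x)) * dist f g)))"
      using xt le by (intro mult_left_mono) auto
    also have "\<dots> = (1 - exp (- 2 * K * x)) * (dist f g / 2)"
      unfolding ev by (simp add: algebra_simps diff_divide_distrib flip: exp_add)
    also have "\<dots> \<le> 1 * (dist f g / 2)" by (intro mult_right_mono) auto
    finally show ?thesis by simp
  qed
  have clampR: "clamp (0, 0) (L, \<tau>) p \<in> R" for p
    unfolding Rc[symmetric] using L \<tau> by (intro clamp_in_interval) (auto simp: Basis_prod_def)
  have "dist (T f) (T g) \<le> 1 / 2 * dist f g" for f g
    by (rule dist_bound) (simp only: T dist_norm[of "G f _"] lipG[OF clampR])
  then have "\<exists>!f. T f = f" by (intro banach_fix_type[of "1 / 2"]) auto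
  then obtain f where f: "T f = f" by blast
  define w where "w = wt f"
  show ?thesis
  proof
    show "continuous_on ({0..L} \<times> {0..\<tau>}) (\<lambda>(x, t). w x t)" using wt_cont[of f] by (simp add: w_def R_def)
    fix x t assume xt: "x \<in> {0..L}" "t \<in> {0..\<tau>}"
    have "(x, t) \<in> cbox (0, 0) (L, \<tau>)" using xt unfolding Rc by (simp add: R_def)
    then have "apply_bcontfun f (x, t) = G f (x, t)" using T[of f "(x, t)"] unfolding f by simp
    then have "w x t = exp (2 * K * x) *\<^sub>R G f (x, t)" by (simp only: w_def wt_def)
    also have "\<dots> = (exp (2 * K * x) * exp (- 2 * K * x)) *\<^sub>R (w0 t + x *\<^sub>R integral {0..1} (\<lambda>s. A (s * x) t (w (s * x) t)))"
      by (simp only: G_def fst_conv snd_conv scaleR_scaleR w_def)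
    also have "exp (2 * K * x) * exp (- 2 * K * x) = 1" by (simp flip: exp_add)
    finally have "w x t = w0 t + x *\<^sub>R integral {0..1} (\<lambda>s. A (s * x) t (w (s * x) t))" by simp
    also have "x *\<^sub>R integral {0..1} (\<lambda>s. A (s * x) t (w (s * x) t)) = integral {0..x} (\<lambda>y. A y t (w y t))"
    proof (rule integral_dilation)
      show "continuous_on {0..x} (\<lambda>y. A y t (w y t))"
        unfolding w_def
        by (rule continuous_on_compose2[OF A_cont, of _ "\<lambda>y. (y, t)", unfolded split_beta fst_conv snd_conv])
          (use xt in \<open>auto simp: R_def intro!: continuous_intros\<close>)
    qed (use xt in auto)
    finally show "w x t = w0 t + integral {0..x} (\<lambda>y. A y t (w y t))" .
  qed
qed

section \<open>Transport by the zero-curvature equation\<close>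

lemma continuous_on_slice:
  assumes "continuous_on (X \<times> Y) (\<lambda>(x, t). f x t)"
  shows "x \<in> X \<Longrightarrow> continuous_on Y (\<lambda>t. f x t)" "t \<in> Y \<Longrightarrow> continuous_on X (\<lambda>x. f x t)"
proof -
  show "continuous_on Y (\<lambda>t. f x t)" if "x \<in> X"
  proof -
    have "continuous_on Y (\<lambda>t. (\<lambda>(x, t). f x t) (x, t))"
      by (rule continuous_on_compose2[OF assms]) (intro continuous_intros, use that in auto)
    then show ?thesis by simp
  qed
  show "continuous_on X (\<lambda>x. f x t)" if "t \<in> Y"
  proof -
    have "continuous_on X (\<lambda>x. (\<lambda>(x, t). f x t) (x, t))"
      by (rule continuous_on_compose2[OF assms]) (intro continuous_intros, use that in auto)
    then show ?thesis by simp
  qed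
qed

lemma continuous_on_rectangle_norm_bound:
  fixes f :: "real \<Rightarrow> real \<Rightarrow> 'a::real_normed_vector"
  assumes "continuous_on ({a..b} \<times> {c..d}) (\<lambda>(x, t). f x t)"
  shows "\<exists>B\<ge>0. \<forall>x\<in>{a..b}. \<forall>t\<in>{c..d}. norm (f x t) \<le> B"
proof -
  have "bounded ((\<lambda>(x, t). f x t) ` ({a..b} \<times> {c..d}))"
    by (intro compact_imp_bounded compact_continuous_image assms compact_Times) auto
  then obtain B where B: "\<forall>y\<in>(\<lambda>(x, t). f x t) ` ({a..b} \<times> {c..d}). norm y \<le> B" unfolding bounded_iff ..
  have "norm (f x t) \<le> \<bar>B\<bar>" if "x \<in> {a..b}" "t \<in> {c..d}" for x t
  proof -
    have "norm (f x t) \<le> B" using B that by force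
    then show ?thesis by linarith
  qed
  then show ?thesis by (intro exI[of _ "\<bar>B\<bar>"]) simp
qed

text \<open>Integration by parts for a pair that fails to satisfy \<open>b' = B\<close>: the boundary terms are expressed
  through the defect of the integrated equation.\<close>

lemma parts_defect:
  fixes r r' b B :: "real \<Rightarrow> complex"
  assumes t: "t \<in> {0..\<tau>}"
    and dr: "\<And>s. s \<in> {0..\<tau>} \<Longrightarrow> (r has_vector_derivative r' s) (at s within {0..\<tau>})"
    and c: "continuous_on {0..\<tau>} r'" "continuous_on {0..\<tau>} b" "continuous_on {0..\<tau>} B"
  shows "r t * b t - r 0 * b 0 - integral {0..t} (\<lambda>s. r s * B s + r' s * b s) =
    r t * (b t - b 0 - integral {0..t} B) - integral {0..t} (\<lambda>s. r' s * (b s - b 0 - integral {0..s} B))"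
proof -
  have sub: "{0..t} \<subseteq> {0..\<tau>}" using t by auto
  define I where "I s = integral {0..s} B" for s
  have dI: "(I has_vector_derivative B s) (at s within {0..\<tau>})" if "s \<in> {0..\<tau>}" for s
    unfolding I_def[abs_def] using c(3) that by (rule integral_has_vector_derivative)
  have cI: "continuous_on {0..\<tau>} I" using dI by (rule continuous_on_vector_derivative)
  have cr: "continuous_on {0..\<tau>} r" using dr by (rule continuous_on_vector_derivative)
  note cs = c[THEN continuous_on_subset, OF sub] cI[THEN continuous_on_subset, OF sub] cr[THEN continuous_on_subset, OF sub]
  note dI' = has_vector_derivative_within_subset[OF dI sub] and dr' = has_vector_derivative_within_subset[OF dr sub]
  have "((\<lambda>s. r s * B s + r' s * I s) has_integral (r t * I t - r 0 * I 0)) {0..t}"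
    using t sub by (intro fundamental_theorem_of_calculus has_vector_derivative_mult dI' dr') auto
  moreover have "I 0 = 0" by (simp add: I_def)
  ultimately have 1: "integral {0..t} (\<lambda>s. r s * B s + r' s * I s) = r t * I t" by (simp add: integral_unique)
  have "(r' has_integral (r t - r 0)) {0..t}"
    using t sub by (intro fundamental_theorem_of_calculus dr') auto
  then have 2: "integral {0..t} r' = r t - r 0" by (rule integral_unique)
  have "integral {0..t} (\<lambda>s. r s * B s + r' s * b s) =
      integral {0..t} (\<lambda>s. (r s * B s + r' s * I s) + (r' s * (b s - b 0 - I s) + b 0 * r' s))"
    by (rule integral_cong) (simp add: algebra_simps)
  also have "\<dots> = integral {0..t} (\<lambda>s. r s * B s + r' s * I s) + integral {0..t} (\<lambda>s. r' s * (b s - b 0 - I s) + b 0 * r' s)"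
    by (intro integral_add integrable_continuous_interval continuous_intros cs)
  also have "integral {0..t} (\<lambda>s. r' s * (b s - b 0 - I s) + b 0 * r' s) =
      integral {0..t} (\<lambda>s. r' s * (b s - b 0 - I s)) + integral {0..t} (\<lambda>s. b 0 * r' s)"
    by (intro integral_add integrable_continuous_interval continuous_intros cs)
  also have "integral {0..t} (\<lambda>s. b 0 * r' s) = b 0 * (r t - r 0)" unfolding 2[symmetric] by (rule integral_mult_right)
  finally show ?thesis unfolding 1 I_def[symmetric] by (simp add: algebra_simps)
qed

text \<open>The defects \<open>z\<close> of the integrated \<open>t\<close>-equations solve the homogeneous system
  \<open>z\<^sub>x = U z - \<integral> U\<^sub>t z dt\<close> with \<open>z = 0\<close> at \<open>x = 0\<close>.  This form of the zero-curvature argument needs no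
  differentiability of the solution in \<open>t\<close>.\<close>

lemma zero_curvature_transport:
  fixes q qx qxx qt a b :: "real \<Rightarrow> real \<Rightarrow> complex" and k :: complex and lam L \<tau> :: real
  assumes lam: "\<bar>lam\<bar> = 1"
    and cont: "continuous_on ({0..L} \<times> {0..\<tau>}) (\<lambda>(x, t). q x t)" "continuous_on ({0..L} \<times> {0..\<tau>}) (\<lambda>(x, t). qx x t)"
      "continuous_on ({0..L} \<times> {0..\<tau>}) (\<lambda>(x, t). qt x t)"
      "continuous_on ({0..L} \<times> {0..\<tau>}) (\<lambda>(x, t). a x t)" "continuous_on ({0..L} \<times> {0..\<tau>}) (\<lambda>(x, t). b x t)"
    and dq: "\<And>x t. x \<in> {0..L} \<Longrightarrow> t \<in> {0..\<tau>} \<Longrightarrow> ((\<lambda>x. q x t) has_vector_derivative qx x t) (at x within {0..L})"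
      "\<And>x t. x \<in> {0..L} \<Longrightarrow> t \<in> {0..\<tau>} \<Longrightarrow> ((\<lambda>x. qx x t) has_vector_derivative qxx x t) (at x within {0..L})"
      "\<And>x t. x \<in> {0..L} \<Longrightarrow> t \<in> {0..\<tau>} \<Longrightarrow> ((\<lambda>t. q x t) has_vector_derivative qt x t) (at t within {0..\<tau>})"
    and nls: "\<And>x t. x \<in> {0..L} \<Longrightarrow> t \<in> {0..\<tau>} \<Longrightarrow>
      qt x t = \<i> * qxx x t - 2 * \<i> * of_real lam * (q x t * cnj (q x t)) * q x t"
    and dab: "\<And>x t. x \<in> {0..L} \<Longrightarrow> t \<in> {0..\<tau>} \<Longrightarrow>
        ((\<lambda>x. a x t) has_vector_derivative (- 2 * \<i> * k * a x t + q x t * b x t)) (at x within {0..L})"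
      "\<And>x t. x \<in> {0..L} \<Longrightarrow> t \<in> {0..\<tau>} \<Longrightarrow>
        ((\<lambda>x. b x t) has_vector_derivative (of_real lam * cnj (q x t) * a x t)) (at x within {0..L})"
  defines "A \<equiv> \<lambda>x t. - (4 * \<i> * k\<^sup>2 + \<i> * of_real lam * (q x t * cnj (q x t))) * a x t + (2 * k * q x t + \<i> * qx x t) * b x t"
    and "B \<equiv> \<lambda>x t. of_real lam * (2 * k * cnj (q x t) - \<i> * cnj (qx x t)) * a x t + \<i> * of_real lam * (q x t * cnj (q x t)) * b x t"
  assumes init: "\<And>t. t \<in> {0..\<tau>} \<Longrightarrow> a 0 t = a 0 0 + integral {0..t} (A 0)"
      "\<And>t. t \<in> {0..\<tau>} \<Longrightarrow> b 0 t = b 0 0 + integral {0..t} (B 0)"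
    and x: "x \<in> {0..L}" and t: "t \<in> {0..\<tau>}"
  shows "a x t = a x 0 + integral {0..t} (A x)" "b x t = b x 0 + integral {0..t} (B x)"
proof -
  define l where "l = complex_of_real lam"
  have nl: "cmod l = 1" using lam by (simp add: l_def)
  have \<tau>: "0 \<le> \<tau>" using t by simp
  have cA: "continuous_on ({0..L} \<times> {0..\<tau>}) (\<lambda>(x, t). A x t)" and cB: "continuous_on ({0..L} \<times> {0..\<tau>}) (\<lambda>(x, t). B x t)"
    using cont unfolding A_def B_def split_beta by (auto intro!: continuous_intros)
  define z1 where "z1 x t = a x t - a x 0 - integral {0..t} (A x)" for x t
  define z2 where "z2 x t = b x t - b x 0 - integral {0..t} (B x)" for x t
  \<comment> \<open>With w = (a, b), w_x = Uw and (A, B) = Vw, \<open>dA\<close> and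
    \<open>dB\<close> together say (Vw)_x = U Vw + U_t w. This is the zero-curvature condition, and
    \<open>nls\<close> enters here by eliminating \<open>qxx\<close>.\<close>
  have dA: "((\<lambda>x. A x t) has_vector_derivative (- 2 * \<i> * k * A x t + (q x t * B x t + qt x t * b x t))) (at x within {0..L})"
    if "x \<in> {0..L}" "t \<in> {0..\<tau>}" for x t
  proof -
    have "((\<lambda>x. A x t) has_vector_derivative
       ((- (4 * \<i> * k\<^sup>2 + \<i> * l * (q x t * cnj (q x t))) * (- 2 * \<i> * k * a x t + q x t * b x t)
         + (- (0 + \<i> * l * (q x t * cnj (qx x t) + qx x t * cnj (q x t)))) * a x t)
        + ((2 * k * q x t + \<i> * qx x t) * (l * cnj (q x t) * a x t) + (2 * k * qx x t + \<i> * qxx x t) * b x t))) (at x within {0..L})"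
      unfolding A_def l_def
      by (intro has_vector_derivative_add has_vector_derivative_mult has_vector_derivative_mult_right has_vector_derivative_minus
          has_vector_derivative_const has_vector_derivative_cnj dq dab that)
    also have "((- (4 * \<i> * k\<^sup>2 + \<i> * l * (q x t * cnj (q x t))) * (- 2 * \<i> * k * a x t + q x t * b x t)
         + (- (0 + \<i> * l * (q x t * cnj (qx x t) + qx x t * cnj (q x t)))) * a x t)
        + ((2 * k * q x t + \<i> * qx x t) * (l * cnj (q x t) * a x t) + (2 * k * qx x t + \<i> * qxx x t) * b x t)) =
        - 2 * \<i> * k * A x t + (q x t * B x t + qt x t * b x t)"
      unfolding A_def B_def nls[OF that] l_def[symmetric] by (simp add: algebra_simps power2_eq_square)
    finally show ?thesis .
  qed
  have dB: "((\<lambda>x. B x t) has_vector_derivative (l * (cnj (q x t) * A x t + cnj (qt x t) * a x t))) (at x within {0..L})"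
    if "x \<in> {0..L}" "t \<in> {0..\<tau>}" for x t
  proof -
    have cnls: "cnj (qt x t) = - \<i> * cnj (qxx x t) + 2 * \<i> * l * (q x t * cnj (q x t)) * cnj (q x t)"
      unfolding nls[OF that] l_def by simp
    have "((\<lambda>x. B x t) has_vector_derivative
       ((l * (2 * k * cnj (q x t) - \<i> * cnj (qx x t)) * (- 2 * \<i> * k * a x t + q x t * b x t)
         + l * (2 * k * cnj (qx x t) - \<i> * cnj (qxx x t)) * a x t)
        + (\<i> * l * (q x t * cnj (q x t)) * (l * cnj (q x t) * a x t)
         + \<i> * l * (q x t * cnj (qx x t) + qx x t * cnj (q x t)) * b x t))) (at x within {0..L})"
      unfolding B_def l_def
      by (intro has_vector_derivative_add has_vector_derivative_diff has_vector_derivative_mult has_vector_derivative_mult_right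
          has_vector_derivative_const has_vector_derivative_cnj dq dab that)
    also have "((l * (2 * k * cnj (q x t) - \<i> * cnj (qx x t)) * (- 2 * \<i> * k * a x t + q x t * b x t)
         + l * (2 * k * cnj (qx x t) - \<i> * cnj (qxx x t)) * a x t)
        + (\<i> * l * (q x t * cnj (q x t)) * (l * cnj (q x t) * a x t)
         + \<i> * l * (q x t * cnj (qx x t) + qx x t * cnj (q x t)) * b x t)) =
        l * (cnj (q x t) * A x t + cnj (qt x t) * a x t)"
      unfolding A_def B_def cnls l_def[symmetric] by (simp add: algebra_simps power2_eq_square)
    finally show ?thesis .
  qed
  have cdA: "continuous_on ({0..L} \<times> {0..\<tau>}) (\<lambda>(x, t). - 2 * \<i> * k * A x t + (q x t * B x t + qt x t * b x t))"
    using cont cA cB unfolding split_beta by (auto intro!: continuous_intros)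
  have cdB: "continuous_on ({0..L} \<times> {0..\<tau>}) (\<lambda>(x, t). l * (cnj (q x t) * A x t + cnj (qt x t) * a x t))"
    using cont cA cB unfolding split_beta by (auto intro!: continuous_intros)
  have dint: "((\<lambda>x. integral {0..t} (F x)) has_vector_derivative integral {0..t} (F' x)) (at x within {0..L})"
    if "x \<in> {0..L}" "t \<in> {0..\<tau>}" and cF: "continuous_on ({0..L} \<times> {0..\<tau>}) (\<lambda>(x, t). F x t)"
      "continuous_on ({0..L} \<times> {0..\<tau>}) (\<lambda>(x, t). F' x t)"
      and dF: "\<And>x t. x \<in> {0..L} \<Longrightarrow> t \<in> {0..\<tau>} \<Longrightarrow> ((\<lambda>x. F x t) has_vector_derivative F' x t) (at x within {0..L})"
    for x t and F F' :: "real \<Rightarrow> real \<Rightarrow> complex"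
  proof -
    have "((\<lambda>x. integral (cbox 0 t) (F x)) has_vector_derivative integral (cbox 0 t) (F' x)) (at x within {0..L})"
    proof (rule leibniz_rule_vector_derivative)
      show "F x integrable_on cbox 0 t" if "x \<in> {0..L}" for x
        using continuous_on_subset[OF continuous_on_slice(1)[OF cF(1) that], of "cbox 0 t"] \<open>t \<in> {0..\<tau>}\<close>
        by (intro integrable_continuous) auto
      show "continuous_on ({0..L} \<times> cbox 0 t) (\<lambda>(x, t). F' x t)"
        using cF(2) by (rule continuous_on_subset) (use \<open>t \<in> {0..\<tau>}\<close> in auto)
    qed (use that in auto)
    then show ?thesis by simp
  qed
  define D1 where "D1 x t = - 2 * \<i> * k * z1 x t + (q x t * z2 x t - integral {0..t} (\<lambda>s. qt x s * z2 x s))" for x t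
  define D2 where "D2 x t = l * (cnj (q x t) * z1 x t - integral {0..t} (\<lambda>s. cnj (qt x s) * z1 x s))" for x t
  have dz1: "((\<lambda>x. z1 x t) has_vector_derivative D1 x t) (at x within {0..L})" if xt: "x \<in> {0..L}" "t \<in> {0..\<tau>}" for x t
  proof -
    note cs = cont[THEN continuous_on_slice(1), OF xt(1)] cA[THEN continuous_on_slice(1), OF xt(1)] cB[THEN continuous_on_slice(1), OF xt(1)]
    note csub = cs[THEN continuous_on_subset, of "{0..t}"]
    have "((\<lambda>x. z1 x t) has_vector_derivative (- 2 * \<i> * k * a x t + q x t * b x t) - (- 2 * \<i> * k * a x 0 + q x 0 * b x 0)
        - integral {0..t} (\<lambda>s. - 2 * \<i> * k * A x s + (q x s * B x s + qt x s * b x s))) (at x within {0..L})"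
      unfolding z1_def using xt \<tau>
      by (intro has_vector_derivative_diff dab dint cA cdA dA) auto
    also have "integral {0..t} (\<lambda>s. - 2 * \<i> * k * A x s + (q x s * B x s + qt x s * b x s)) =
        - 2 * \<i> * k * integral {0..t} (A x) + integral {0..t} (\<lambda>s. q x s * B x s + qt x s * b x s)"
      using xt by (subst integral_add) (auto intro!: integrable_continuous_interval continuous_intros csub)
    also have "(- 2 * \<i> * k * a x t + q x t * b x t) - (- 2 * \<i> * k * a x 0 + q x 0 * b x 0) - \<dots> =
        - 2 * \<i> * k * z1 x t + (q x t * b x t - q x 0 * b x 0 - integral {0..t} (\<lambda>s. q x s * B x s + qt x s * b x s))"
      by (simp add: z1_def algebra_simps)
    also have "q x t * b x t - q x 0 * b x 0 - integral {0..t} (\<lambda>s. q x s * B x s + qt x s * b x s) =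
        q x t * z2 x t - integral {0..t} (\<lambda>s. qt x s * z2 x s)"
      unfolding z2_def by (rule parts_defect[OF xt(2) dq(3)[OF xt(1)]]) (auto intro: cs)
    finally show ?thesis by (simp add: D1_def)
  qed
  have dz2: "((\<lambda>x. z2 x t) has_vector_derivative D2 x t) (at x within {0..L})" if xt: "x \<in> {0..L}" "t \<in> {0..\<tau>}" for x t
  proof -
    note cs = cont[THEN continuous_on_slice(1), OF xt(1)] cA[THEN continuous_on_slice(1), OF xt(1)] cB[THEN continuous_on_slice(1), OF xt(1)]
    have "((\<lambda>x. z2 x t) has_vector_derivative (l * cnj (q x t) * a x t) - (l * cnj (q x 0) * a x 0)
        - integral {0..t} (\<lambda>s. l * (cnj (q x s) * A x s + cnj (qt x s) * a x s))) (at x within {0..L})"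
      unfolding z2_def using xt \<tau>
      by (intro has_vector_derivative_diff dab[folded l_def] dint cB cdB dB) auto
    also have "integral {0..t} (\<lambda>s. l * (cnj (q x s) * A x s + cnj (qt x s) * a x s)) =
        l * integral {0..t} (\<lambda>s. cnj (q x s) * A x s + cnj (qt x s) * a x s)" by (rule integral_mult_right)
    also have "(l * cnj (q x t) * a x t) - (l * cnj (q x 0) * a x 0) - \<dots> =
        l * (cnj (q x t) * a x t - cnj (q x 0) * a x 0 - integral {0..t} (\<lambda>s. cnj (q x s) * A x s + cnj (qt x s) * a x s))"
      by (simp add: algebra_simps)
    also have "cnj (q x t) * a x t - cnj (q x 0) * a x 0 - integral {0..t} (\<lambda>s. cnj (q x s) * A x s + cnj (qt x s) * a x s) =
        cnj (q x t) * z1 x t - integral {0..t} (\<lambda>s. cnj (qt x s) * z1 x s)"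
      unfolding z1_def by (rule parts_defect[OF xt(2) has_vector_derivative_cnj[OF dq(3)[OF xt(1)]]]) (auto intro: cs continuous_intros)
    finally show ?thesis by (simp add: D2_def)
  qed
  obtain Q where Q: "0 \<le> Q" "\<forall>x\<in>{0..L}. \<forall>t\<in>{0..\<tau>}. cmod (q x t) \<le> Q"
    using continuous_on_rectangle_norm_bound[OF cont(1)] by (elim exE conjE)
  obtain Qt where Qt: "0 \<le> Qt" "\<forall>x\<in>{0..L}. \<forall>t\<in>{0..\<tau>}. cmod (qt x t) \<le> Qt"
    using continuous_on_rectangle_norm_bound[OF cont(3)] by (elim exE conjE)
  obtain Ba where Ba: "0 \<le> Ba" "\<forall>x\<in>{0..L}. \<forall>t\<in>{0..\<tau>}. cmod (a x t) \<le> Ba"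
    using continuous_on_rectangle_norm_bound[OF cont(4)] by (elim exE conjE)
  obtain Bb where Bb: "0 \<le> Bb" "\<forall>x\<in>{0..L}. \<forall>t\<in>{0..\<tau>}. cmod (b x t) \<le> Bb"
    using continuous_on_rectangle_norm_bound[OF cont(5)] by (elim exE conjE)
  obtain BA where BA: "0 \<le> BA" "\<forall>x\<in>{0..L}. \<forall>t\<in>{0..\<tau>}. cmod (A x t) \<le> BA"
    using continuous_on_rectangle_norm_bound[OF cA] by (elim exE conjE)
  obtain BB where BB: "0 \<le> BB" "\<forall>x\<in>{0..L}. \<forall>t\<in>{0..\<tau>}. cmod (B x t) \<le> BB"
    using continuous_on_rectangle_norm_bound[OF cB] by (elim exE conjE)
  have nint: "cmod (integral {0..t} f) \<le> C * \<tau>"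
    if "t \<in> {0..\<tau>}" "continuous_on {0..\<tau>} f" "\<And>s. s \<in> {0..\<tau>} \<Longrightarrow> cmod (f s) \<le> C" "0 \<le> C" for f C and t
  proof -
    have "cmod (integral {0..t} f) \<le> C * (t - 0)"
      by (rule integral_bound) (use that in \<open>auto intro: continuous_on_subset\<close>)
    also have "\<dots> \<le> C * \<tau>" using that by (intro mult_left_mono) auto
    finally show ?thesis .
  qed
  define K where "K = 2 * cmod k + Q + Qt * \<tau>"
  have K: "0 \<le> K" using Q Qt \<tau> by (simp add: K_def)
  have cz: "continuous_on {0..\<tau>} (z1 x)" "continuous_on {0..\<tau>} (z2 x)" if x: "x \<in> {0..L}" for x
  proof -
    note cs = cont[THEN continuous_on_slice(1), OF x] cA[THEN continuous_on_slice(1), OF x] cB[THEN continuous_on_slice(1), OF x]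
    have "continuous_on {0..\<tau>} (\<lambda>t. integral {0..t} (A x))" "continuous_on {0..\<tau>} (\<lambda>t. integral {0..t} (B x))"
      by (rule continuous_on_vector_derivative, rule integral_has_vector_derivative, rule cs, assumption)+
    then show "continuous_on {0..\<tau>} (z1 x)" "continuous_on {0..\<tau>} (z2 x)"
      unfolding z1_def[abs_def] z2_def[abs_def] by (auto intro!: continuous_intros cs)
  qed
  \<comment> \<open>The parameter is a pair of a component and a time: the x-derivative of the
    defect at time \<open>t\<close> involves both components at all earlier times, so only a
    supremum over all of them closes the estimate.\<close>
  have "(if i then z1 x t else z2 x t) = 0" for i
  proof (rule gronwall_zero[where P = "UNIV \<times> {0..\<tau>}" and p = "(i, t)" and f = "\<lambda>(i, t) x. if i then z1 x t else z2 x t"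
        and f' = "\<lambda>(i, t) x. if i then D1 x t else D2 x t" and K = K and L = L and x = x
        and C = "(Ba + Ba + BA * \<tau>) + (Bb + Bb + BB * \<tau>)", unfolded split_conv, OF K _ _ _ _ _ x])
    show "(i, t) \<in> UNIV \<times> {0..\<tau>}" using t by simp
    show "((case p of (i, t) \<Rightarrow> \<lambda>x. if i then z1 x t else z2 x t) has_vector_derivative
        (case p of (i, t) \<Rightarrow> \<lambda>x. if i then D1 x t else D2 x t) x) (at x within {0..L})"
      if "p \<in> UNIV \<times> {0..\<tau>}" "x \<in> {0..L}" for p :: "bool \<times> real" and x
    proof -
      obtain i t where it: "p = (i, t)" by (cases p)
      then have "t \<in> {0..\<tau>}" using that(1) by simp
      with it show ?thesis using dz1[OF that(2), of t] dz2[OF that(2), of t] by (cases i) simp_all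
    qed
    show "(case p of (i, t) \<Rightarrow> \<lambda>x. if i then z1 x t else z2 x t) 0 = 0" if "p \<in> UNIV \<times> {0..\<tau>}" for p :: "bool \<times> real"
    proof -
      obtain i t where it: "p = (i, t)" by (cases p)
      then have "t \<in> {0..\<tau>}" using that by simp
      with it show ?thesis using init[of t] by (cases i) (simp_all add: z1_def z2_def)
    qed
    show "cmod ((case p of (i, t) \<Rightarrow> \<lambda>x. if i then z1 x t else z2 x t) x) \<le> (Ba + Ba + BA * \<tau>) + (Bb + Bb + BB * \<tau>)"
      if p: "p \<in> UNIV \<times> {0..\<tau>}" and x: "x \<in> {0..L}" for p :: "bool \<times> real" and x
    proof -
      obtain i t where it1: "p = (i, t)" by (cases p)
      then have it2: "t \<in> {0..\<tau>}" using p by simp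
      note it = it1 it2
      have "cmod (z1 x t) \<le> Ba + Ba + BA * \<tau>"
        unfolding z1_def using BA Ba x it \<tau>
        by (intro norm_triangle_le_diff add_mono nint continuous_on_slice(1)[OF cA]) auto
      moreover have "cmod (z2 x t) \<le> Bb + Bb + BB * \<tau>"
        unfolding z2_def using BB Bb x it \<tau>
        by (intro norm_triangle_le_diff add_mono nint continuous_on_slice(1)[OF cB]) auto
      moreover have "0 \<le> Ba + Ba + BA * \<tau>" "0 \<le> Bb + Bb + BB * \<tau>" using Ba Bb BA BB \<tau> by simp_all
      ultimately show ?thesis using it by auto
    qed
    show "cmod ((case p of (i, t) \<Rightarrow> \<lambda>x. if i then D1 x t else D2 x t) x) \<le> K * S"
      if p: "p \<in> UNIV \<times> {0..\<tau>}" and x: "x \<in> {0..L}"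
        and S: "\<And>p :: bool \<times> real. p \<in> UNIV \<times> {0..\<tau>} \<Longrightarrow> cmod ((case p of (i, t) \<Rightarrow> \<lambda>x. if i then z1 x t else z2 x t) x) \<le> S"
      for p :: "bool \<times> real" and x S
    proof -
      obtain i t where it1: "p = (i, t)" by (cases p)
      then have it2: "t \<in> {0..\<tau>}" using p by simp
      note it = it1 it2
      have S1: "cmod (z1 x s) \<le> S" and S2: "cmod (z2 x s) \<le> S" if "s \<in> {0..\<tau>}" for s
        using S[of "(True, s)"] S[of "(False, s)"] that by auto
      have S0: "0 \<le> S" using order_trans[OF norm_ge_zero S1[OF it(2)]] .
      note cs = cont[THEN continuous_on_slice(1), OF x] cz[OF x]
      have i1: "cmod (integral {0..t} (\<lambda>s. qt x s * z2 x s)) \<le> Qt * S * \<tau>"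
        using Qt x S0 it by (intro nint) (auto simp: norm_mult intro!: mult_mono S2 continuous_intros cs)
      have i2: "cmod (integral {0..t} (\<lambda>s. cnj (qt x s) * z1 x s)) \<le> Qt * S * \<tau>"
        using Qt x S0 it by (intro nint) (auto simp: norm_mult intro!: mult_mono S1 continuous_intros cs)
      have q1: "cmod (q x t * z2 x t) \<le> Q * S" "cmod (cnj (q x t) * z1 x t) \<le> Q * S"
        using Q x it S0 by (auto simp: norm_mult intro!: mult_mono S1 S2)
      have k1: "cmod (2 * \<i> * k * z1 x t) \<le> 2 * cmod k * S"
        using S1[OF it(2)] by (simp add: norm_mult mult_left_mono)
      have "cmod (D1 x t) \<le> 2 * cmod k * S + (Q * S + Qt * S * \<tau>)"
        unfolding D1_def by (rule order_trans[OF norm_triangle_ineq])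
          (use k1 q1 i1 in \<open>auto intro!: add_mono norm_triangle_le_diff simp: norm_mult\<close>)
      moreover have "cmod (D2 x t) \<le> Q * S + Qt * S * \<tau>"
        unfolding D2_def norm_mult nl mult_1 using q1 i2 by (intro norm_triangle_le_diff add_mono) (auto simp: norm_mult)
      moreover have "0 \<le> 2 * cmod k * S" using S0 by simp
      ultimately have "cmod (D1 x t) \<le> K * S" "cmod (D2 x t) \<le> K * S" by (auto simp: K_def algebra_simps)
      then show ?thesis using it by simp
    qed
  qed
  from this[of True] this[of False] show "a x t = a x 0 + integral {0..t} (A x)" "b x t = b x 0 + integral {0..t} (B x)"
    by (simp_all add: z1_def z2_def algebra_simps)
qed

section \<open>Large k asymptotics of the spatial problem\<close>

text \<open>The weight \<open>exp (- 4\<kappa>x)\<close> absorbs the growing exponential, whatever the sign of \<open>Im k\<close>.\<close>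

lemma scattering_energy_estimate:
  fixes eu ev :: "real \<Rightarrow> complex"
  assumes L: "0 < L" and lam: "\<bar>lam\<bar> = 1" and \<kappa>: "0 \<le> \<kappa>" "Im k \<le> \<kappa>" and Q: "0 \<le> Q" "\<And>x. x \<in> {0..L} \<Longrightarrow> cmod (q x) \<le> Q"
    and du: "\<And>x. x \<in> {0..L} \<Longrightarrow> (eu has_vector_derivative (- 2 * \<i> * k * eu x + q x * ev x + r1 x)) (at x within {0..L})"
    and dv: "\<And>x. x \<in> {0..L} \<Longrightarrow> (ev has_vector_derivative (of_real lam * cnj (q x) * eu x + r2 x)) (at x within {0..L})"
    and r: "\<And>x. x \<in> {0..L} \<Longrightarrow> cmod (r1 x) \<le> \<rho> * exp (2 * \<kappa> * x)" "\<And>x. x \<in> {0..L} \<Longrightarrow> cmod (r2 x) \<le> \<rho> * exp (2 * \<kappa> * x)"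
    and init: "cmod (eu 0) \<le> \<rho>" "cmod (ev 0) \<le> \<rho>"
  shows "cmod (eu L) \<le> 2 * exp ((2 * Q + 1) * L / 2) * \<rho> * exp (2 * \<kappa> * L)"
proof -
  define a where "a = 2 * Q + 1"
  have a: "1 \<le> a" using Q by (simp add: a_def)
  have \<rho>: "0 \<le> \<rho>" using init norm_ge_zero order_trans by blast
  define n where "n x = (cmod (eu x))\<^sup>2 + (cmod (ev x))\<^sup>2" for x
  define n' where "n' x = 2 * (eu x \<bullet> (- 2 * \<i> * k * eu x + q x * ev x + r1 x))
    + 2 * (ev x \<bullet> (of_real lam * cnj (q x) * eu x + r2 x))" for x
  define m where "m x = n x * exp (- 4 * \<kappa> * x)" for x
  \<comment> \<open>\<open>m\<close> grows at most at rate \<open>a\<close>, up to a forcing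
    2\<rho>^2. As \<open>a\<close> is at least 1, adding 2\<rho>^2 to \<open>m\<close> absorbs the
    forcing and makes \<open>w\<close> nonincreasing.\<close>
  define w where "w x = (m x + 2 * \<rho>\<^sup>2) * exp (- a * x)" for x
  have dn: "(n has_vector_derivative n' x) (at x within {0..L})" if "x \<in> {0..L}" for x
  proof -
    have "((\<lambda>x. eu x \<bullet> eu x + ev x \<bullet> ev x) has_vector_derivative n' x) (at x within {0..L})"
      using du[OF that] dv[OF that] unfolding has_vector_derivative_def n'_def
      by (auto intro!: derivative_eq_intros simp: inner_commute algebra_simps)
    then show ?thesis by (simp add: n_def[abs_def] power2_norm_eq_inner)
  qed
  have n'_le: "n' x \<le> (4 * \<kappa> + a) * n x + 2 * (\<rho> * exp (2 * \<kappa> * x))\<^sup>2" if x: "x \<in> {0..L}" for x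
  proof -
    define e where "e = \<rho> * exp (2 * \<kappa> * x)"
    have re: "eu x \<bullet> (- 2 * \<i> * k * eu x) = 2 * Im k * (cmod (eu x))\<^sup>2"
      by (simp add: inner_complex_def cmod_power2) (simp add: power2_eq_square algebra_simps)
    have "Im k * (cmod (eu x))\<^sup>2 \<le> \<kappa> * (cmod (eu x))\<^sup>2" by (intro mult_right_mono \<kappa>) auto
    then have i1: "eu x \<bullet> (- 2 * \<i> * k * eu x) \<le> 2 * \<kappa> * (cmod (eu x))\<^sup>2" unfolding re by simp
    have cs: "u \<bullet> (c * v) \<le> Q * (cmod u * cmod v)" if "cmod c \<le> Q" for u v c :: complex
    proof -
      have "u \<bullet> (c * v) \<le> cmod u * (cmod c * cmod v)" using norm_cauchy_schwarz[of u "c * v"] by (simp add: norm_mult)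
      also have "\<dots> \<le> cmod u * (Q * cmod v)" using that by (intro mult_left_mono mult_right_mono) auto
      finally show ?thesis by (simp add: mult_ac)
    qed
    have i2: "eu x \<bullet> (q x * ev x) \<le> Q * (cmod (eu x) * cmod (ev x))" by (rule cs[OF Q(2)[OF x]])
    have "ev x \<bullet> (of_real lam * cnj (q x) * eu x) \<le> Q * (cmod (ev x) * cmod (eu x))"
      using lam Q(2)[OF x] by (intro cs) (simp add: norm_mult)
    then have i3: "ev x \<bullet> (of_real lam * cnj (q x) * eu x) \<le> Q * (cmod (eu x) * cmod (ev x))" by (simp add: mult_ac)
    have sq: "2 * (s * t) \<le> s\<^sup>2 + t\<^sup>2" for s t :: real using zero_le_power2[of "s - t"] by (simp add: power2_diff)
    have cr: "2 * (u \<bullet> r) \<le> (cmod u)\<^sup>2 + e\<^sup>2" if "cmod r \<le> e" for u r :: complex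
    proof -
      have "u \<bullet> r \<le> cmod u * e" using norm_cauchy_schwarz[of u r] mult_left_mono[OF that norm_ge_zero[of u]] by linarith
      then show ?thesis using sq[of "cmod u" e] by linarith
    qed
    have i4: "2 * (eu x \<bullet> r1 x) \<le> (cmod (eu x))\<^sup>2 + e\<^sup>2" "2 * (ev x \<bullet> r2 x) \<le> (cmod (ev x))\<^sup>2 + e\<^sup>2"
      using cr[OF r(1)[OF x, folded e_def]] cr[OF r(2)[OF x, folded e_def]] by auto
    have i5: "Q * (2 * (cmod (eu x) * cmod (ev x))) \<le> Q * n x"
      unfolding n_def by (intro mult_left_mono sq Q)
    have i6: "2 * \<kappa> * (cmod (eu x))\<^sup>2 \<le> 2 * \<kappa> * n x" unfolding n_def using \<kappa> by (intro mult_left_mono) auto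
    have "n' x = 2 * (eu x \<bullet> (- 2 * \<i> * k * eu x)) + 2 * (eu x \<bullet> (q x * ev x)) + 2 * (eu x \<bullet> r1 x)
        + 2 * (ev x \<bullet> (of_real lam * cnj (q x) * eu x)) + 2 * (ev x \<bullet> r2 x)"
      unfolding n'_def by (simp only: inner_add_right distrib_left add.assoc)
    also have "\<dots> \<le> 4 * \<kappa> * n x + 2 * (Q * n x) + (n x + 2 * e\<^sup>2)"
      using i1 i2 i3 i4 i5 i6 unfolding n_def by linarith
    finally show ?thesis by (simp add: a_def e_def algebra_simps)
  qed
  have dw: "(w has_real_derivative ((n' x * exp (- 4 * \<kappa> * x) - 4 * \<kappa> * m x) - a * (m x + 2 * \<rho>\<^sup>2)) * exp (- a * x)) (at x within {0..L})"
    if x: "x \<in> {0..L}" for x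
    using dn[OF x] unfolding w_def m_def has_real_derivative_iff_has_vector_derivative[symmetric]
    by (auto intro!: derivative_eq_intros simp: algebra_simps)
  have "w L \<le> w 0"
  proof (rule DERIV_nonpos_imp_decreasing_open[OF less_imp_le[OF L]])
    show "continuous_on {0..L} w" using dw by (rule DERIV_continuous_on)
    fix x assume x: "0 < x" "x < L"
    have "n' x * exp (- 4 * \<kappa> * x) \<le> ((4 * \<kappa> + a) * n x + 2 * (\<rho> * exp (2 * \<kappa> * x))\<^sup>2) * exp (- 4 * \<kappa> * x)"
      using x by (intro mult_right_mono n'_le) auto
    also have "\<dots> = (4 * \<kappa> + a) * m x + 2 * \<rho>\<^sup>2 * ((exp (2 * \<kappa> * x))\<^sup>2 * exp (- 4 * \<kappa> * x))"
      by (simp add: m_def power_mult_distrib algebra_simps)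
    also have "(exp (2 * \<kappa> * x))\<^sup>2 * exp (- 4 * \<kappa> * x) = 1"
      by (simp add: exp_double[symmetric] exp_minus mult.assoc flip: exp_add)
    finally have "n' x * exp (- 4 * \<kappa> * x) - 4 * \<kappa> * m x \<le> a * m x + 2 * \<rho>\<^sup>2" by (simp add: algebra_simps)
    also have "\<dots> \<le> a * m x + a * (2 * \<rho>\<^sup>2)" using a mult_right_mono[of 1 a "2 * \<rho>\<^sup>2"] by simp
    finally have "((n' x * exp (- 4 * \<kappa> * x) - 4 * \<kappa> * m x) - a * (m x + 2 * \<rho>\<^sup>2)) * exp (- a * x) \<le> 0"
      by (intro mult_nonpos_nonneg) (auto simp: algebra_simps)
    moreover have "at x within {0..L} = at x" using x by (intro at_within_Icc_at) auto
    ultimately show "\<exists>y. (w has_real_derivative y) (at x) \<and> y \<le> 0"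
      using dw[of x] x by (intro exI conjI) auto
  qed
  then have "m L + 2 * \<rho>\<^sup>2 \<le> exp (a * L) * (m 0 + 2 * \<rho>\<^sup>2)"
    by (simp add: w_def exp_minus field_simps)
  also have "\<dots> \<le> exp (a * L) * (4 * \<rho>\<^sup>2)"
    using power_mono[OF init(1), of 2] power_mono[OF init(2), of 2] by (intro mult_left_mono) (auto simp: m_def n_def)
  finally have mL: "m L \<le> exp (a * L) * (4 * \<rho>\<^sup>2)" using zero_le_power2[of \<rho>] by linarith
  have "(cmod (eu L))\<^sup>2 * exp (- 4 * \<kappa> * L) \<le> m L" unfolding m_def n_def by (intro mult_right_mono) auto
  then have "(cmod (eu L))\<^sup>2 * exp (- 4 * \<kappa> * L) * exp (4 * \<kappa> * L) \<le> exp (a * L) * (4 * \<rho>\<^sup>2) * exp (4 * \<kappa> * L)"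
    using mL by (intro mult_right_mono) auto
  also have "(cmod (eu L))\<^sup>2 * exp (- 4 * \<kappa> * L) * exp (4 * \<kappa> * L) = (cmod (eu L))\<^sup>2"
    by (simp add: mult.assoc flip: exp_add)
  also have "exp (a * L) * (4 * \<rho>\<^sup>2) * exp (4 * \<kappa> * L) = (2 * exp (a * L / 2) * \<rho> * exp (2 * \<kappa> * L))\<^sup>2"
    by (simp add: power_mult_distrib exp_double[symmetric])
  finally show ?thesis unfolding a_def by (rule power2_le_imp_le) (use \<rho> in auto)
qed

text \<open>The two formal solutions are \<open>(U, V)\<close> without and \<open>(U2, V2)\<close> with the factor \<open>exp (- 2\<i>kx)\<close>; the
  second is the Schwarz conjugate of the first.\<close>

lemma wkb_residual:
  fixes q u1 u2 u3 v1 v2 :: "real \<Rightarrow> complex" and lam :: real and k :: complex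
  assumes k: "k \<noteq> 0"
    and d: "(u1 has_vector_derivative u1') (at x within S)" "(u2 has_vector_derivative u2') (at x within S)"
      "(u3 has_vector_derivative u3') (at x within S)"
      "(v1 has_vector_derivative of_real lam * cnj (q x) * u1 x) (at x within S)"
      "(v2 has_vector_derivative of_real lam * cnj (q x) * u2 x) (at x within S)"
    and rel: "2 * \<i> * u1 x = q x" "2 * \<i> * u2 x = q x * v1 x - u1'" "2 * \<i> * u3 x = q x * v2 x - u2'"
  defines "U \<equiv> \<lambda>x. u1 x / k + u2 x / k^2 + u3 x / k^3" and "V \<equiv> \<lambda>x. 1 + v1 x / k + v2 x / k^2"
    and "U2 \<equiv> \<lambda>x. exp (- 2 * \<i> * k * of_real x) * (1 + cnj (v1 x) / k + cnj (v2 x) / k^2)"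
    and "V2 \<equiv> \<lambda>x. exp (- 2 * \<i> * k * of_real x) * (of_real lam * (cnj (u1 x) / k + cnj (u2 x) / k^2 + cnj (u3 x) / k^3))"
  shows "(U has_vector_derivative (- 2 * \<i> * k * U x + q x * V x + u3' / k^3)) (at x within S)"
    "(V has_vector_derivative (of_real lam * cnj (q x) * U x - of_real lam * cnj (q x) * u3 x / k^3)) (at x within S)"
    "(U2 has_vector_derivative (- 2 * \<i> * k * U2 x + q x * V2 x - exp (- 2 * \<i> * k * of_real x) * (of_real lam * q x * cnj (u3 x)) / k^3)) (at x within S)"
    "(V2 has_vector_derivative (of_real lam * cnj (q x) * U2 x + exp (- 2 * \<i> * k * of_real x) * (of_real lam * cnj u3') / k^3)) (at x within S)"
proof -
  have crel: "- 2 * \<i> * cnj (u1 x) = cnj (q x)" "- 2 * \<i> * cnj (u2 x) = cnj (q x) * cnj (v1 x) - cnj u1'"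
      "- 2 * \<i> * cnj (u3 x) = cnj (q x) * cnj (v2 x) - cnj u2'"
    using arg_cong[OF rel(1), of cnj] arg_cong[OF rel(2), of cnj] arg_cong[OF rel(3), of cnj] by simp_all
  define E where "E x = exp (- 2 * \<i> * k * of_real x)" for x :: real
  have dE: "(E has_vector_derivative - 2 * \<i> * k * E x) (at x within S)"
  proof -
    have "((\<lambda>z. exp (- 2 * \<i> * k * z)) has_field_derivative - 2 * \<i> * k * E x) (at (of_real x))"
      by (auto intro!: derivative_eq_intros simp: E_def)
    from has_vector_derivative_real_field[OF this] show ?thesis by (simp add: E_def[abs_def])
  qed
  note dc = d[THEN has_vector_derivative_cnj]
  have "(U has_vector_derivative u1' / k + u2' / k^2 + u3' / k^3) (at x within S)"
    unfolding U_def by (intro has_vector_derivative_add has_vector_derivative_divide d)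
  also have "u1' / k + u2' / k^2 + u3' / k^3 = - 2 * \<i> * k * U x + q x * V x + u3' / k^3"
  proof -
    have "- 2 * \<i> * k * U x = - (2 * \<i> * u1 x) - (2 * \<i> * u2 x) / k - (2 * \<i> * u3 x) / k^2"
      using k by (simp add: U_def field_simps power2_eq_square power3_eq_cube)
    then show ?thesis unfolding rel V_def by (simp add: algebra_simps diff_divide_distrib)
  qed
  finally show "(U has_vector_derivative (- 2 * \<i> * k * U x + q x * V x + u3' / k^3)) (at x within S)" .
  have "(V has_vector_derivative 0 + of_real lam * cnj (q x) * u1 x / k + of_real lam * cnj (q x) * u2 x / k^2) (at x within S)"
    unfolding V_def by (intro has_vector_derivative_add has_vector_derivative_divide d has_vector_derivative_const)
  then show "(V has_vector_derivative (of_real lam * cnj (q x) * U x - of_real lam * cnj (q x) * u3 x / k^3)) (at x within S)"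
    by (simp add: U_def algebra_simps)
  have "(U2 has_vector_derivative E x * (0 + cnj (of_real lam * cnj (q x) * u1 x) / k + cnj (of_real lam * cnj (q x) * u2 x) / k^2)
      + - 2 * \<i> * k * E x * (1 + cnj (v1 x) / k + cnj (v2 x) / k^2)) (at x within S)"
    unfolding U2_def E_def[symmetric]
    by (intro has_vector_derivative_mult has_vector_derivative_add has_vector_derivative_divide dc has_vector_derivative_const dE)
  also have "E x * (0 + cnj (of_real lam * cnj (q x) * u1 x) / k + cnj (of_real lam * cnj (q x) * u2 x) / k^2)
      + - 2 * \<i> * k * E x * (1 + cnj (v1 x) / k + cnj (v2 x) / k^2) =
      - 2 * \<i> * k * U2 x + q x * V2 x - E x * (of_real lam * q x * cnj (u3 x)) / k^3"
    unfolding U2_def V2_def E_def[symmetric] by (simp add: algebra_simps)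
  finally show "(U2 has_vector_derivative (- 2 * \<i> * k * U2 x + q x * V2 x - exp (- 2 * \<i> * k * of_real x) * (of_real lam * q x * cnj (u3 x)) / k^3)) (at x within S)"
    unfolding E_def .
  have "(V2 has_vector_derivative E x * (of_real lam * (cnj u1' / k + cnj u2' / k^2 + cnj u3' / k^3))
      + - 2 * \<i> * k * E x * (of_real lam * (cnj (u1 x) / k + cnj (u2 x) / k^2 + cnj (u3 x) / k^3))) (at x within S)"
    unfolding V2_def E_def[symmetric]
    by (intro has_vector_derivative_mult has_vector_derivative_add has_vector_derivative_divide dc has_vector_derivative_const
        has_vector_derivative_mult_right dE)
  also have "E x * (of_real lam * (cnj u1' / k + cnj u2' / k^2 + cnj u3' / k^3))
      + - 2 * \<i> * k * E x * (of_real lam * (cnj (u1 x) / k + cnj (u2 x) / k^2 + cnj (u3 x) / k^3)) =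
      of_real lam * E x * (cnj u1' / k + cnj u2' / k^2 + cnj u3' / k^3
      + (- 2 * \<i> * cnj (u1 x)) + (- 2 * \<i> * cnj (u2 x)) / k + (- 2 * \<i> * cnj (u3 x)) / k^2)"
    using k by (simp add: field_simps power2_eq_square power3_eq_cube)
  also have "\<dots> = of_real lam * cnj (q x) * U2 x + E x * (of_real lam * cnj u3') / k^3"
    unfolding crel U2_def E_def[symmetric] by (simp add: algebra_simps diff_divide_distrib)
  finally show "(V2 has_vector_derivative (of_real lam * cnj (q x) * U2 x + exp (- 2 * \<i> * k * of_real x) * (of_real lam * cnj u3') / k^3)) (at x within S)"
    unfolding E_def .
qed

text \<open>Used for polynomials in y = 1/k with |k| \<ge> 1: the truncation errors of products of
  the expansions are y^3 times such polynomials.\<close>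

lemma continuous_unit_disc_bound:
  fixes R :: "complex \<Rightarrow> complex"
  assumes "continuous_on UNIV R"
  shows "\<exists>B\<ge>0. \<forall>y. cmod y \<le> 1 \<longrightarrow> cmod (R y) \<le> B"
proof -
  have "bounded (R ` cball 0 1)"
    by (intro compact_imp_bounded compact_continuous_image continuous_on_subset[OF assms]) auto
  then obtain B where B: "\<forall>z\<in>R ` cball 0 1. norm z \<le> B" unfolding bounded_iff ..
  have "cmod (R y) \<le> \<bar>B\<bar>" if "cmod y \<le> 1" for y
  proof -
    have "R y \<in> R ` cball 0 1" using that by simp
    then have "norm (R y) \<le> B" using B by blast
    then show ?thesis by linarith
  qed
  then show ?thesis by (intro exI[of _ "\<bar>B\<bar>"]) simp
qed

text \<open>The approximate solution is \<open>P\<close> times the combination of the two formal solutions whose first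
  component vanishes at \<open>0\<close>; \<open>P = 1 + p / k\<^sup>2\<close> normalises the second component up to \<open>O(k\<^sup>-\<^sup>3)\<close>.\<close>

lemma scattering_asymptotics:
  fixes q q1 q2 q3 :: "real \<Rightarrow> complex" and u v :: "complex \<Rightarrow> real \<Rightarrow> complex" and L lam :: real
  assumes L: "0 < L" and lam: "\<bar>lam\<bar> = 1"
    and dq: "\<And>x. x \<in> {0..L} \<Longrightarrow> (q has_vector_derivative q1 x) (at x within {0..L})"
      "\<And>x. x \<in> {0..L} \<Longrightarrow> (q1 has_vector_derivative q2 x) (at x within {0..L})"
      "\<And>x. x \<in> {0..L} \<Longrightarrow> (q2 has_vector_derivative q3 x) (at x within {0..L})"
    and cq3: "continuous_on {0..L} q3"
    and du: "\<And>k x. x \<in> {0..L} \<Longrightarrow> (u k has_vector_derivative (- 2 * \<i> * k * u k x + q x * v k x)) (at x within {0..L})"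
    and dv: "\<And>k x. x \<in> {0..L} \<Longrightarrow> (v k has_vector_derivative (of_real lam * cnj (q x) * u k x)) (at x within {0..L})"
    and init: "\<And>k. u k 0 = 0" "\<And>k. v k 0 = 1"
  defines "m \<equiv> complex_of_real lam * integral {0..L} (\<lambda>x. q x * cnj (q x))"
  shows "\<exists>C\<ge>0. \<forall>k. 1 \<le> cmod k \<longrightarrow>
    cmod (- exp (2 * \<i> * k * of_real L) * u k L -
      ((q 0 - exp (2 * \<i> * k * of_real L) * q L) / (2 * \<i> * k)
       + (((q1 0 + q 0 * m) / 4) - exp (2 * \<i> * k * of_real L) * ((q1 L - q L * m) / 4)) / k^2))
    \<le> C * max 1 (exp (- 2 * Im k * L)) / (cmod k)^3"
proof -
  define l where "l = complex_of_real lam"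
  \<comment> \<open>Coefficients of the formal solution in powers of 1/k. The first equation gives
    each next u-coefficient algebraically from the preceding v-coefficient and u-derivative; the
    second gives the v-coefficients by integration from 0. Primes denote x-derivatives, and
    \<open>u3'\<close> is where the third derivative of \<open>q\<close> is consumed.\<close>
  define u1 where "u1 x = q x / (2 * \<i>)" for x
  define u1' where "u1' x = q1 x / (2 * \<i>)" for x
  define v1 where "v1 x = integral {0..x} (\<lambda>y. l * cnj (q y) * u1 y)" for x
  define u2 where "u2 x = (q x * v1 x - u1' x) / (2 * \<i>)" for x
  define u2' where "u2' x = (q x * (l * cnj (q x) * u1 x) + q1 x * v1 x - q2 x / (2 * \<i>)) / (2 * \<i>)" for x
  define v2 where "v2 x = integral {0..x} (\<lambda>y. l * cnj (q y) * u2 y)" for x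
  define u3 where "u3 x = (q x * v2 x - u2' x) / (2 * \<i>)" for x
  define u2'' where "u2'' x = ((q x * (l * cnj (q x) * u1' x + l * cnj (q1 x) * u1 x) + q1 x * (l * cnj (q x) * u1 x))
    + (q1 x * (l * cnj (q x) * u1 x) + q2 x * v1 x) - q3 x / (2 * \<i>)) / (2 * \<i>)" for x
  define u3' where "u3' x = (q x * (l * cnj (q x) * u2 x) + q1 x * v2 x - u2'' x) / (2 * \<i>)" for x
  have cq: "continuous_on {0..L} q" "continuous_on {0..L} q1" "continuous_on {0..L} q2"
    by (rule continuous_on_vector_derivative, erule dq)+
  have cu1: "continuous_on {0..L} u1" unfolding u1_def[abs_def] by (intro continuous_intros cq) auto
  have cu1': "continuous_on {0..L} u1'" unfolding u1'_def[abs_def] by (intro continuous_intros cq) auto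
  have du1: "(u1 has_vector_derivative u1' x) (at x within {0..L})" if "x \<in> {0..L}" for x
    unfolding u1_def[abs_def] u1'_def by (intro has_vector_derivative_divide dq that)
  have dv1: "(v1 has_vector_derivative l * cnj (q x) * u1 x) (at x within {0..L})" if "x \<in> {0..L}" for x
    unfolding v1_def[abs_def] by (rule integral_has_vector_derivative[OF _ that]) (intro continuous_intros cq cu1)
  have cv1: "continuous_on {0..L} v1" using dv1 by (rule continuous_on_vector_derivative)
  have cu2: "continuous_on {0..L} u2" unfolding u2_def[abs_def] by (intro continuous_intros cq cv1 cu1') auto
  have du2: "(u2 has_vector_derivative u2' x) (at x within {0..L})" if "x \<in> {0..L}" for x
    unfolding u2_def[abs_def] u2'_def u1'_def[abs_def]
    by (intro has_vector_derivative_divide has_vector_derivative_diff has_vector_derivative_mult dv1 dq that)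
  have dv2: "(v2 has_vector_derivative l * cnj (q x) * u2 x) (at x within {0..L})" if "x \<in> {0..L}" for x
    unfolding v2_def[abs_def] by (rule integral_has_vector_derivative[OF _ that]) (intro continuous_intros cq cu2)
  have cv2: "continuous_on {0..L} v2" using dv2 by (rule continuous_on_vector_derivative)
  have du2': "(u2' has_vector_derivative u2'' x) (at x within {0..L})" if "x \<in> {0..L}" for x
    unfolding u2'_def[abs_def] u2''_def
    by (intro has_vector_derivative_divide has_vector_derivative_diff has_vector_derivative_add
        has_vector_derivative_mult has_vector_derivative_mult_right has_vector_derivative_cnj dv1 du1 dq that)
  have du3: "(u3 has_vector_derivative u3' x) (at x within {0..L})" if "x \<in> {0..L}" for x
    unfolding u3_def[abs_def] u3'_def
    by (intro has_vector_derivative_divide has_vector_derivative_diff has_vector_derivative_mult dv2 du2' dq that)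
  have cu3: "continuous_on {0..L} u3" using du3 by (rule continuous_on_vector_derivative)
  have cu3': "continuous_on {0..L} u3'" unfolding u3'_def[abs_def] u2''_def[abs_def]
    by (intro continuous_intros cq cv1 cv2 cu1 cu1' cu2 cq3) auto
  have rel: "2 * \<i> * u1 x = q x" "2 * \<i> * u2 x = q x * v1 x - u1' x" "2 * \<i> * u3 x = q x * v2 x - u2' x" for x
    by (simp_all add: u1_def u2_def u3_def)
  have v0: "v1 0 = 0" "v2 0 = 0" by (simp_all add: v1_def v2_def)
  obtain Q where Q: "0 \<le> Q" "\<forall>x\<in>{0..L}. cmod (q x) \<le> Q"
    using continuous_on_Icc_norm_bound[OF cq(1)] by (elim exE conjE)
  obtain M3 where M3: "0 \<le> M3" "\<forall>x\<in>{0..L}. cmod (u3 x) \<le> M3"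
    using continuous_on_Icc_norm_bound[OF cu3] by (elim exE conjE)
  obtain M3' where M3': "0 \<le> M3'" "\<forall>x\<in>{0..L}. cmod (u3' x) \<le> M3'"
    using continuous_on_Icc_norm_bound[OF cu3'] by (elim exE conjE)
  define a1 a2 a3 where "a1 = u1 0" and "a2 = u2 0" and "a3 = u3 0"
  define b1 b2 b3 where "b1 = cnj a1" and "b2 = cnj a2" and "b3 = cnj a3"
  define c1 c2 where "c1 = cnj (v1 L)" and "c2 = cnj (v2 L)"
  define l1 l2 l3 where "l1 = u1 L" and "l2 = u2 L" and "l3 = u3 L"
  \<comment> \<open>The combination has second component 1 - l a1 b1 y^2 + O(y^3) at
    \<open>x = 0\<close>, so this \<open>p\<close> cancels the quadratic term.\<close>
  define p where "p = l * a1 * b1"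
  \<comment> \<open>The cofactors of y^3: \<open>B0\<close> for the error in the initial value,
    \<open>BL\<close> and \<open>B1\<close> for the two formal solutions at \<open>x = L\<close>
    after removal of their first two orders. \<open>BS\<close> and \<open>BP\<close> bound the
    coefficients of the combination themselves.\<close>
  have "\<exists>B\<ge>0. \<forall>y. cmod y \<le> 1 \<longrightarrow> cmod (l * (a1 * (b2 + b3 * y) + (a2 + a3 * y) * (b1 + b2 * y + b3 * y^2))
      + p * l * y * (a1 + a2 * y + a3 * y^2) * (b1 + b2 * y + b3 * y^2)) \<le> B"
    by (rule continuous_unit_disc_bound) (intro continuous_intros)
  then obtain B0 where B0: "0 \<le> B0" "\<forall>y. cmod y \<le> 1 \<longrightarrow> cmod (l * (a1 * (b2 + b3 * y) + (a2 + a3 * y) * (b1 + b2 * y + b3 * y^2))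
      + p * l * y * (a1 + a2 * y + a3 * y^2) * (b1 + b2 * y + b3 * y^2)) \<le> B0" by (elim exE conjE)
  have "\<exists>B\<ge>0. \<forall>y. cmod y \<le> 1 \<longrightarrow> cmod (l3 + p * (l1 + l2 * y + l3 * y^2)) \<le> B"
    by (rule continuous_unit_disc_bound) (intro continuous_intros)
  then obtain BL where BL: "0 \<le> BL" "\<forall>y. cmod y \<le> 1 \<longrightarrow> cmod (l3 + p * (l1 + l2 * y + l3 * y^2)) \<le> BL" by (elim exE conjE)
  have "\<exists>B\<ge>0. \<forall>y. cmod y \<le> 1 \<longrightarrow> cmod (a3 + a2 * c1 + a1 * c2 + y * (a3 * c1 + a2 * c2) + y^2 * a3 * c2
      + p * (a1 + a2 * y + a3 * y^2) * (1 + c1 * y + c2 * y^2)) \<le> B"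
    by (rule continuous_unit_disc_bound) (intro continuous_intros)
  then obtain B1 where B1: "0 \<le> B1" "\<forall>y. cmod y \<le> 1 \<longrightarrow> cmod (a3 + a2 * c1 + a1 * c2 + y * (a3 * c1 + a2 * c2) + y^2 * a3 * c2
      + p * (a1 + a2 * y + a3 * y^2) * (1 + c1 * y + c2 * y^2)) \<le> B1" by (elim exE conjE)
  have "\<exists>B\<ge>0. \<forall>y. cmod y \<le> 1 \<longrightarrow> cmod (a1 * y + a2 * y^2 + a3 * y^3) \<le> B"
    by (rule continuous_unit_disc_bound) (intro continuous_intros)
  then obtain BS where BS: "0 \<le> BS" "\<forall>y. cmod y \<le> 1 \<longrightarrow> cmod (a1 * y + a2 * y^2 + a3 * y^3) \<le> BS" by (elim exE conjE)
  have "\<exists>B\<ge>0. \<forall>y. cmod y \<le> 1 \<longrightarrow> cmod (1 + p * y^2) \<le> B"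
    by (rule continuous_unit_disc_bound) (intro continuous_intros)
  then obtain BP where BP: "0 \<le> BP" "\<forall>y. cmod y \<le> 1 \<longrightarrow> cmod (1 + p * y^2) \<le> BP" by (elim exE conjE)
  define Kr where "Kr = BP * (M3' + Q * M3 + BS * (Q * M3 + M3')) + B0"
  have Kr: "0 \<le> Kr" unfolding Kr_def using BP BS Q M3 M3' B0 by (intro add_nonneg_nonneg mult_nonneg_nonneg) auto
  define Ce where "Ce = 2 * exp ((2 * Q + 1) * L / 2)"
  have "cmod (- exp (2 * \<i> * k * of_real L) * u k L -
      ((q 0 - exp (2 * \<i> * k * of_real L) * q L) / (2 * \<i> * k)
       + (((q1 0 + q 0 * m) / 4) - exp (2 * \<i> * k * of_real L) * ((q1 L - q L * m) / 4)) / k^2))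
    \<le> (Ce * Kr + BL + B1) * max 1 (exp (- 2 * Im k * L)) / (cmod k)^3" if k: "1 \<le> cmod k" for k
  proof -
    have k0: "k \<noteq> 0" using k by auto
    define y where "y = 1 / k"
    have y: "cmod y \<le> 1" using k by (simp add: y_def norm_divide divide_le_eq)
    have y3: "cmod (y^3) = 1 / (cmod k)^3" by (simp add: y_def norm_divide norm_power power_divide)
    define \<kappa> where "\<kappa> = max 0 (Im k)"
    have \<kappa>: "0 \<le> \<kappa>" "Im k \<le> \<kappa>" by (auto simp: \<kappa>_def)
    define E where "E x = exp (- 2 * \<i> * k * of_real x)" for x :: real
    define G where "G = exp (2 * \<i> * k * of_real L)"
    have GE: "G * E L = 1" unfolding G_def E_def by (simp flip: exp_add)
    define U where "U x = u1 x / k + u2 x / k^2 + u3 x / k^3" for x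
    define V where "V x = 1 + v1 x / k + v2 x / k^2" for x
    define U2 where "U2 x = E x * (1 + cnj (v1 x) / k + cnj (v2 x) / k^2)" for x
    define V2 where "V2 x = E x * (l * (cnj (u1 x) / k + cnj (u2 x) / k^2 + cnj (u3 x) / k^3))" for x
    define P where "P = 1 + p * y^2"
    define S0 where "S0 = U 0"
    have S0: "S0 = a1 * y + a2 * y^2 + a3 * y^3"
      by (simp add: S0_def U_def a1_def a2_def a3_def y_def power_divide)
    have V20: "V2 0 = l * (b1 * y + b2 * y^2 + b3 * y^3)"
      by (simp add: V2_def E_def a1_def a2_def a3_def b1_def b2_def b3_def y_def power_divide)
    have nS0: "cmod S0 \<le> BS" using BS(2) y unfolding S0 by blast
    have nP: "cmod P \<le> BP" using BP(2) y unfolding P_def by blast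
    define eu where "eu x = u k x - P * (U x - S0 * U2 x)" for x
    define ev where "ev x = v k x - P * (V x - S0 * V2 x)" for x
    define r1 where "r1 x = - (P * (u3' x * y^3 + S0 * (E x * (l * q x * cnj (u3 x)) * y^3)))" for x
    define r2 where "r2 x = P * (l * cnj (q x) * u3 x * y^3 + S0 * (E x * (l * cnj (u3' x)) * y^3))" for x
    define \<rho> where "\<rho> = Kr / (cmod k)^3"
    have "cmod (eu L) \<le> 2 * exp ((2 * Q + 1) * L / 2) * \<rho> * exp (2 * \<kappa> * L)"
    proof (rule scattering_energy_estimate[OF L lam \<kappa> Q(1), where q = q and ev = ev and ?r1.0 = r1 and ?r2.0 = r2])
      fix x assume x: "x \<in> {0..L}"
      note d = wkb_residual[where q = q and ?u1.0 = u1 and ?u2.0 = u2 and ?u3.0 = u3 and ?v1.0 = v1 and ?v2.0 = v2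
          and lam = lam and x = x and S = "{0..L}", OF k0 du1[OF x] du2[OF x] du3[OF x] dv1[OF x, unfolded l_def] dv2[OF x, unfolded l_def] rel,
          folded l_def E_def, folded U_def V_def U2_def V2_def]
      show "cmod (q x) \<le> Q" using Q x by blast
      have "(eu has_vector_derivative (- 2 * \<i> * k * u k x + q x * v k x)
          - P * ((- 2 * \<i> * k * U x + q x * V x + u3' x / k^3)
          - S0 * (- 2 * \<i> * k * U2 x + q x * V2 x - E x * (l * q x * cnj (u3 x)) / k^3))) (at x within {0..L})"
        unfolding eu_def[abs_def] by (intro has_vector_derivative_diff has_vector_derivative_mult_right du[OF x] d)
      also have "(- 2 * \<i> * k * u k x + q x * v k x)
          - P * ((- 2 * \<i> * k * U x + q x * V x + u3' x / k^3)
          - S0 * (- 2 * \<i> * k * U2 x + q x * V2 x - E x * (l * q x * cnj (u3 x)) / k^3)) =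
          - 2 * \<i> * k * eu x + q x * ev x + r1 x"
        unfolding eu_def ev_def r1_def y_def by (simp add: algebra_simps power_divide)
      finally show "(eu has_vector_derivative - 2 * \<i> * k * eu x + q x * ev x + r1 x) (at x within {0..L})" .
      have "(ev has_vector_derivative (of_real lam * cnj (q x) * u k x)
          - P * ((l * cnj (q x) * U x - l * cnj (q x) * u3 x / k^3)
          - S0 * (l * cnj (q x) * U2 x + E x * (l * cnj (u3' x)) / k^3))) (at x within {0..L})"
        unfolding ev_def[abs_def] by (intro has_vector_derivative_diff has_vector_derivative_mult_right dv[OF x] d)
      also have "(of_real lam * cnj (q x) * u k x)
          - P * ((l * cnj (q x) * U x - l * cnj (q x) * u3 x / k^3)
          - S0 * (l * cnj (q x) * U2 x + E x * (l * cnj (u3' x)) / k^3)) = of_real lam * cnj (q x) * eu x + r2 x"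
        unfolding eu_def ev_def r2_def y_def l_def by (simp add: algebra_simps power_divide)
      finally show "(ev has_vector_derivative of_real lam * cnj (q x) * eu x + r2 x) (at x within {0..L})" .
      have e1: "1 \<le> exp (2 * \<kappa> * x)" using \<kappa> x by simp
      have "Im k * x \<le> \<kappa> * x" using \<kappa> x by (intro mult_right_mono) auto
      then have nE: "cmod (E x) \<le> exp (2 * \<kappa> * x)" unfolding E_def norm_exp_eq_Re by simp
      have nl: "cmod l = 1" using lam by (simp add: l_def)
      have nq: "cmod (q x) \<le> Q" and n3: "cmod (u3 x) \<le> M3" and n3': "cmod (u3' x) \<le> M3'" using Q M3 M3' x by auto
      have bnd: "cmod P * (A * cmod (y^3) + cmod S0 * (cmod (E x) * B * cmod (y^3))) \<le> \<rho> * exp (2 * \<kappa> * x)"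
        if A: "0 \<le> A" "0 \<le> B" "A \<le> M3' + Q * M3" "B \<le> Q * M3 + M3'" for A B
      proof -
        have "cmod P * (A * cmod (y^3) + cmod S0 * (cmod (E x) * B * cmod (y^3)))
            \<le> BP * (((M3' + Q * M3) * exp (2 * \<kappa> * x)) * cmod (y^3) + BS * (exp (2 * \<kappa> * x) * (Q * M3 + M3') * cmod (y^3)))"
          using A nP nS0 nE e1 mult_mono[OF A(3) e1] BP BS Q M3 M3'
          by (intro mult_mono add_mono add_nonneg_nonneg mult_nonneg_nonneg mult_right_mono) auto
        also have "\<dots> = (BP * (M3' + Q * M3 + BS * (Q * M3 + M3'))) * (exp (2 * \<kappa> * x) * cmod (y^3))"
          by (simp add: algebra_simps)
        also have "\<dots> \<le> Kr * (exp (2 * \<kappa> * x) * cmod (y^3))"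
          unfolding Kr_def using B0 by (intro mult_right_mono) auto
        finally show ?thesis by (simp add: \<rho>_def y3 mult_ac)
      qed
      have "cmod (r1 x) \<le> cmod P * (cmod (u3' x) * cmod (y^3) + cmod S0 * (cmod (E x) * (cmod (q x) * cmod (u3 x)) * cmod (y^3)))"
        unfolding r1_def norm_minus_cancel norm_mult[of P]
        by (intro mult_left_mono order_trans[OF norm_triangle_ineq]) (simp_all add: norm_mult nl)
      also have "\<dots> \<le> \<rho> * exp (2 * \<kappa> * x)"
      proof (rule bnd)
        show "cmod (u3' x) \<le> M3' + Q * M3" using n3' Q M3 by (simp add: add_increasing2)
        show "cmod (q x) * cmod (u3 x) \<le> Q * M3 + M3'" using mult_mono[OF nq n3] Q M3' by simp
      qed auto
      finally show "cmod (r1 x) \<le> \<rho> * exp (2 * \<kappa> * x)" .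
      have "cmod (r2 x) \<le> cmod P * ((cmod (q x) * cmod (u3 x)) * cmod (y^3) + cmod S0 * (cmod (E x) * cmod (u3' x) * cmod (y^3)))"
        unfolding r2_def norm_mult[of P]
        by (intro mult_left_mono order_trans[OF norm_triangle_ineq]) (simp_all add: norm_mult nl)
      also have "\<dots> \<le> \<rho> * exp (2 * \<kappa> * x)"
      proof (rule bnd)
        show "cmod (u3' x) \<le> Q * M3 + M3'" using n3' Q M3 by (simp add: add_increasing)
        show "cmod (q x) * cmod (u3 x) \<le> M3' + Q * M3" using mult_mono[OF nq n3] Q M3' by simp
      qed auto
      finally show "cmod (r2 x) \<le> \<rho> * exp (2 * \<kappa> * x)" .
    next
      have U20: "U2 0 = 1" by (simp add: U2_def E_def v0)
      show "cmod (eu 0) \<le> \<rho>" unfolding eu_def init U20 using Kr by (simp add: S0_def \<rho>_def)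
      have V0: "V 0 = 1" by (simp add: V_def v0)
      have "ev 0 = y^3 * (l * (a1 * (b2 + b3 * y) + (a2 + a3 * y) * (b1 + b2 * y + b3 * y^2))
      + p * l * y * (a1 + a2 * y + a3 * y^2) * (b1 + b2 * y + b3 * y^2))"
        unfolding ev_def init V0 S0 V20 P_def p_def by algebra
      also have "cmod \<dots> \<le> 1 / (cmod k)^3 * B0" unfolding norm_mult[of "y^3"] y3 using B0 y by (intro mult_left_mono) auto
      also have "\<dots> \<le> 1 / (cmod k)^3 * Kr" unfolding Kr_def using BP BS Q M3 M3' by (intro mult_left_mono) auto
      finally show "cmod (ev 0) \<le> \<rho>" by (simp add: \<rho>_def)
    qed
    then have neu: "cmod (eu L) \<le> Ce * \<rho> * exp (2 * \<kappa> * L)" by (simp add: Ce_def)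
    have nG: "cmod G = exp (- 2 * Im k * L)" unfolding G_def norm_exp_eq_Re by simp
    define mx where "mx = max 1 (exp (- 2 * Im k * L))"
    have mx: "1 \<le> mx" "cmod G \<le> mx" by (auto simp: mx_def nG)
    \<comment> \<open>The energy estimate allows growth e^{2\<kappa>L}; the factor |e^{2ikL}| turns
      this into exactly the weight of the claim, in both half-planes.\<close>
    have Gex: "cmod G * exp (2 * \<kappa> * L) = mx"
    proof (cases "0 \<le> Im k")
      case True
      then have "mx = 1" using L by (simp add: mx_def)
      then show ?thesis using True unfolding nG \<kappa>_def by (simp flip: exp_add)
    next
      case False
      then have "mx = exp (- 2 * Im k * L)" using L by (simp add: mx_def mult_nonpos_nonneg max_def)
      then show ?thesis using False unfolding nG \<kappa>_def by simp
    qed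
    have nGeu: "cmod (G * eu L) \<le> Ce * Kr * mx * cmod (y^3)"
    proof -
      have "cmod (G * eu L) \<le> cmod G * (Ce * \<rho> * exp (2 * \<kappa> * L))" unfolding norm_mult using neu by (intro mult_left_mono) auto
      also have "\<dots> = Ce * \<rho> * (cmod G * exp (2 * \<kappa> * L))" by (simp add: mult_ac)
      finally show ?thesis unfolding Gex by (simp add: \<rho>_def y3 mult_ac)
    qed
    have mL: "m = 2 * \<i> * v1 L"
    proof -
      have "v1 L = integral {0..L} (\<lambda>y. l / (2 * \<i>) * (q y * cnj (q y)))"
        unfolding v1_def u1_def by (rule integral_cong) simp
      also have "\<dots> = l / (2 * \<i>) * integral {0..L} (\<lambda>y. q y * cnj (q y))" by (rule integral_mult_right)
      finally show ?thesis by (simp add: m_def l_def)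
    qed
    \<comment> \<open>\<open>m\<close> is real, hence m = 2i v1(L) = -2i c1. The value at 0 involves
      \<open>c1\<close> and the one at \<open>L\<close> involves v1(L), so \<open>m\<close> enters
      the two second-order coefficients with opposite signs.\<close>
    have "cnj (integral {0..L} (\<lambda>x. q x * cnj (q x))) = integral {0..L} (\<lambda>x. cnj (q x * cnj (q x)))"
      by (rule integral_cnj)
    also have "\<dots> = integral {0..L} (\<lambda>x. q x * cnj (q x))" by (simp add: mult.commute)
    finally have "cnj m = m" unfolding m_def by simp
    then have c1: "m = - 2 * \<i> * c1" unfolding c1_def using mL by simp
    have A: "(q1 0 + q 0 * m) / 4 = a2 + a1 * c1"
      unfolding c1 a2_def a1_def u2_def u1_def u1'_def v0 by simp
    have Bq: "(q1 L - q L * m) / 4 = l2"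
      unfolding mL l2_def u2_def u1'_def by (simp add: field_simps)
    have q0: "(q 0 - G * q L) / (2 * \<i> * k) = a1 * y - G * (l1 * y)"
      unfolding a1_def l1_def u1_def y_def by (simp only: diff_divide_distrib times_divide_eq_right divide_divide_eq_left mult_1_right)
    have UL: "P * U L - l1 * y - l2 * y^2 = y^3 * (l3 + p * (l1 + l2 * y + l3 * y^2))"
    proof -
      have "U L = l1 * y + l2 * y^2 + l3 * y^3" by (simp add: U_def l1_def l2_def l3_def y_def power_divide)
      then show ?thesis unfolding P_def by algebra
    qed
    have W: "P * S0 * (G * U2 L) - a1 * y - (a2 + a1 * c1) * y^2 =
        y^3 * (a3 + a2 * c1 + a1 * c2 + y * (a3 * c1 + a2 * c2) + y^2 * a3 * c2
      + p * (a1 + a2 * y + a3 * y^2) * (1 + c1 * y + c2 * y^2))"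
    proof -
      have "G * U2 L = 1 + c1 * y + c2 * y^2"
        unfolding U2_def mult.assoc[symmetric] GE by (simp add: c1_def c2_def y_def power_divide)
      then show ?thesis unfolding P_def S0 by algebra
    qed
    have "- G * u k L - ((q 0 - G * q L) / (2 * \<i> * k) + (((q1 0 + q 0 * m) / 4) - G * ((q1 L - q L * m) / 4)) / k^2)
        = - (G * eu L) - G * (P * U L - l1 * y - l2 * y^2) + (P * S0 * (G * U2 L) - a1 * y - (a2 + a1 * c1) * y^2)"
      unfolding A Bq q0 eu_def y_def by (simp add: algebra_simps power_divide diff_divide_distrib add_divide_distrib)
    also have "cmod \<dots> \<le> cmod (G * eu L) + cmod (G * (P * U L - l1 * y - l2 * y^2)) + cmod (P * S0 * (G * U2 L) - a1 * y - (a2 + a1 * c1) * y^2)"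
      using norm_triangle_ineq[of "- (G * eu L) - G * (P * U L - l1 * y - l2 * y^2)" "P * S0 * (G * U2 L) - a1 * y - (a2 + a1 * c1) * y^2"]
        norm_triangle_ineq4[of "- (G * eu L)" "G * (P * U L - l1 * y - l2 * y^2)"] unfolding norm_minus_cancel by linarith
    also have "\<dots> \<le> Ce * Kr * mx * cmod (y^3) + mx * (cmod (y^3) * BL) + 1 * (cmod (y^3) * B1)"
      unfolding UL W norm_mult[of G "_ * _"] norm_mult[of "y^3"] mult_1
      using nGeu BL B1 y mx by (intro add_mono mult_mono mult_nonneg_nonneg mult_left_mono) auto
    also have "\<dots> \<le> Ce * Kr * mx * cmod (y^3) + mx * (cmod (y^3) * BL) + mx * (cmod (y^3) * B1)"
      using mult_right_mono[OF mx(1), of "cmod (y^3) * B1"] B1 by simp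
    also have "\<dots> = (Ce * Kr + BL + B1) * mx / (cmod k)^3" unfolding y3 by (simp add: add_divide_distrib algebra_simps)
    finally show ?thesis unfolding G_def mx_def .
  qed
  moreover have "0 \<le> Ce * Kr + BL + B1" using Kr BL B1 by (simp add: Ce_def)
  ultimately show ?thesis by blast
qed

section \<open>The global relation\<close>

text \<open>The exponential splits into a function of t and one of t', so the first Volterra
  equation can be differentiated by the product rule. Compact intervals below T make the boundary
  values bounded.\<close>

lemma eigenfunctions_ode:
  assumes ef: "eigenfunctions T lam g0 g1 Phi1 Phi2" and \<tau>: "0 \<le> \<tau>" "\<tau> < T"
    and g: "continuous_on {0..\<tau>} g0" "continuous_on {0..\<tau>} g1"
  shows "continuous_on {0..\<tau>} (\<lambda>t. Phi1 t k)" "continuous_on {0..\<tau>} (\<lambda>t. Phi2 t k)"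
    "Phi1 0 k = 0" "Phi2 0 k = 1"
    "\<And>t. t \<in> {0..\<tau>} \<Longrightarrow> ((\<lambda>t. Phi1 t k) has_vector_derivative
      - (4 * \<i> * k\<^sup>2 + \<i> * of_real lam * (g0 t * cnj (g0 t))) * Phi1 t k + (2 * k * g0 t + \<i> * g1 t) * Phi2 t k) (at t within {0..\<tau>})"
    "\<And>t. t \<in> {0..\<tau>} \<Longrightarrow> ((\<lambda>t. Phi2 t k) has_vector_derivative
      of_real lam * (2 * k * cnj (g0 t) - \<i> * cnj (g1 t)) * Phi1 t k + \<i> * of_real lam * (g0 t * cnj (g0 t)) * Phi2 t k) (at t within {0..\<tau>})"
proof -
  have sub: "{0..\<tau>} \<subseteq> {0..<T}" using \<tau> by auto
  show c1: "continuous_on {0..\<tau>} (\<lambda>t. Phi1 t k)" and c2: "continuous_on {0..\<tau>} (\<lambda>t. Phi2 t k)"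
    using ef sub unfolding eigenfunctions_def by (auto intro: continuous_on_subset)
  define h1 where "h1 s = - \<i> * of_real lam * (g0 s * cnj (g0 s)) * Phi1 s k + (2 * k * g0 s + \<i> * g1 s) * Phi2 s k" for s
  define h2 where "h2 s = (2 * k * cnj (g0 s) - \<i> * cnj (g1 s)) * Phi1 s k + \<i> * (g0 s * cnj (g0 s)) * Phi2 s k" for s
  have ch: "continuous_on {0..\<tau>} h1" "continuous_on {0..\<tau>} h2"
    unfolding h1_def[abs_def] h2_def[abs_def] by (intro continuous_intros c1 c2 g)+
  define E where "E s = exp (4 * \<i> * k\<^sup>2 * of_real s)" for s :: real
  have cE: "continuous_on X E" for X unfolding E_def[abs_def] by (intro continuous_intros)
  have dEm: "((\<lambda>s. E (- s)) has_vector_derivative - (4 * \<i> * k\<^sup>2) * E (- t)) (at t within {0..\<tau>})" for t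
  proof -
    have "((\<lambda>z. exp (4 * \<i> * k\<^sup>2 * (- z))) has_field_derivative - (4 * \<i> * k\<^sup>2) * E (- t)) (at (of_real t))"
      by (auto intro!: derivative_eq_intros simp: E_def)
    from has_vector_derivative_real_field[OF this] show ?thesis by (simp add: E_def)
  qed
  have P1: "Phi1 t k = E (- t) * integral {0..t} (\<lambda>s. E s * h1 s)" if t: "t \<in> {0..\<tau>}" for t
  proof -
    have "Phi1 t k = integral {0..t} (\<lambda>t'. exp (4 * \<i> * k\<^sup>2 * of_real (t' - t)) *
        (- \<i> * of_real lam * of_real ((cmod (g0 t'))\<^sup>2) * Phi1 t' k + (2 * k * g0 t' + \<i> * g1 t') * Phi2 t' k))"
      using ef t sub unfolding eigenfunctions_def by (auto simp only: subset_iff)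
    also have "\<dots> = integral {0..t} (\<lambda>s. E (- t) * (E s * h1 s))"
      unfolding complex_norm_square h1_def[symmetric]
      by (rule integral_cong) (simp add: E_def algebra_simps exp_diff exp_minus divide_inverse)
    also have "\<dots> = E (- t) * integral {0..t} (\<lambda>s. E s * h1 s)" by (rule integral_mult_right)
    finally show ?thesis .
  qed
  have P2: "Phi2 t k = 1 + of_real lam * integral {0..t} h2" if t: "t \<in> {0..\<tau>}" for t
  proof -
    have "Phi2 t k = 1 + of_real lam * integral {0..t} (\<lambda>t'.
        (2 * k * cnj (g0 t') - \<i> * cnj (g1 t')) * Phi1 t' k + \<i> * of_real ((cmod (g0 t'))\<^sup>2) * Phi2 t' k)"
      using ef t sub unfolding eigenfunctions_def by (auto simp only: subset_iff)
    then show ?thesis unfolding complex_norm_square h2_def[symmetric] .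
  qed
  show "Phi1 0 k = 0" using P1[of 0] \<tau> by simp
  show "Phi2 0 k = 1" using P2[of 0] \<tau> by simp
  fix t assume t: "t \<in> {0..\<tau>}"
  have "((\<lambda>t. integral {0..t} (\<lambda>s. E s * h1 s)) has_vector_derivative E t * h1 t) (at t within {0..\<tau>})"
    by (rule integral_has_vector_derivative[OF _ t]) (intro continuous_intros ch cE)
  from has_vector_derivative_mult[OF dEm this]
  have "((\<lambda>t. E (- t) * integral {0..t} (\<lambda>s. E s * h1 s)) has_vector_derivative
      E (- t) * (E t * h1 t) + - (4 * \<i> * k\<^sup>2) * E (- t) * integral {0..t} (\<lambda>s. E s * h1 s)) (at t within {0..\<tau>})" .
  then have "((\<lambda>t. Phi1 t k) has_vector_derivative
      E (- t) * (E t * h1 t) + - (4 * \<i> * k\<^sup>2) * E (- t) * integral {0..t} (\<lambda>s. E s * h1 s)) (at t within {0..\<tau>})"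
    by (rule has_vector_derivative_transform[OF t P1, rotated])
  also have "E (- t) * (E t * h1 t) + - (4 * \<i> * k\<^sup>2) * E (- t) * integral {0..t} (\<lambda>s. E s * h1 s) =
      (E (- t) * E t) * h1 t - 4 * \<i> * k\<^sup>2 * Phi1 t k" unfolding P1[OF t] by (simp add: algebra_simps)
  also have "E (- t) * E t = 1" unfolding E_def by (simp flip: exp_add)
  also have "1 * h1 t - 4 * \<i> * k\<^sup>2 * Phi1 t k = - (4 * \<i> * k\<^sup>2 + \<i> * of_real lam * (g0 t * cnj (g0 t))) * Phi1 t k + (2 * k * g0 t + \<i> * g1 t) * Phi2 t k"
    unfolding h1_def by (simp add: algebra_simps)
  finally show "((\<lambda>t. Phi1 t k) has_vector_derivative
      - (4 * \<i> * k\<^sup>2 + \<i> * of_real lam * (g0 t * cnj (g0 t))) * Phi1 t k + (2 * k * g0 t + \<i> * g1 t) * Phi2 t k) (at t within {0..\<tau>})" .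
  have "((\<lambda>t. 1 + of_real lam * integral {0..t} h2) has_vector_derivative 0 + of_real lam * h2 t) (at t within {0..\<tau>})"
    by (intro has_vector_derivative_add has_vector_derivative_const has_vector_derivative_mult_right
        integral_has_vector_derivative ch t)
  then have "((\<lambda>t. Phi2 t k) has_vector_derivative 0 + of_real lam * h2 t) (at t within {0..\<tau>})"
    by (rule has_vector_derivative_transform[OF t P2, rotated])
  also have "0 + of_real lam * h2 t = of_real lam * (2 * k * cnj (g0 t) - \<i> * cnj (g1 t)) * Phi1 t k + \<i> * of_real lam * (g0 t * cnj (g0 t)) * Phi2 t k"
    unfolding h2_def by (simp add: algebra_simps)
  finally show "((\<lambda>t. Phi2 t k) has_vector_derivative
      of_real lam * (2 * k * cnj (g0 t) - \<i> * cnj (g1 t)) * Phi1 t k + \<i> * of_real lam * (g0 t * cnj (g0 t)) * Phi2 t k) (at t within {0..\<tau>})" .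
qed

lemma has_vector_derivative_zero_Icc:
  fixes f :: "real \<Rightarrow> 'a::banach"
  assumes "\<And>x. x \<in> {a..b} \<Longrightarrow> (f has_vector_derivative 0) (at x within {a..b})" "y \<in> {a..b}"
  shows "f y = f a"
proof -
  have "((\<lambda>_. 0) has_integral (f y - f a)) {a..y}"
  proof (rule fundamental_theorem_of_calculus)
    show "(f has_vector_derivative 0) (at x within {a..y})" if "x \<in> {a..y}" for x
      by (rule has_vector_derivative_within_subset[OF assms(1)]) (use that assms(2) in auto)
  qed (use assms(2) in auto)
  moreover have "((\<lambda>_. 0) has_integral (0 :: 'a)) {a..y}" by (rule has_integral_0)
  ultimately have "f y - f a = 0" by (rule has_integral_unique)
  then show ?thesis by simp
qed

lemma eigenfunctions_determinant:
  assumes ef: "eigenfunctions T lam g0 g1 Phi1 Phi2" and \<tau>: "0 \<le> \<tau>" "\<tau> < T"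
    and g: "continuous_on {0..\<tau>} g0" "continuous_on {0..\<tau>} g1"
  shows "Phi2 \<tau> k * cnj (Phi2 \<tau> (cnj k)) - of_real lam * (Phi1 \<tau> k * cnj (Phi1 \<tau> (cnj k))) = 1"
proof -
  note o = eigenfunctions_ode[OF assms]
  define D where "D t = Phi2 t k * cnj (Phi2 t (cnj k)) - of_real lam * (Phi1 t k * cnj (Phi1 t (cnj k)))" for t
  have "(D has_vector_derivative 0) (at t within {0..\<tau>})" if t: "t \<in> {0..\<tau>}" for t
  proof -
    note d1 = o(5)[OF t] and d2 = o(6)[OF t]
    from has_vector_derivative_diff[OF has_vector_derivative_mult[OF d2[of k] has_vector_derivative_cnj[OF d2[of "cnj k"]]]
        has_vector_derivative_mult_right[OF has_vector_derivative_mult[OF d1[of k] has_vector_derivative_cnj[OF d1[of "cnj k"]]], of "of_real lam"]]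
    show ?thesis unfolding D_def[abs_def] by (rule has_vector_derivative_eq_rhs) (simp add: algebra_simps)
  qed
  then have "D \<tau> = D 0" by (rule has_vector_derivative_zero_Icc) (use \<tau> in auto)
  also have "\<dots> = 1" by (simp add: D_def o)
  finally show ?thesis by (simp add: D_def)
qed

text \<open>The spatial half of the Lax pair, started at x = 0 from data depending on t. Joint
  continuity of the solution is the regularity on which the transport argument rests.\<close>

lemma linear_system_parametric:
  fixes q :: "real \<Rightarrow> real \<Rightarrow> complex"
  assumes L: "0 \<le> L" and \<tau>: "0 \<le> \<tau>" and lam: "\<bar>lam\<bar> = 1"
    and q: "continuous_on ({0..L} \<times> {0..\<tau>}) (\<lambda>(x, t). q x t)"
    and f: "continuous_on {0..\<tau>} f1" "continuous_on {0..\<tau>} f2"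
  shows "\<exists>a b. continuous_on ({0..L} \<times> {0..\<tau>}) (\<lambda>(x, t). a x t) \<and> continuous_on ({0..L} \<times> {0..\<tau>}) (\<lambda>(x, t). b x t) \<and>
    (\<forall>t\<in>{0..\<tau>}. a 0 t = f1 t \<and> b 0 t = f2 t) \<and>
    (\<forall>x\<in>{0..L}. \<forall>t\<in>{0..\<tau>}. ((\<lambda>x. a x t) has_vector_derivative (- 2 * \<i> * k * a x t + q x t * b x t)) (at x within {0..L}) \<and>
      ((\<lambda>x. b x t) has_vector_derivative (of_real lam * cnj (q x t) * a x t)) (at x within {0..L}))"
proof -
  obtain Q where Q: "0 \<le> Q" "\<forall>x\<in>{0..L}. \<forall>t\<in>{0..\<tau>}. cmod (q x t) \<le> Q"
    using continuous_on_rectangle_norm_bound[OF q] by (elim exE conjE)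
  define A where "A x t v = (- 2 * \<i> * k * fst v + q x t * snd v, of_real lam * cnj (q x t) * fst v)" for x t and v :: "complex \<times> complex"
  define K where "K = 2 * cmod k + 2 * Q + 1"
  obtain w where w: "continuous_on ({0..L} \<times> {0..\<tau>}) (\<lambda>(x, t). w x t)"
    "\<And>x t. x \<in> {0..L} \<Longrightarrow> t \<in> {0..\<tau>} \<Longrightarrow> w x t = (f1 t, f2 t) + integral {0..x} (\<lambda>y. A y t (w y t))"
  proof (rule volterra_parametric[OF L \<tau>, of K A "\<lambda>t. (f1 t, f2 t)"])
    show "0 < K" using Q by (simp add: K_def add_nonneg_pos)
    show "continuous_on {0..\<tau>} (\<lambda>t. (f1 t, f2 t))" by (intro continuous_intros f)
    show "continuous_on ({0..L} \<times> {0..\<tau>}) (\<lambda>(x, t). A x t (w x t))"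
      if "continuous_on ({0..L} \<times> {0..\<tau>}) (\<lambda>(x, t). w x t)" for w
      using that q unfolding A_def split_beta by (auto intro!: continuous_intros)
    fix x t :: real and v v' :: "complex \<times> complex" assume xt: "x \<in> {0..L}" "t \<in> {0..\<tau>}"
    define d where "d = v - v'"
    have nd: "cmod (fst d) \<le> norm d" "cmod (snd d) \<le> norm d" 
      using norm_fst_le[of "fst d" "snd d"] norm_snd_le[of "snd d" "fst d"] by simp_all
    have nq: "cmod (q x t) \<le> Q" using Q xt by blast
    have "A x t v - A x t v' = (- 2 * \<i> * k * fst d + q x t * snd d, of_real lam * cnj (q x t) * fst d)"
      by (simp add: A_def d_def algebra_simps)
    also have "norm \<dots> \<le> cmod (- 2 * \<i> * k * fst d + q x t * snd d) + cmod (of_real lam * cnj (q x t) * fst d)"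
      by (rule norm_Pair_le)
    also have "\<dots> \<le> (2 * cmod k * norm d + Q * norm d) + Q * norm d"
      using nd nq Q lam by (intro add_mono norm_triangle_le mult_mono) (auto simp: norm_mult intro!: mult_mono add_mono)
    also have "\<dots> \<le> K * norm d" by (simp add: K_def algebra_simps)
    finally show "norm (A x t v - A x t v') \<le> K * norm (v - v')" by (simp add: d_def)
  qed (use that in blast)
  have cA: "continuous_on {0..L} (\<lambda>y. A y t (w y t))" if "t \<in> {0..\<tau>}" for t
    using continuous_on_slice(2)[OF q that] continuous_on_slice(2)[OF w(1) that] unfolding A_def by (intro continuous_intros)
  have dw: "((\<lambda>x. w x t) has_vector_derivative A x t (w x t)) (at x within {0..L})" if xt: "x \<in> {0..L}" "t \<in> {0..\<tau>}" for x t
  proof -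
    have "((\<lambda>x. (f1 t, f2 t) + integral {0..x} (\<lambda>y. A y t (w y t))) has_vector_derivative 0 + A x t (w x t)) (at x within {0..L})"
      by (intro has_vector_derivative_add has_vector_derivative_const integral_has_vector_derivative cA xt)
    then show ?thesis
      using has_vector_derivative_transform[OF xt(1), of "\<lambda>x. w x t"] w(2) xt(2) by simp
  qed
  show ?thesis
  proof (rule exI[of _ "\<lambda>x t. fst (w x t)"], rule exI[of _ "\<lambda>x t. snd (w x t)"], intro conjI ballI)
    show "continuous_on ({0..L} \<times> {0..\<tau>}) (\<lambda>(x, t). fst (w x t))" "continuous_on ({0..L} \<times> {0..\<tau>}) (\<lambda>(x, t). snd (w x t))"
      using w(1) unfolding split_beta by (auto intro!: continuous_intros)
    fix t assume "t \<in> {0..\<tau>}"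
    then show "fst (w 0 t) = f1 t" "snd (w 0 t) = f2 t" using w(2)[of 0 t] L by auto
  next
    fix x t assume xt: "x \<in> {0..L}" "t \<in> {0..\<tau>}"
    show "((\<lambda>x. fst (w x t)) has_vector_derivative (- 2 * \<i> * k * fst (w x t) + q x t * snd (w x t))) (at x within {0..L})"
      using bounded_linear.has_vector_derivative[OF bounded_linear_fst dw[OF xt]] by (simp add: A_def)
    show "((\<lambda>x. snd (w x t)) has_vector_derivative (of_real lam * cnj (q x t) * fst (w x t))) (at x within {0..L})"
      using bounded_linear.has_vector_derivative[OF bounded_linear_snd dw[OF xt]] by (simp add: A_def)
  qed
qed

text \<open>Vanishing initial data enter here: the solution carried from \<open>x = 0\<close> starts at \<open>(0, 1)\<close> at \<open>x = L\<close>,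
  so it coincides with \<open>(phi1, phi2)\<close> there.\<close>

lemma eigenfunctions_x_evolution:
  fixes q qx qxx qt :: "real \<Rightarrow> real \<Rightarrow> complex" and lam L \<tau> T :: real
  assumes lam: "\<bar>lam\<bar> = 1" and L: "0 < L" and \<tau>: "0 \<le> \<tau>" "\<tau> < T"
    and cont: "continuous_on ({0..L} \<times> {0..\<tau>}) (\<lambda>(x, t). q x t)" "continuous_on ({0..L} \<times> {0..\<tau>}) (\<lambda>(x, t). qx x t)"
      "continuous_on ({0..L} \<times> {0..\<tau>}) (\<lambda>(x, t). qt x t)"
    and dq: "\<And>x t. x \<in> {0..L} \<Longrightarrow> t \<in> {0..\<tau>} \<Longrightarrow> ((\<lambda>x. q x t) has_vector_derivative qx x t) (at x within {0..L})"
      "\<And>x t. x \<in> {0..L} \<Longrightarrow> t \<in> {0..\<tau>} \<Longrightarrow> ((\<lambda>x. qx x t) has_vector_derivative qxx x t) (at x within {0..L})"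
      "\<And>x t. x \<in> {0..L} \<Longrightarrow> t \<in> {0..\<tau>} \<Longrightarrow> ((\<lambda>t. q x t) has_vector_derivative qt x t) (at t within {0..\<tau>})"
    and nls: "\<And>x t. x \<in> {0..L} \<Longrightarrow> t \<in> {0..\<tau>} \<Longrightarrow>
      qt x t = \<i> * qxx x t - 2 * \<i> * of_real lam * (q x t * cnj (q x t)) * q x t"
    and q0: "\<And>x. x \<in> {0..L} \<Longrightarrow> q x 0 = 0"
    and bv: "\<And>t. t \<in> {0..\<tau>} \<Longrightarrow> g0 t = q 0 t \<and> g1 t = qx 0 t \<and> h0 t = q L t \<and> h1 t = qx L t"
    and ef: "eigenfunctions T lam g0 g1 Phi1 Phi2" "eigenfunctions T lam h0 h1 phi1 phi2"
  shows "\<exists>a b. a 0 = Phi1 \<tau> k \<and> b 0 = Phi2 \<tau> k \<and> a L = phi1 \<tau> k \<and> b L = phi2 \<tau> k \<and>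
    (\<forall>x\<in>{0..L}. (a has_vector_derivative (- 2 * \<i> * k * a x + q x \<tau> * b x)) (at x within {0..L}) \<and>
      (b has_vector_derivative (of_real lam * cnj (q x \<tau>) * a x)) (at x within {0..L}))"
proof -
  have "0 \<in> {0..L}" "L \<in> {0..L}" using L by auto
  note slice = this[THEN continuous_on_slice(1)[OF cont(1)]] this[THEN continuous_on_slice(1)[OF cont(2)]]
  have cg: "continuous_on {0..\<tau>} g0" "continuous_on {0..\<tau>} g1" "continuous_on {0..\<tau>} h0" "continuous_on {0..\<tau>} h1"
    using bv continuous_on_eq[OF slice(1), of g0] continuous_on_eq[OF slice(2), of h0]
      continuous_on_eq[OF slice(3), of g1] continuous_on_eq[OF slice(4), of h1] by simp_all
  note o = eigenfunctions_ode[OF ef(1) \<tau> cg(1,2)] and o' = eigenfunctions_ode[OF ef(2) \<tau> cg(3,4)]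
  obtain a b where ab: "continuous_on ({0..L} \<times> {0..\<tau>}) (\<lambda>(x, t). a x t)" "continuous_on ({0..L} \<times> {0..\<tau>}) (\<lambda>(x, t). b x t)"
    "\<forall>t\<in>{0..\<tau>}. a 0 t = Phi1 t k \<and> b 0 t = Phi2 t k"
    "\<forall>x\<in>{0..L}. \<forall>t\<in>{0..\<tau>}. ((\<lambda>x. a x t) has_vector_derivative (- 2 * \<i> * k * a x t + q x t * b x t)) (at x within {0..L}) \<and>
      ((\<lambda>x. b x t) has_vector_derivative (of_real lam * cnj (q x t) * a x t)) (at x within {0..L})"
    using linear_system_parametric[where k = k, OF less_imp_le[OF L] \<tau>(1) lam cont(1) o(1)[of k] o(2)[of k]] by (elim exE conjE)
  define A where "A x t = - (4 * \<i> * k\<^sup>2 + \<i> * of_real lam * (q x t * cnj (q x t))) * a x t + (2 * k * q x t + \<i> * qx x t) * b x t" for x t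
  define B where "B x t = of_real lam * (2 * k * cnj (q x t) - \<i> * cnj (qx x t)) * a x t + \<i> * of_real lam * (q x t * cnj (q x t)) * b x t" for x t
  have cAB: "continuous_on ({0..L} \<times> {0..\<tau>}) (\<lambda>(x, t). A x t)" "continuous_on ({0..L} \<times> {0..\<tau>}) (\<lambda>(x, t). B x t)"
    using cont ab unfolding A_def B_def split_beta by (auto intro!: continuous_intros)
  have init: "a 0 t = a 0 0 + integral {0..t} (A 0)" "b 0 t = b 0 0 + integral {0..t} (B 0)" if t: "t \<in> {0..\<tau>}" for t
  proof -
    have sub: "{0..t} \<subseteq> {0..\<tau>}" using t by auto
    have "(A 0 has_integral (Phi1 t k - Phi1 0 k)) {0..t}"
    proof (rule fundamental_theorem_of_calculus)
      fix s assume "s \<in> {0..t}"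
      then have s: "s \<in> {0..\<tau>}" using sub by auto
      have "A 0 s = - (4 * \<i> * k\<^sup>2 + \<i> * of_real lam * (g0 s * cnj (g0 s))) * Phi1 s k + (2 * k * g0 s + \<i> * g1 s) * Phi2 s k"
        using ab(3) bv[OF s] s by (simp add: A_def)
      then show "((\<lambda>t. Phi1 t k) has_vector_derivative A 0 s) (at s within {0..t})"
        using has_vector_derivative_within_subset[OF o(5)[OF s] sub] by simp
    qed (use t in auto)
    then show "a 0 t = a 0 0 + integral {0..t} (A 0)" using ab(3) t \<tau> by (simp add: integral_unique)
    have "(B 0 has_integral (Phi2 t k - Phi2 0 k)) {0..t}"
    proof (rule fundamental_theorem_of_calculus)
      fix s assume "s \<in> {0..t}"
      then have s: "s \<in> {0..\<tau>}" using sub by auto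
      have "B 0 s = of_real lam * (2 * k * cnj (g0 s) - \<i> * cnj (g1 s)) * Phi1 s k + \<i> * of_real lam * (g0 s * cnj (g0 s)) * Phi2 s k"
        using ab(3) bv[OF s] s by (simp add: B_def)
      then show "((\<lambda>t. Phi2 t k) has_vector_derivative B 0 s) (at s within {0..t})"
        using has_vector_derivative_within_subset[OF o(6)[OF s] sub] by simp
    qed (use t in auto)
    then show "b 0 t = b 0 0 + integral {0..t} (B 0)" using ab(3) t \<tau> by (simp add: integral_unique)
  qed
  have LL: "L \<in> {0..L}" and z\<tau>: "0 \<in> {0..\<tau>}" using L \<tau> by auto
  have transport: "a L t = a L 0 + integral {0..t} (A L)" "b L t = b L 0 + integral {0..t} (B L)" if t: "t \<in> {0..\<tau>}" for t
    unfolding A_def[abs_def] B_def[abs_def]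
    by (rule zero_curvature_transport[OF lam cont ab(1,2) dq nls _ _ _ _ LL t, of k];
        use ab(4) init[unfolded A_def[abs_def] B_def[abs_def]] in blast)+
  \<comment> \<open>At time 0 the potential vanishes: b is constant in x, and a solves a' = -2ika
    with initial value 0.\<close>
  have bL0: "b L 0 = 1"
  proof -
    have "((\<lambda>x. b x 0) has_vector_derivative 0) (at x within {0..L})" if "x \<in> {0..L}" for x
      using ab(4) that z\<tau> q0[OF that] by force
    then have "b L 0 = b 0 0" by (rule has_vector_derivative_zero_Icc) (use L in auto)
    then show ?thesis using ab(3) z\<tau> o(4) by auto
  qed
  have aL0: "a L 0 = 0"
  proof -
    obtain C where C: "0 \<le> C" "\<forall>x\<in>{0..L}. \<forall>t\<in>{0..\<tau>}. cmod (a x t) \<le> C"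
      using continuous_on_rectangle_norm_bound[OF ab(1)] by (elim exE conjE)
    show ?thesis
    proof (rule gronwall_zero[where P = "{()}" and f = "\<lambda>_ x. a x 0" and f' = "\<lambda>_ x. - 2 * \<i> * k * a x 0" and K = "2 * cmod k" and C = C])
      show "((\<lambda>x. a x 0) has_vector_derivative - 2 * \<i> * k * a x 0) (at x within {0..L})" if "x \<in> {0..L}" for x
        using ab(4) that z\<tau> q0[OF that] by force
      show "cmod (- 2 * \<i> * k * a x 0) \<le> 2 * cmod k * S" if "\<And>p. p \<in> {()} \<Longrightarrow> cmod (a x 0) \<le> S" for x S
        using that by (auto simp: norm_mult intro!: mult_left_mono)
    qed (use C z\<tau> ab(3) o(3) LL in auto)
  qed
  obtain Ca where Ca: "0 \<le> Ca" "\<forall>x\<in>{0..L}. \<forall>t\<in>{0..\<tau>}. cmod (a x t) \<le> Ca"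
    using continuous_on_rectangle_norm_bound[OF ab(1)] by (elim exE conjE)
  obtain Cb where Cb: "0 \<le> Cb" "\<forall>x\<in>{0..L}. \<forall>t\<in>{0..\<tau>}. cmod (b x t) \<le> Cb"
    using continuous_on_rectangle_norm_bound[OF ab(2)] by (elim exE conjE)
  obtain C1 where C1: "0 \<le> C1" "\<forall>t\<in>{0..\<tau>}. cmod (phi1 t k) \<le> C1"
    using continuous_on_Icc_norm_bound[OF o'(1)[of k]] by (elim exE conjE)
  obtain C2 where C2: "0 \<le> C2" "\<forall>t\<in>{0..\<tau>}. cmod (phi2 t k) \<le> C2"
    using continuous_on_Icc_norm_bound[OF o'(2)[of k]] by (elim exE conjE)
  obtain G0 where G0: "0 \<le> G0" "\<forall>t\<in>{0..\<tau>}. cmod (h0 t) \<le> G0"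
    using continuous_on_Icc_norm_bound[OF cg(3)] by (elim exE conjE)
  obtain G1 where G1: "0 \<le> G1" "\<forall>t\<in>{0..\<tau>}. cmod (h1 t) \<le> G1"
    using continuous_on_Icc_norm_bound[OF cg(4)] by (elim exE conjE)
  define d1 where "d1 t = a L t - phi1 t k" for t
  define d2 where "d2 t = b L t - phi2 t k" for t
  define e1 where "e1 t = - (4 * \<i> * k\<^sup>2 + \<i> * of_real lam * (h0 t * cnj (h0 t))) * d1 t + (2 * k * h0 t + \<i> * h1 t) * d2 t" for t
  define e2 where "e2 t = of_real lam * (2 * k * cnj (h0 t) - \<i> * cnj (h1 t)) * d1 t + \<i> * of_real lam * (h0 t * cnj (h0 t)) * d2 t" for t
  have dd1: "(d1 has_vector_derivative e1 t) (at t within {0..\<tau>})" if t: "t \<in> {0..\<tau>}" for t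
  proof -
    have "((\<lambda>t. a L 0 + integral {0..t} (A L)) has_vector_derivative 0 + A L t) (at t within {0..\<tau>})"
      by (intro has_vector_derivative_add has_vector_derivative_const integral_has_vector_derivative
          continuous_on_slice(1)[OF cAB(1) LL] t)
    then have "((\<lambda>t. a L t) has_vector_derivative 0 + A L t) (at t within {0..\<tau>})"
      by (rule has_vector_derivative_transform[OF t transport(1), rotated])
    from has_vector_derivative_diff[OF this o'(5)[OF t, of k]]
    show ?thesis unfolding d1_def[abs_def]
      by (rule has_vector_derivative_eq_rhs) (use bv[OF t] in \<open>simp add: A_def e1_def d1_def d2_def algebra_simps\<close>)
  qed
  have dd2: "(d2 has_vector_derivative e2 t) (at t within {0..\<tau>})" if t: "t \<in> {0..\<tau>}" for t
  proof -
    have "((\<lambda>t. b L 0 + integral {0..t} (B L)) has_vector_derivative 0 + B L t) (at t within {0..\<tau>})"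
      by (intro has_vector_derivative_add has_vector_derivative_const integral_has_vector_derivative
          continuous_on_slice(1)[OF cAB(2) LL] t)
    then have "((\<lambda>t. b L t) has_vector_derivative 0 + B L t) (at t within {0..\<tau>})"
      by (rule has_vector_derivative_transform[OF t transport(2), rotated])
    from has_vector_derivative_diff[OF this o'(6)[OF t, of k]]
    show ?thesis unfolding d2_def[abs_def]
      by (rule has_vector_derivative_eq_rhs) (use bv[OF t] in \<open>simp add: B_def e2_def d1_def d2_def algebra_simps\<close>)
  qed
  \<comment> \<open>A common bound for the row sums of the coefficient matrix of the t-system at x =
    L, in terms of the bounds \<open>G0\<close> and \<open>G1\<close> of the boundary
    values.\<close>
  define K where "K = 4 * (cmod k)\<^sup>2 + G0 * G0 + (2 * cmod k * G0 + G1)"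
  have K0: "0 \<le> K" using G0 G1 by (simp add: K_def)
  have "(if i then d1 \<tau> else d2 \<tau>) = 0" for i :: bool
  proof (rule gronwall_zero[where P = UNIV and f = "\<lambda>i t. if i then d1 t else d2 t" and f' = "\<lambda>i t. if i then e1 t else e2 t"
        and K = K and L = \<tau> and C = "(Ca + C1) + (Cb + C2)"])
    show "((\<lambda>t. if i then d1 t else d2 t) has_vector_derivative (if i then e1 t else e2 t)) (at t within {0..\<tau>})"
      if "t \<in> {0..\<tau>}" for i :: bool and t using dd1[OF that] dd2[OF that] by (cases i) auto
    show "(if i then d1 0 else d2 0) = 0" for i :: bool using aL0 bL0 o'(3,4) by (simp add: d1_def d2_def)
    show "cmod (if i then d1 t else d2 t) \<le> (Ca + C1) + (Cb + C2)" if t: "t \<in> {0..\<tau>}" for i :: bool and t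
    proof -
      have "cmod (d1 t) \<le> Ca + C1" "cmod (d2 t) \<le> Cb + C2"
        unfolding d1_def d2_def using t LL Ca Cb C1 C2 by (auto intro!: norm_triangle_le_diff add_mono)
      then show ?thesis using Ca Cb C1 C2 by auto
    qed
    show "cmod (if i then e1 t else e2 t) \<le> K * S"
      if t: "t \<in> {0..\<tau>}" and S: "\<And>i :: bool. i \<in> UNIV \<Longrightarrow> cmod (if i then d1 t else d2 t) \<le> S" for i :: bool and t S
    proof -
      have S1: "cmod (d1 t) \<le> S" and S2: "cmod (d2 t) \<le> S" using S[of True] S[of False] by auto
      have S0: "0 \<le> S" using order_trans[OF norm_ge_zero S1] .
      have h: "cmod (h0 t) \<le> G0" "cmod (h1 t) \<le> G1" using G0 G1 t by auto
      have hh: "cmod (h0 t) * cmod (h0 t) \<le> G0 * G0" using h G0 by (intro mult_mono) auto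
      have n1: "cmod (2 * k * h0 t + \<i> * h1 t) \<le> 2 * cmod k * G0 + G1"
        using h by (intro norm_triangle_le add_mono) (auto simp: norm_mult mult_left_mono)
      have n1': "cmod (2 * k * cnj (h0 t) - \<i> * cnj (h1 t)) \<le> 2 * cmod k * G0 + G1"
        using h by (intro norm_triangle_le_diff add_mono) (auto simp: norm_mult mult_left_mono)
      have n2: "cmod (4 * \<i> * k\<^sup>2 + \<i> * of_real lam * (h0 t * cnj (h0 t))) \<le> 4 * (cmod k)\<^sup>2 + G0 * G0"
        using hh lam by (intro norm_triangle_le add_mono) (auto simp: norm_mult norm_power)
      have n3: "cmod (\<i> * of_real lam * (h0 t * cnj (h0 t))) \<le> G0 * G0"
        using hh lam by (simp add: norm_mult)
      have p1: "cmod (- (4 * \<i> * k\<^sup>2 + \<i> * of_real lam * (h0 t * cnj (h0 t))) * d1 t) \<le> (4 * (cmod k)\<^sup>2 + G0 * G0) * S"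
        unfolding norm_mult[of "- _"] norm_minus_cancel by (intro mult_mono n2 S1) (use G0 in auto)
      have p2: "cmod ((2 * k * h0 t + \<i> * h1 t) * d2 t) \<le> (2 * cmod k * G0 + G1) * S"
        unfolding norm_mult[of _ "d2 t"] by (intro mult_mono n1 S2) (use G0 G1 in auto)
      have "cmod (of_real lam * (2 * k * cnj (h0 t) - \<i> * cnj (h1 t))) \<le> 2 * cmod k * G0 + G1"
        unfolding norm_mult[of "of_real lam"] using n1' lam by simp
      then have p3: "cmod (of_real lam * (2 * k * cnj (h0 t) - \<i> * cnj (h1 t)) * d1 t) \<le> (2 * cmod k * G0 + G1) * S"
        unfolding norm_mult[of _ "d1 t"] by (rule mult_mono[OF _ S1]) (use G0 G1 in auto)
      have p4: "cmod (\<i> * of_real lam * (h0 t * cnj (h0 t)) * d2 t) \<le> (G0 * G0) * S"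
        unfolding norm_mult[of _ "d2 t"] by (intro mult_mono n3 S2) (use G0 in auto)
      have "cmod (e1 t) \<le> (4 * (cmod k)\<^sup>2 + G0 * G0) * S + (2 * cmod k * G0 + G1) * S"
        unfolding e1_def by (intro norm_triangle_le add_mono p1 p2)
      moreover have "cmod (e2 t) \<le> (2 * cmod k * G0 + G1) * S + (G0 * G0) * S"
        unfolding e2_def by (intro norm_triangle_le add_mono p3 p4)
      moreover have "0 \<le> 4 * (cmod k)\<^sup>2 * S" using S0 by simp
      ultimately show ?thesis by (auto simp: K_def algebra_simps)
    qed
  qed (use \<tau> K0 in auto)
  from this[of True] this[of False] have "a L \<tau> = phi1 \<tau> k" "b L \<tau> = phi2 \<tau> k" by (simp_all add: d1_def d2_def)
  then show ?thesis
    using ab(3,4) \<tau> by (intro exI[of _ "\<lambda>x. a x \<tau>"] exI[of _ "\<lambda>x. b x \<tau>"]) auto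
qed

section \<open>Boundary data, conservation of mass and the kernels on the diagonal\<close>

text \<open>\<open>nls_solution\<close> speaks of two-sided derivatives at interior points. The
  smoothness witness agrees with them there, and its continuity carries the equation to the closed
  rectangle, so that it holds on the sides x = 0, x = L and at t = 0 as well.\<close>

lemma nls_smooth_data:
  assumes Ck: "Ck2_on 3 {0..L} {0..<T} q" and nls: "nls_solution T L lam q"
    and q0: "\<forall>x\<in>{0..L}. q x 0 = 0" and bv: "boundary_values T L q g0 g1 h0 h1"
    and L: "0 < L" and \<tau>: "0 < \<tau>" "\<tau> < T"
  shows "\<exists>D :: nat \<Rightarrow> nat \<Rightarrow> real \<Rightarrow> real \<Rightarrow> complex.
    (\<forall>i j. i + j \<le> 3 \<longrightarrow> continuous_on ({0..L} \<times> {0..\<tau>}) (\<lambda>(x, t). D i j x t)) \<and>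
    (\<forall>i j. i + j < 3 \<longrightarrow> (\<forall>x\<in>{0..L}. \<forall>t\<in>{0..\<tau>}.
      ((\<lambda>x. D i j x t) has_vector_derivative D (Suc i) j x t) (at x within {0..L}))) \<and>
    (\<forall>i j. i + j < 3 \<longrightarrow> (\<forall>x\<in>{0..L}. \<forall>t\<in>{0..\<tau>}.
      ((\<lambda>t. D i j x t) has_vector_derivative D i (Suc j) x t) (at t within {0..\<tau>}))) \<and>
    (\<forall>x\<in>{0..L}. \<forall>t\<in>{0..\<tau>}.
      D 0 1 x t = \<i> * D 2 0 x t - 2 * \<i> * of_real lam * (D 0 0 x t * cnj (D 0 0 x t)) * D 0 0 x t) \<and>
    (\<forall>t\<in>{0..\<tau>}. g0 t = D 0 0 0 t \<and> g1 t = D 1 0 0 t \<and> h0 t = D 0 0 L t \<and> h1 t = D 1 0 L t) \<and>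
    (\<forall>x\<in>{0..L}. D 0 0 x 0 = 0)"
proof -
  obtain D :: "nat \<Rightarrow> nat \<Rightarrow> real \<Rightarrow> real \<Rightarrow> complex" where
    Dq: "\<forall>x\<in>{0..L}. \<forall>y\<in>{0..<T}. D 0 0 x y = q x y" and
    Dc: "\<forall>i j. i + j \<le> 3 \<longrightarrow> continuous_on ({0..L} \<times> {0..<T}) (\<lambda>(x, y). D i j x y)" and
    Dd: "\<forall>i j. i + j < 3 \<longrightarrow> (\<forall>x\<in>{0..L}. \<forall>y\<in>{0..<T}.
         ((\<lambda>\<xi>. D i j \<xi> y) has_vector_derivative D (Suc i) j x y) (at x within {0..L}) \<and>
         ((\<lambda>\<eta>. D i j x \<eta>) has_vector_derivative D i (Suc j) x y) (at y within {0..<T}))"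
    using Ck unfolding Ck2_on_def by (elim exE conjE)
  have sub: "{0..\<tau>} \<subseteq> {0..<T}" using \<tau> by auto
  have cont: "continuous_on ({0..L} \<times> {0..\<tau>}) (\<lambda>(x, t). D i j x t)" if "i + j \<le> 3" for i j
    by (rule continuous_on_subset[OF Dc[rule_format, OF that]]) (use sub in auto)
  have dx: "((\<lambda>x. D i j x t) has_vector_derivative D (Suc i) j x t) (at x within {0..L})"
    if "i + j < 3" "x \<in> {0..L}" "t \<in> {0..\<tau>}" for i j x t
    using Dd[rule_format, OF that(1,2) subsetD[OF sub that(3)]] by (rule conjunct1)
  have dt: "((\<lambda>t. D i j x t) has_vector_derivative D i (Suc j) x t) (at t within {0..\<tau>})"
    if "i + j < 3" "x \<in> {0..L}" "t \<in> {0..\<tau>}" for i j x t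
  proof -
    have "((\<lambda>t. D i j x t) has_vector_derivative D i (Suc j) x t) (at t within {0..<T})"
      using Dd[rule_format, OF that(1,2) subsetD[OF sub that(3)]] by (rule conjunct2)
    then show ?thesis using sub by (rule has_vector_derivative_within_subset)
  qed
  define F where "F = (\<lambda>(x, t). \<i> * D 0 1 x t + D 2 0 x t - 2 * of_real lam * (D 0 0 x t * cnj (D 0 0 x t)) * D 0 0 x t)"
  have F0: "F (x, t) = 0" if x: "0 < x" "x < L" and t: "0 < t" "t < \<tau>" for x t
  proof -
    have atx: "at \<xi> within {0..L} = at \<xi>" if "\<xi> \<in> {0<..<L}" for \<xi> using that by (intro at_within_Icc_at) auto
    have "((\<lambda>t. D 0 0 x t) has_vector_derivative D 0 (Suc 0) x t) (at t within {0..\<tau>})" using x t by (intro dt) auto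
    moreover have "at t within {0..\<tau>} = at t" using t by (intro at_within_Icc_at) auto
    ultimately have "((\<lambda>t. D 0 0 x t) has_vector_derivative D 0 1 x t) (at t)" by simp
    then have "((\<lambda>t. q x t) has_vector_derivative D 0 1 x t) (at t)"
      by (rule has_vector_derivative_transform_within_open[where S = "{0<..<\<tau>}"]) (use Dq x t \<tau> in auto)
    then have 1: "vector_derivative (\<lambda>t. q x t) (at t) = D 0 1 x t" by (rule vector_derivative_at)
    have 2: "vector_derivative (\<lambda>y. q y t) (at \<xi>) = D 1 0 \<xi> t" if \<xi>: "\<xi> \<in> {0<..<L}" for \<xi>
    proof -
      have "((\<lambda>y. D 0 0 y t) has_vector_derivative D (Suc 0) 0 \<xi> t) (at \<xi> within {0..L})" using \<xi> t by (intro dx) auto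
      then have "((\<lambda>y. D 0 0 y t) has_vector_derivative D 1 0 \<xi> t) (at \<xi>)" using atx[OF \<xi>] by simp
      then have "((\<lambda>y. q y t) has_vector_derivative D 1 0 \<xi> t) (at \<xi>)"
        by (rule has_vector_derivative_transform_within_open[where S = "{0<..<L}"]) (use Dq \<xi> t \<tau> in auto)
      then show ?thesis by (rule vector_derivative_at)
    qed
    have "((\<lambda>y. D 1 0 y t) has_vector_derivative D (Suc 1) 0 x t) (at x within {0..L})" using x t by (intro dx) auto
    then have "((\<lambda>y. D 1 0 y t) has_vector_derivative D 2 0 x t) (at x)" using atx[of x] x by (simp add: numeral_2_eq_2)
    then have "((\<lambda>\<xi>. vector_derivative (\<lambda>y. q y t) (at \<xi>)) has_vector_derivative D 2 0 x t) (at x)"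
      by (rule has_vector_derivative_transform_within_open[where S = "{0<..<L}"]) (use 2 x in auto)
    then have 3: "vector_derivative (\<lambda>\<xi>. vector_derivative (\<lambda>y. q y t) (at \<xi>)) (at x) = D 2 0 x t" by (rule vector_derivative_at)
    have "\<i> * vector_derivative (\<lambda>\<tau>. q x \<tau>) (at t)
      + vector_derivative (\<lambda>\<xi>. vector_derivative (\<lambda>y. q y t) (at \<xi>)) (at x)
      - 2 * of_real lam * of_real ((cmod (q x t))\<^sup>2) * q x t = 0"
      using nls x t \<tau> unfolding nls_solution_def by simp
    moreover have "q x t = D 0 0 x t" using Dq x t \<tau> by simp
    ultimately show ?thesis unfolding 1 3 complex_norm_square by (simp add: F_def)
  qed
  have eq: "D 0 1 x t = \<i> * D 2 0 x t - 2 * \<i> * of_real lam * (D 0 0 x t * cnj (D 0 0 x t)) * D 0 0 x t"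
    if xt: "x \<in> {0..L}" "t \<in> {0..\<tau>}" for x t
  proof -
    have cl: "closure ({0<..<L} \<times> {0<..<\<tau>}) = {0..L} \<times> {0..\<tau>}" using L \<tau> by (simp add: closure_Times)
    have "continuous_on ({0..L} \<times> {0..\<tau>}) F"
      using cont[of 0 1] cont[of 2 0] cont[of 0 0] unfolding F_def split_beta by (auto intro!: continuous_intros)
    then have "F (x, t) = 0"
      using continuous_constant_on_closure[of "{0<..<L} \<times> {0<..<\<tau>}" F 0 "(x, t)"] F0 xt unfolding cl by auto
    then have "\<i> * (\<i> * D 0 1 x t + D 2 0 x t - 2 * of_real lam * (D 0 0 x t * cnj (D 0 0 x t)) * D 0 0 x t) = 0"
      by (simp add: F_def)
    then show ?thesis by (simp add: algebra_simps)
  qed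
  have bvD: "g0 t = D 0 0 0 t \<and> g1 t = D 1 0 0 t \<and> h0 t = D 0 0 L t \<and> h1 t = D 1 0 L t" if t: "t \<in> {0..\<tau>}" for t
  proof -
    have tT: "t \<in> {0..<T}" using t sub by auto
    have b: "g0 t = q 0 t" "h0 t = q L t" "((\<lambda>x. q x t) has_vector_derivative g1 t) (at 0 within {0..L})"
        "((\<lambda>x. q x t) has_vector_derivative h1 t) (at L within {0..L})"
      using bv tT unfolding boundary_values_def by auto
    have "((\<lambda>x. q x t) has_vector_derivative D 1 0 x t) (at x within {0..L})" if x: "x \<in> {0..L}" for x
    proof (rule has_vector_derivative_transform[OF x])
      show "q y t = D 0 0 y t" if "y \<in> {0..L}" for y using Dq that tT by simp
      show "((\<lambda>x. D 0 0 x t) has_vector_derivative D 1 0 x t) (at x within {0..L})"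
        using dx[of 0 0 x t] x t by simp
    qed
    \<comment> \<open>One-sided derivatives at the ends of the interval are unique, which identifies
      the Neumann data with the witness.\<close>
    from this[of 0] this[of L] have "g1 t = D 1 0 0 t" "h1 t = D 1 0 L t"
      using vector_derivative_unique_within_closed_interval[of 0 L 0 "\<lambda>x. q x t" "g1 t" "D 1 0 0 t"]
        vector_derivative_unique_within_closed_interval[of 0 L L "\<lambda>x. q x t" "h1 t" "D 1 0 L t"] b L by auto
    then show ?thesis using b Dq tT L by auto
  qed
  have q0D: "D 0 0 x 0 = 0" if "x \<in> {0..L}" for x using Dq q0 that \<tau> by simp
  show ?thesis
    by (intro exI[of _ D] conjI allI ballI impI) (rule cont dx dt eq bvD[THEN conjunct1]
      bvD[THEN conjunct2, THEN conjunct1] bvD[THEN conjunct2, THEN conjunct2, THEN conjunct1]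
      bvD[THEN conjunct2, THEN conjunct2, THEN conjunct2] q0D; assumption)+
qed

text \<open>The time derivative of |q|^2 is the x-derivative of i(q_x cnj q - q cnj q_x), the cubic
  term dropping out. Integrate over the rectangle in both orders; at t = 0 the mass is zero.\<close>

lemma nls_mass_balance:
  fixes q qx qxx qt :: "real \<Rightarrow> real \<Rightarrow> complex" and lam L \<tau> :: real
  assumes L: "0 \<le> L" and \<tau>: "0 \<le> \<tau>"
    and cont: "continuous_on ({0..L} \<times> {0..\<tau>}) (\<lambda>(x, t). q x t)" "continuous_on ({0..L} \<times> {0..\<tau>}) (\<lambda>(x, t). qxx x t)"
    and dq: "\<And>x t. x \<in> {0..L} \<Longrightarrow> t \<in> {0..\<tau>} \<Longrightarrow> ((\<lambda>x. q x t) has_vector_derivative qx x t) (at x within {0..L})"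
      "\<And>x t. x \<in> {0..L} \<Longrightarrow> t \<in> {0..\<tau>} \<Longrightarrow> ((\<lambda>x. qx x t) has_vector_derivative qxx x t) (at x within {0..L})"
      "\<And>x t. x \<in> {0..L} \<Longrightarrow> t \<in> {0..\<tau>} \<Longrightarrow> ((\<lambda>t. q x t) has_vector_derivative qt x t) (at t within {0..\<tau>})"
    and nls: "\<And>x t. x \<in> {0..L} \<Longrightarrow> t \<in> {0..\<tau>} \<Longrightarrow>
      qt x t = \<i> * qxx x t - 2 * \<i> * of_real lam * (q x t * cnj (q x t)) * q x t"
    and q0: "\<And>x. x \<in> {0..L} \<Longrightarrow> q x 0 = 0"
  shows "integral {0..L} (\<lambda>x. q x \<tau> * cnj (q x \<tau>)) =
    integral {0..\<tau>} (\<lambda>t. \<i> * (qx L t * cnj (q L t) - q L t * cnj (qx L t)) - \<i> * (qx 0 t * cnj (q 0 t) - q 0 t * cnj (qx 0 t)))"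
proof -
  define f where "f x t = \<i> * (qxx x t * cnj (q x t) - q x t * cnj (qxx x t))" for x t
  have cf: "continuous_on (cbox (0, 0) (L, \<tau>)) (\<lambda>(x, t). f x t)"
    using cont unfolding f_def split_beta cbox_Pair_eq box_real by (auto intro!: continuous_intros)
  have 1: "q x \<tau> * cnj (q x \<tau>) = integral (cbox 0 \<tau>) (f x)" if x: "x \<in> {0..L}" for x
  proof -
    have "(f x has_integral (q x \<tau> * cnj (q x \<tau>) - q x 0 * cnj (q x 0))) {0..\<tau>}"
    proof (rule fundamental_theorem_of_calculus[OF \<tau>])
      fix t assume t: "t \<in> {0..\<tau>}"
      have "q x t * cnj (qt x t) + qt x t * cnj (q x t) = f x t"
        unfolding f_def nls[OF x t] by (simp add: algebra_simps)
      then show "((\<lambda>t. q x t * cnj (q x t)) has_vector_derivative f x t) (at t within {0..\<tau>})"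
        using has_vector_derivative_mult[OF dq(3)[OF x t] has_vector_derivative_cnj[OF dq(3)[OF x t]]] by simp
    qed
    then show ?thesis using q0[OF x] by (simp add: integral_unique)
  qed
  have 2: "integral (cbox 0 L) (\<lambda>x. f x t) =
      \<i> * (qx L t * cnj (q L t) - q L t * cnj (qx L t)) - \<i> * (qx 0 t * cnj (q 0 t) - q 0 t * cnj (qx 0 t))"
    if t: "t \<in> {0..\<tau>}" for t
  proof -
    have "((\<lambda>x. f x t) has_integral
        (\<i> * (qx L t * cnj (q L t) - q L t * cnj (qx L t)) - \<i> * (qx 0 t * cnj (q 0 t) - q 0 t * cnj (qx 0 t)))) {0..L}"
    proof (rule fundamental_theorem_of_calculus[OF L])
      fix x assume x: "x \<in> {0..L}"
      note d = dq(1)[OF x t] dq(2)[OF x t]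
      have "\<i> * ((qx x t * cnj (qx x t) + qxx x t * cnj (q x t)) - (q x t * cnj (qxx x t) + qx x t * cnj (qx x t))) = f x t"
        unfolding f_def by (simp add: algebra_simps)
      then show "((\<lambda>x. \<i> * (qx x t * cnj (q x t) - q x t * cnj (qx x t))) has_vector_derivative f x t) (at x within {0..L})"
        using has_vector_derivative_mult_right[OF has_vector_derivative_diff[OF
            has_vector_derivative_mult[OF d(2) has_vector_derivative_cnj[OF d(1)]]
            has_vector_derivative_mult[OF d(1) has_vector_derivative_cnj[OF d(2)]]], of \<i>] by simp
    qed
    then show ?thesis by (simp add: integral_unique)
  qed
  have "integral {0..L} (\<lambda>x. q x \<tau> * cnj (q x \<tau>)) = integral (cbox 0 L) (\<lambda>x. integral (cbox 0 \<tau>) (f x))"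
    unfolding box_real[symmetric] by (rule integral_cong) (use 1 in simp)
  also have "\<dots> = integral (cbox 0 \<tau>) (\<lambda>t. integral (cbox 0 L) (\<lambda>x. f x t))"
    by (rule integral_swap_continuous[OF cf])
  also have "\<dots> = integral (cbox 0 \<tau>) (\<lambda>t. \<i> * (qx L t * cnj (q L t) - q L t * cnj (qx L t)) - \<i> * (qx 0 t * cnj (q 0 t) - q 0 t * cnj (qx 0 t)))"
    by (rule integral_cong) (use 2 in simp)
  finally show ?thesis by simp
qed

lemma boundary_values_continuous:
  assumes "Ck2_on 3 {0..L} {0..<T} q" "nls_solution T L lam q" "\<forall>x\<in>{0..L}. q x 0 = 0"
    "boundary_values T L q g0 g1 h0 h1" "0 < L" "0 < \<tau>" "\<tau> < T"
  shows "continuous_on {0..\<tau>} g0" "continuous_on {0..\<tau>} g1" "continuous_on {0..\<tau>} h0" "continuous_on {0..\<tau>} h1"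
proof -
  obtain D :: "nat \<Rightarrow> nat \<Rightarrow> real \<Rightarrow> real \<Rightarrow> complex" where
    D: "\<forall>i j. i + j \<le> 3 \<longrightarrow> continuous_on ({0..L} \<times> {0..\<tau>}) (\<lambda>(x, t). D i j x t)"
    and bv: "\<forall>t\<in>{0..\<tau>}. g0 t = D 0 0 0 t \<and> g1 t = D 1 0 0 t \<and> h0 t = D 0 0 L t \<and> h1 t = D 1 0 L t"
    using nls_smooth_data[OF assms] by (elim exE conjE)
  have slice: "continuous_on {0..\<tau>} (\<lambda>t. D i j x t)" if "i + j \<le> 3" "x \<in> {0..L}" for i j x
    using continuous_on_slice(1)[OF D[rule_format, OF that(1)] that(2)] .
  show "continuous_on {0..\<tau>} g0" by (rule continuous_on_eq[OF slice[of 0 0 0]]) (use bv assms in auto)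
  show "continuous_on {0..\<tau>} g1" by (rule continuous_on_eq[OF slice[of 1 0 0]]) (use bv assms in auto)
  show "continuous_on {0..\<tau>} h0" by (rule continuous_on_eq[OF slice[of 0 0 L]]) (use bv assms in auto)
  show "continuous_on {0..\<tau>} h1" by (rule continuous_on_eq[OF slice[of 1 0 L]]) (use bv assms in auto)
qed

section \<open>The kernels inside the triangle and on its diagonal\<close>

lemma C1_triangle_slice:
  assumes "C1_triangle T f" "0 < t" "t < T"
  shows "\<exists>f'. continuous_on {-t..t} (f t) \<and> continuous_on {-t..t} f' \<and>
    (\<forall>s\<in>{-t<..<t}. (f t has_vector_derivative f' s) (at s))"
proof -
  let ?S = "{(t, s). 0 \<le> t \<and> t < T \<and> - t \<le> s \<and> s \<le> t}"
  obtain ft fs :: "real \<Rightarrow> real \<Rightarrow> complex" where c: "\<forall>u\<in>{f, ft, fs}. continuous_on ?S (\<lambda>(t, s). u t s)"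
    and d: "\<forall>t s. 0 < t \<and> t < T \<and> - t < s \<and> s < t \<longrightarrow>
        ((\<lambda>\<tau>. f \<tau> s) has_vector_derivative ft t s) (at t) \<and> ((\<lambda>\<sigma>. f t \<sigma>) has_vector_derivative fs t s) (at s)"
    using assms(1) unfolding C1_triangle_def by (elim exE conjE)
  have slice: "continuous_on {-t..t} (\<lambda>s. (\<lambda>(t, s). u t s) (t, s))" if "u \<in> {f, ft, fs}" for u
    by (rule continuous_on_compose2[OF bspec[OF c that]]) (intro continuous_intros, use assms in auto)
  show ?thesis
    by (rule exI[of _ "fs t"]) (use slice[of f] slice[of fs] d assms in auto)
qed

text \<open>Along a ray both variables move at once, which calls for total differentiability. It
  follows from the continuity of the partial derivatives on a small square inside the triangle; the
  half-side \<open>\<delta>\<close> is chosen to keep the square there.\<close>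

lemma C1_triangle_total_derivative:
  assumes "C1_triangle T f"
  shows "\<exists>ft fs.
    (\<forall>u\<in>{f, ft, fs}. continuous_on {(t, s). 0 \<le> t \<and> t < T \<and> - t \<le> s \<and> s \<le> t} (\<lambda>(t, s). u t s)) \<and>
    (\<forall>t s. 0 < t \<longrightarrow> t < T \<longrightarrow> - t < s \<longrightarrow> s < t \<longrightarrow> ddt f t s = ft t s \<and> dds f t s = fs t s) \<and>
    (\<forall>t s. 0 < t \<longrightarrow> t < T \<longrightarrow> - t < s \<longrightarrow> s < t \<longrightarrow>
      ((\<lambda>(t, s). f t s) has_derivative (\<lambda>(a, b). a *\<^sub>R ft t s + b *\<^sub>R fs t s)) (at (t, s)))"
proof -
  let ?S = "{(t, s). 0 \<le> t \<and> t < T \<and> - t \<le> s \<and> s \<le> t}"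
  obtain ft fs :: "real \<Rightarrow> real \<Rightarrow> complex" where c: "\<forall>u\<in>{f, ft, fs}. continuous_on ?S (\<lambda>(t, s). u t s)"
    and d: "\<forall>t s. 0 < t \<and> t < T \<and> - t < s \<and> s < t \<longrightarrow>
        ((\<lambda>\<tau>. f \<tau> s) has_vector_derivative ft t s) (at t) \<and> ((\<lambda>\<sigma>. f t \<sigma>) has_vector_derivative fs t s) (at s)"
    using assms(1) unfolding C1_triangle_def by (elim exE conjE)
  have tot: "((\<lambda>(t, s). f t s) has_derivative (\<lambda>(a, b). a *\<^sub>R ft t s + b *\<^sub>R fs t s)) (at (t, s))"
    if ts: "0 < t" "t < T" "- t < s" "s < t" for t s
  proof -
    define \<delta> where "\<delta> = min (min (t - s) (t + s)) (T - t) / 2"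
    have \<delta>: "0 < \<delta>" "2 * \<delta> \<le> t - s" "2 * \<delta> \<le> t + s" "\<delta> < T - t" using ts by (auto simp: \<delta>_def)
    define X where "X = {t - \<delta><..<t + \<delta>}"
    define Y where "Y = {s - \<delta><..<s + \<delta>}"
    have XY: "(t, s) \<in> X \<times> Y" "open (X \<times> Y)" "convex Y" using \<delta> by (auto simp: X_def Y_def intro: open_Times)
    have inXY: "0 < x \<and> x < T \<and> - x < y \<and> y < x" if "x \<in> X" "y \<in> Y" for x y
      using that \<delta> by (auto simp: X_def Y_def)
    have "((\<lambda>(x, y). f x y) has_derivative (\<lambda>(a, b). blinfun_apply (blinfun_scaleR_left (ft t s)) a
        + blinfun_apply (blinfun_scaleR_left (fs t s)) b)) (at (t, s) within X \<times> Y)"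
    proof (rule has_derivative_partialsI)
      show "((\<lambda>x. f x s) has_derivative blinfun_apply (blinfun_scaleR_left (ft t s))) (at t within X)"
        using d ts unfolding has_vector_derivative_eq_has_derivative_blinfun[symmetric]
        by (auto intro: has_vector_derivative_at_within)
      show "((\<lambda>y. f x y) has_derivative blinfun_apply (blinfun_scaleR_left (fs x y))) (at y within Y)"
        if "x \<in> X" "y \<in> Y" for x y
        using d inXY[OF that] unfolding has_vector_derivative_eq_has_derivative_blinfun[symmetric]
        by (auto intro: has_vector_derivative_at_within)
      have "continuous_on (X \<times> Y) (\<lambda>(x, y). fs x y)"
      proof (rule continuous_on_subset)
        show "continuous_on ?S (\<lambda>(t, s). fs t s)" using c by simp
        show "X \<times> Y \<subseteq> ?S"
        proof
          fix p assume "p \<in> X \<times> Y"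
          then obtain x y where "p = (x, y)" "x \<in> X" "y \<in> Y" by auto
          then show "p \<in> ?S" using inXY[of x y] by auto
        qed
      qed
      then have "continuous_on (X \<times> Y) (\<lambda>p. blinfun_scaleR_left ((\<lambda>(x, y). fs x y) p))"
        by (rule bounded_linear.continuous_on[OF bounded_linear_blinfun_scaleR_left])
      then show "continuous (at (t, s) within X \<times> Y) (\<lambda>(x, y). blinfun_scaleR_left (fs x y))"
        using XY(1) unfolding continuous_on_eq_continuous_within split_beta by blast
    qed (use XY in auto)
    then show ?thesis using at_within_open[OF XY(1,2)] by simp
  qed
  have dd: "ddt f t s = ft t s \<and> dds f t s = fs t s" if "0 < t" "t < T" "- t < s" "s < t" for t s
    using d that unfolding ddt_def dds_def by (auto intro: vector_derivative_at)
  show ?thesis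
    by (rule exI[of _ ft], rule exI[of _ fs], intro conjI[OF c] conjI allI impI)
      (simp_all add: dd tot)
qed

text \<open>The system only holds inside the triangle, so the diagonal is approached along the rays \<open>s = \<theta>t\<close>,
  \<open>\<theta> < 1\<close>.\<close>

lemma goursat_M2_diagonal:
  assumes C1: "C1_triangle T (L1 K)" "C1_triangle T (M1 K)" "C1_triangle T (M2 K)"
    and gou: "goursat T lam g0 g1 K" and t: "0 < t" "t < T"
  shows "M2 K t t = integral {0..t} (\<lambda>r. \<i> * of_real lam * (cnj (g0 r) * g1 r - cnj (g1 r) * g0 r))"
proof -
  let ?S = "{(t, s). 0 \<le> t \<and> t < T \<and> - t \<le> s \<and> s \<le> t}"
  obtain ft fs where ft: "\<forall>u\<in>{M2 K, ft, fs}. continuous_on ?S (\<lambda>(t, s). u t s)"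
    "\<forall>t s. 0 < t \<longrightarrow> t < T \<longrightarrow> - t < s \<longrightarrow> s < t \<longrightarrow> ddt (M2 K) t s = ft t s \<and> dds (M2 K) t s = fs t s"
    "\<forall>t s. 0 < t \<longrightarrow> t < T \<longrightarrow> - t < s \<longrightarrow> s < t \<longrightarrow>
      ((\<lambda>(t, s). M2 K t s) has_derivative (\<lambda>(a, b). a *\<^sub>R ft t s + b *\<^sub>R fs t s)) (at (t, s))"
    using C1_triangle_total_derivative[OF C1(3)] by (elim exE conjE)
  note c = ft(1)[rule_format] and dd = ft(2)[rule_format] and tot = ft(3)[rule_format]
  have pde: "ft r s + fs r s = 2 * of_real lam * cnj (g0 r) * L1 K r s - \<i> * of_real lam * cnj (g1 r) * M1 K r s"
    if "0 < r" "r < T" "- r < s" "s < r" for r s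
  proof -
    have "ddt (M2 K) r s + dds (M2 K) r s =
        2 * of_real lam * cnj (g0 r) * L1 K r s - \<i> * of_real lam * cnj (g1 r) * M1 K r s"
      using gou that unfolding goursat_def Let_def by simp
    then show ?thesis using dd[OF that] by simp
  qed
  have diag: "L1 K r r = \<i> / 2 * g1 r" "M1 K r r = g0 r" "M2 K r (- r) = 0" if "0 \<le> r" "r < T" for r
    using gou that unfolding goursat_def Let_def by auto
  have ray: "continuous_on ({0..1} \<times> cbox 0 t) (\<lambda>z. (\<lambda>(t, s). u t s) (snd z, fst z * snd z))" if "u \<in> {M2 K, ft, fs}" for u
  proof (rule continuous_on_compose2[OF c[OF that]])
    show "continuous_on ({0..1} \<times> cbox 0 t) (\<lambda>z. (snd z, fst z * snd z))" by (intro continuous_intros)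
    show "(\<lambda>z. (snd z, fst z * snd z)) ` ({0..1} \<times> cbox 0 t) \<subseteq> ?S"
    proof (rule image_subsetI)
      fix z :: "real \<times> real" assume z: "z \<in> {0..1} \<times> cbox 0 t"
      then have "0 \<le> fst z * snd z" "fst z * snd z \<le> 1 * snd z" using mult_right_mono[of "fst z" 1 "snd z"] by (auto simp: mem_Times_iff)
      then show "(snd z, fst z * snd z) \<in> ?S" using z t by (auto simp: mem_Times_iff)
    qed
  qed
  define I where "I \<theta> = integral (cbox 0 t) (\<lambda>r. ft r (\<theta> * r) + \<theta> *\<^sub>R fs r (\<theta> * r))" for \<theta>
  have cI: "continuous_on {0..1} I" unfolding I_def[abs_def]
  proof (rule integral_continuous_on_param)
    show "continuous_on ({0..1} \<times> cbox 0 t) (\<lambda>(\<theta>, r). ft r (\<theta> * r) + \<theta> *\<^sub>R fs r (\<theta> * r))"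
      using ray[of ft] ray[of fs] unfolding split_beta by (auto intro!: continuous_intros)
  qed
  have sl: "continuous_on {0..t} (\<lambda>r. M2 K r (\<theta> * r))" if "\<theta> \<in> {0..1}" for \<theta>
  proof -
    have "continuous_on {0..t} (\<lambda>r. (\<lambda>z. (\<lambda>(t, s). M2 K t s) (snd z, fst z * snd z)) (\<theta>, r))"
      by (rule continuous_on_compose2[OF ray]) (auto intro!: continuous_intros simp: that[simplified])
    then show ?thesis by simp
  qed
  have cM: "continuous_on {0..1} (\<lambda>\<theta>. M2 K t (\<theta> * t))"
  proof -
    have "continuous_on {0..1} (\<lambda>\<theta>. (\<lambda>z. (\<lambda>(t, s). M2 K t s) (snd z, fst z * snd z)) (\<theta>, t))"
      by (rule continuous_on_compose2[OF ray[of "M2 K"]]) (simp, intro continuous_intros, use t in auto)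
    then show ?thesis by simp
  qed
  \<comment> \<open>The derivative of \<open>M2\<close> along an inner ray is integrated from the
    vertex, where \<open>M2 K 0 0 = 0\<close> is the condition on the lower side of the triangle at
    time 0.\<close>
  have eq: "I \<theta> - M2 K t (\<theta> * t) = 0" if \<theta>: "\<theta> \<in> {0<..<1}" for \<theta>
  proof -
    have "((\<lambda>r. ft r (\<theta> * r) + \<theta> *\<^sub>R fs r (\<theta> * r)) has_integral (M2 K t (\<theta> * t) - M2 K 0 (\<theta> * 0))) {0..t}"
    proof (rule fundamental_theorem_of_calculus_interior)
      show "continuous_on {0..t} (\<lambda>r. M2 K r (\<theta> * r))" using \<theta> by (intro sl) auto
      fix r assume r: "r \<in> {0<..<t}"
      have "\<theta> * r < 1 * r" "- r < \<theta> * r" using r \<theta> by (auto intro: mult_strict_right_mono less_le_trans[of _ 0])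
      then have T: "((\<lambda>(t, s). M2 K t s) has_derivative (\<lambda>(a, b). a *\<^sub>R ft r (\<theta> * r) + b *\<^sub>R fs r (\<theta> * r))) (at (r, \<theta> * r))"
        using r t by (intro tot) auto
      have P: "((\<lambda>r. (r, \<theta> * r)) has_derivative (\<lambda>h. (h, \<theta> * h))) (at r)"
        by (auto intro!: derivative_eq_intros)
      from has_derivative_compose[OF P T]
      show "((\<lambda>r. M2 K r (\<theta> * r)) has_vector_derivative ft r (\<theta> * r) + \<theta> *\<^sub>R fs r (\<theta> * r)) (at r)"
        by (simp add: has_vector_derivative_def scaleR_add_right mult.commute)
    qed (use t in auto)
    then show ?thesis using diag(3)[of 0] t by (simp add: I_def integral_unique)
  qed
  \<comment> \<open>Both terms are continuous in \<theta> up to 1, so the identity passes from the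
    inner rays to the diagonal.\<close>
  have "I 1 - M2 K t (1 * t) = 0"
  proof (rule continuous_constant_on_closure[of "{0<..<1}" "\<lambda>\<theta>. I \<theta> - M2 K t (\<theta> * t)"])
    show "continuous_on (closure {0<..<1}) (\<lambda>\<theta>. I \<theta> - M2 K t (\<theta> * t))"
      by (simp add: continuous_on_diff cI cM)
  qed (use eq in auto)
  then have M: "M2 K t t = integral {0..t} (\<lambda>r. ft r r + fs r r)" by (simp add: I_def)
  also have "\<dots> = integral {0<..<t} (\<lambda>r. ft r r + fs r r)" by (rule integral_open_interval_real)
  also have "\<dots> = integral {0<..<t} (\<lambda>r. \<i> * of_real lam * (cnj (g0 r) * g1 r - cnj (g1 r) * g0 r))"
  proof (rule integral_cong)
    fix r assume r: "r \<in> {0<..<t}"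
    then have r': "0 < r" "r < T" using t by auto
    have l': "continuous_on {-r..r} (L1 K r)" and m': "continuous_on {-r..r} (M1 K r)"
      using C1_triangle_slice[OF C1(1) r'] C1_triangle_slice[OF C1(2) r'] by simp_all
    have cu: "continuous_on {-r..r} (\<lambda>s. (\<lambda>(t, s). u t s) (r, s))" if "u \<in> {M2 K, ft, fs}" for u
      by (rule continuous_on_compose2[OF c[OF that]]) (intro continuous_intros, use r' in auto)
    \<comment> \<open>At \<theta> = 1 the derivative along the ray is the left side of the equation
      for \<open>M2\<close>, which extends to the diagonal by continuity in \<open>s\<close>; there
      \<open>L1\<close> and \<open>M1\<close> are the boundary values.\<close>
    have "ft r r + fs r r - (2 * of_real lam * cnj (g0 r) * L1 K r r - \<i> * of_real lam * cnj (g1 r) * M1 K r r) = 0"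
    proof (rule continuous_constant_on_closure[of "{-r<..<r}"
          "\<lambda>s. ft r s + fs r s - (2 * of_real lam * cnj (g0 r) * L1 K r s - \<i> * of_real lam * cnj (g1 r) * M1 K r s)"])
      show "continuous_on (closure {-r<..<r}) (\<lambda>s. ft r s + fs r s - (2 * of_real lam * cnj (g0 r) * L1 K r s - \<i> * of_real lam * cnj (g1 r) * M1 K r s))"
        using r' cu[of ft] cu[of fs] l' m' by (auto intro!: continuous_intros)
    qed (use r' pde in auto)
    then show "ft r r + fs r r = \<i> * of_real lam * (cnj (g0 r) * g1 r - cnj (g1 r) * g0 r)"
      using r' by (simp add: diag algebra_simps)
  qed
  finally show ?thesis unfolding integral_open_interval_real[symmetric] .
qed

section \<open>Evaluation of the contour integrals\<close>

text \<open>The transfer matrix has determinant one, so \<open>u = Phi2* a - Phi1 e\<^sup>-\<^sup>2\<^sup>i\<^sup>k\<^sup>x b*\<close> is the solution with initial value \<open>(0, 1)\<close>, and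
  the combination of the global relation is \<open>- e\<^sup>2\<^sup>i\<^sup>k\<^sup>L u\<close> at \<open>x = L\<close>.\<close>

lemma nls_global_relation_asymptotics:
  assumes L: "0 < L" and lam: "\<bar>lam\<bar> = 1" and \<tau>: "0 < \<tau>" "\<tau> < T"
    and Ck: "Ck2_on 3 {0..L} {0..<T} q" and nls: "nls_solution T L lam q"
    and q0: "\<forall>x\<in>{0..L}. q x 0 = 0" and bv: "boundary_values T L q g0 g1 h0 h1"
    and ef: "eigenfunctions T lam g0 g1 Phi1 Phi2" "eigenfunctions T lam h0 h1 phi1 phi2"
  defines "m \<equiv> of_real lam * integral {0..\<tau>} (\<lambda>t. \<i> * (h1 t * cnj (h0 t) - h0 t * cnj (h1 t)) - \<i> * (g1 t * cnj (g0 t) - g0 t * cnj (g1 t)))"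
  shows "\<exists>C\<ge>0. \<forall>k. 1 \<le> cmod k \<longrightarrow>
    cmod (Phi1 \<tau> k * cnj (phi2 \<tau> (cnj k)) - exp (2 * \<i> * k * of_real L) * phi1 \<tau> k * cnj (Phi2 \<tau> (cnj k)) -
      ((g0 \<tau> - exp (2 * \<i> * k * of_real L) * h0 \<tau>) / (2 * \<i> * k)
       + (((g1 \<tau> + g0 \<tau> * m) / 4) - exp (2 * \<i> * k * of_real L) * ((h1 \<tau> - h0 \<tau> * m) / 4)) / k^2))
    \<le> C * max 1 (exp (- 2 * Im k * L)) / (cmod k)^3"
proof -
  obtain D :: "nat \<Rightarrow> nat \<Rightarrow> real \<Rightarrow> real \<Rightarrow> complex" where D:
    "\<forall>i j. i + j \<le> 3 \<longrightarrow> continuous_on ({0..L} \<times> {0..\<tau>}) (\<lambda>(x, t). D i j x t)"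
    "\<forall>i j. i + j < 3 \<longrightarrow> (\<forall>x\<in>{0..L}. \<forall>t\<in>{0..\<tau>}.
      ((\<lambda>x. D i j x t) has_vector_derivative D (Suc i) j x t) (at x within {0..L}))"
    "\<forall>i j. i + j < 3 \<longrightarrow> (\<forall>x\<in>{0..L}. \<forall>t\<in>{0..\<tau>}.
      ((\<lambda>t. D i j x t) has_vector_derivative D i (Suc j) x t) (at t within {0..\<tau>}))"
    "\<forall>x\<in>{0..L}. \<forall>t\<in>{0..\<tau>}.
      D 0 1 x t = \<i> * D 2 0 x t - 2 * \<i> * of_real lam * (D 0 0 x t * cnj (D 0 0 x t)) * D 0 0 x t"
    "\<forall>t\<in>{0..\<tau>}. g0 t = D 0 0 0 t \<and> g1 t = D 1 0 0 t \<and> h0 t = D 0 0 L t \<and> h1 t = D 1 0 L t"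
    "\<forall>x\<in>{0..L}. D 0 0 x 0 = 0"
    using nls_smooth_data[OF Ck nls q0 bv L \<tau>] by (elim exE conjE)
  note cD = D(1)[rule_format] and dx = D(2)[rule_format] and dt = D(3)[rule_format] and eq = D(4)[rule_format]
    and q0D = D(6)[rule_format]
  have bvD: "g0 t = D 0 0 0 t \<and> g1 t = D 1 0 0 t \<and> h0 t = D 0 0 L t \<and> h1 t = D 1 0 L t" if "t \<in> {0..\<tau>}" for t
    using D(5) that by (rule bspec)
  have \<tau>0: "0 \<le> \<tau>" and \<tau>\<tau>: "\<tau> \<in> {0..\<tau>}" and end_pts: "0 \<in> {0..L}" "L \<in> {0..L}" using \<tau> L by auto
  have d00: "((\<lambda>x. D 0 0 x t) has_vector_derivative D 1 0 x t) (at x within {0..L})"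
    and d10: "((\<lambda>x. D 1 0 x t) has_vector_derivative D 2 0 x t) (at x within {0..L})"
    and d20: "((\<lambda>x. D 2 0 x t) has_vector_derivative D 3 0 x t) (at x within {0..L})"
    and d01: "((\<lambda>t. D 0 0 x t) has_vector_derivative D 0 1 x t) (at t within {0..\<tau>})"
    if "x \<in> {0..L}" "t \<in> {0..\<tau>}" for x t
    using dx[of 0 0 x t] dx[of 1 0 x t] dx[of 2 0 x t] dt[of 0 0 x t] that
    by (simp_all add: numeral_2_eq_2 numeral_3_eq_3)
  have cD': "continuous_on ({0..L} \<times> {0..\<tau>}) (\<lambda>(x, t). D 0 0 x t)" "continuous_on ({0..L} \<times> {0..\<tau>}) (\<lambda>(x, t). D 1 0 x t)"
    "continuous_on ({0..L} \<times> {0..\<tau>}) (\<lambda>(x, t). D 0 1 x t)" "continuous_on ({0..L} \<times> {0..\<tau>}) (\<lambda>(x, t). D 2 0 x t)"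
    "continuous_on ({0..L} \<times> {0..\<tau>}) (\<lambda>(x, t). D 3 0 x t)"
    by (rule cD, simp)+
  have "\<forall>k. \<exists>a b. a 0 = Phi1 \<tau> k \<and> b 0 = Phi2 \<tau> k \<and> a L = phi1 \<tau> k \<and> b L = phi2 \<tau> k \<and>
    (\<forall>x\<in>{0..L}. (a has_vector_derivative (- 2 * \<i> * k * a x + D 0 0 x \<tau> * b x)) (at x within {0..L}) \<and>
      (b has_vector_derivative (of_real lam * cnj (D 0 0 x \<tau>) * a x)) (at x within {0..L}))"
    by (intro allI, rule eigenfunctions_x_evolution[OF lam L \<tau>0 \<tau>(2) cD'(1,2,3) d00 d10 d01 eq q0D bvD ef])
  then obtain a b where ab: "\<And>k. a k 0 = Phi1 \<tau> k" "\<And>k. b k 0 = Phi2 \<tau> k" "\<And>k. a k L = phi1 \<tau> k" "\<And>k. b k L = phi2 \<tau> k"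
    "\<And>k x. x \<in> {0..L} \<Longrightarrow> (a k has_vector_derivative (- 2 * \<i> * k * a k x + D 0 0 x \<tau> * b k x)) (at x within {0..L})"
    "\<And>k x. x \<in> {0..L} \<Longrightarrow> (b k has_vector_derivative (of_real lam * cnj (D 0 0 x \<tau>) * a k x)) (at x within {0..L})"
    by metis
  have cg: "continuous_on {0..\<tau>} g0" "continuous_on {0..\<tau>} g1"
    using bvD continuous_on_eq[OF continuous_on_slice(1)[OF cD'(1) end_pts(1)], of g0]
      continuous_on_eq[OF continuous_on_slice(1)[OF cD'(2) end_pts(1)], of g1] by simp_all
  note det = eigenfunctions_determinant[OF ef(1) \<tau>0 \<tau>(2) cg]
  define E where "E k x = exp (- 2 * \<i> * k * of_real x)" for k and x :: real
  have dE: "(E k has_vector_derivative - 2 * \<i> * k * E k x) (at x within {0..L})" for k x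
  proof -
    have "((\<lambda>z. exp (- 2 * \<i> * k * z)) has_field_derivative - 2 * \<i> * k * E k x) (at (of_real x))"
      by (auto intro!: derivative_eq_intros simp: E_def)
    from has_vector_derivative_real_field[OF this] show ?thesis by (simp add: E_def[abs_def])
  qed
  define u where "u k x = cnj (Phi2 \<tau> (cnj k)) * a k x - Phi1 \<tau> k * (E k x * cnj (b (cnj k) x))" for k x
  define v where "v k x = cnj (Phi2 \<tau> (cnj k)) * b k x - of_real lam * Phi1 \<tau> k * (E k x * cnj (a (cnj k) x))" for k x
  have du: "(u k has_vector_derivative (- 2 * \<i> * k * u k x + D 0 0 x \<tau> * v k x)) (at x within {0..L})"
    and dv: "(v k has_vector_derivative (of_real lam * cnj (D 0 0 x \<tau>) * u k x)) (at x within {0..L})" if x: "x \<in> {0..L}" for k x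
  proof -
    have "(u k has_vector_derivative cnj (Phi2 \<tau> (cnj k)) * (- 2 * \<i> * k * a k x + D 0 0 x \<tau> * b k x)
        - Phi1 \<tau> k * (E k x * cnj (of_real lam * cnj (D 0 0 x \<tau>) * a (cnj k) x) + - 2 * \<i> * k * E k x * cnj (b (cnj k) x))) (at x within {0..L})"
      unfolding u_def[abs_def]
      by (intro has_vector_derivative_diff has_vector_derivative_mult_right has_vector_derivative_mult has_vector_derivative_cnj ab x dE)
    then show "(u k has_vector_derivative (- 2 * \<i> * k * u k x + D 0 0 x \<tau> * v k x)) (at x within {0..L})"
      by (rule has_vector_derivative_eq_rhs) (simp add: u_def v_def algebra_simps)
    have "(v k has_vector_derivative cnj (Phi2 \<tau> (cnj k)) * (of_real lam * cnj (D 0 0 x \<tau>) * a k x)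
        - of_real lam * Phi1 \<tau> k * (E k x * cnj (- 2 * \<i> * cnj k * a (cnj k) x + D 0 0 x \<tau> * b (cnj k) x) + - 2 * \<i> * k * E k x * cnj (a (cnj k) x))) (at x within {0..L})"
      unfolding v_def[abs_def]
      by (intro has_vector_derivative_diff has_vector_derivative_mult_right has_vector_derivative_mult has_vector_derivative_cnj ab x dE)
    then show "(v k has_vector_derivative (of_real lam * cnj (D 0 0 x \<tau>) * u k x)) (at x within {0..L})"
      by (rule has_vector_derivative_eq_rhs) (simp add: u_def v_def algebra_simps)
  qed
  have u0: "u k 0 = 0" for k by (simp add: u_def ab E_def)
  \<comment> \<open>This is the determinant identity: it normalises the second component of the
    combination to 1 at x = 0.\<close>
  have v0: "v k 0 = 1" for k using det[of k] by (simp add: v_def ab E_def mult_ac)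
  have uL: "- exp (2 * \<i> * k * of_real L) * u k L =
      Phi1 \<tau> k * cnj (phi2 \<tau> (cnj k)) - exp (2 * \<i> * k * of_real L) * phi1 \<tau> k * cnj (Phi2 \<tau> (cnj k))" for k
  proof -
    have "exp (2 * \<i> * k * of_real L) * E k L = 1" unfolding E_def by (simp flip: exp_add)
    then have "exp (2 * \<i> * k * of_real L) * (Phi1 \<tau> k * (E k L * cnj (phi2 \<tau> (cnj k)))) = Phi1 \<tau> k * cnj (phi2 \<tau> (cnj k))"
      by algebra
    then show ?thesis unfolding u_def ab by (simp add: algebra_simps)
  qed
  have "integral {0..L} (\<lambda>x. D 0 0 x \<tau> * cnj (D 0 0 x \<tau>)) =
      integral {0..\<tau>} (\<lambda>t. \<i> * (D 1 0 L t * cnj (D 0 0 L t) - D 0 0 L t * cnj (D 1 0 L t)) - \<i> * (D 1 0 0 t * cnj (D 0 0 0 t) - D 0 0 0 t * cnj (D 1 0 0 t)))"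
    by (rule nls_mass_balance[where qx = "D 1 0" and qxx = "D 2 0" and qt = "D 0 1" and lam = lam,
          OF less_imp_le[OF L] \<tau>0 cD'(1,4) d00 d10 d01 eq q0D])
  also have "\<dots> = integral {0..\<tau>} (\<lambda>t. \<i> * (h1 t * cnj (h0 t) - h0 t * cnj (h1 t)) - \<i> * (g1 t * cnj (g0 t) - g0 t * cnj (g1 t)))"
    by (rule integral_cong) (simp add: bvD)
  finally have m: "of_real lam * integral {0..L} (\<lambda>x. D 0 0 x \<tau> * cnj (D 0 0 x \<tau>)) = m" by (simp add: m_def)
  have "\<exists>C\<ge>0. \<forall>k. 1 \<le> cmod k \<longrightarrow>
    cmod (- exp (2 * \<i> * k * of_real L) * u k L -
      ((D 0 0 0 \<tau> - exp (2 * \<i> * k * of_real L) * D 0 0 L \<tau>) / (2 * \<i> * k)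
       + (((D 1 0 0 \<tau> + D 0 0 0 \<tau> * m) / 4) - exp (2 * \<i> * k * of_real L) * ((D 1 0 L \<tau> - D 0 0 L \<tau> * m) / 4)) / k^2))
    \<le> C * max 1 (exp (- 2 * Im k * L)) / (cmod k)^3"
    unfolding m[symmetric]
    by (rule scattering_asymptotics[where q = "\<lambda>x. D 0 0 x \<tau>" and ?q1.0 = "\<lambda>x. D 1 0 x \<tau>" and ?q2.0 = "\<lambda>x. D 2 0 x \<tau>"
          and ?q3.0 = "\<lambda>x. D 3 0 x \<tau>" and v = v,
          OF L lam d00[OF _ \<tau>\<tau>] d10[OF _ \<tau>\<tau>] d20[OF _ \<tau>\<tau>] continuous_on_slice(2)[OF cD'(5) \<tau>\<tau>] du dv u0 v0])
  then show ?thesis unfolding uL using bvD[OF \<tau>\<tau>] by simp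
qed

section \<open>The transforms as oscillatory integrals in k^2\<close>

lemma hat_eq_osc: "hat f t k = osc 1 t (f t) (k\<^sup>2)"
  by (simp add: hat_def osc_def)

lemma hatc_eq_osc: "hatc f t k = osc (- 1) t (\<lambda>s. cnj (f t s)) (k\<^sup>2)"
  unfolding hatc_def hat_def osc_def integral_cnj by (simp add: exp_cnj)

lemma hat_minus: "hat f t (- k) = hat f t k" "hatc f t (- k) = hatc f t k"
  by (simp_all add: hat_eq_osc hatc_eq_osc)

lemma hat_holomorphic:
  assumes "C1_triangle T f" "0 < t" "t < T"
  shows "hat f t holomorphic_on UNIV" "hatc f t holomorphic_on UNIV"
proof -
  have f: "continuous_on {-t..t} (f t)" using C1_triangle_slice[OF assms] by simp
  have "(osc \<sigma> t h \<circ> (\<lambda>k. k\<^sup>2)) holomorphic_on UNIV" if "continuous_on {-t..t} h" for \<sigma> h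
    by (rule holomorphic_on_compose_gen[OF _ osc_holomorphic[OF that]]) (auto intro!: holomorphic_intros)
  from this[OF f, of 1] this[OF continuous_on_cnj[OF f], of "- 1"]
  show "hat f t holomorphic_on UNIV" "hatc f t holomorphic_on UNIV"
    by (simp_all add: hat_eq_osc[abs_def] hatc_eq_osc[abs_def] o_def)
qed

lemma has_lim_contour_integral_hat:
  assumes con: "contour_D1 L \<gamma>" and f: "C1_triangle T f" "0 < t" "t < T"
  shows "has_lim_contour_integral (\<lambda>k. k * hat f t k) (of_real (pi / 4) * f t t) \<gamma>"
    "has_lim_contour_integral (\<lambda>k. k * hatc f t k) (of_real (pi / 4) * cnj (f t t)) \<gamma>"
proof -
  obtain f' where f'': "continuous_on {-t..t} (f t)" "continuous_on {-t..t} f'"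
    "\<forall>s\<in>{-t<..<t}. (f t has_vector_derivative f' s) (at s)"
    using C1_triangle_slice[OF f] by (elim exE conjE)
  note f' = f''(1,2) f''(3)[rule_format]
  show "has_lim_contour_integral (\<lambda>k. k * hat f t k) (of_real (pi / 4) * f t t) \<gamma>"
    unfolding hat_eq_osc by (rule has_lim_contour_integral_osc[OF con f(2) _ f']) auto
  show "has_lim_contour_integral (\<lambda>k. k * hatc f t k) (of_real (pi / 4) * cnj (f t t)) \<gamma>"
    unfolding hatc_eq_osc
    by (rule has_lim_contour_integral_osc[OF con f(2) _ continuous_on_cnj[OF f'(1)] continuous_on_cnj[OF f'(2)]
          has_vector_derivative_cnj[OF f'(3)]]) auto
qed

section \<open>Quotients by \<Delta>\<close>

lemma Del_factor: "Del L k = - exp (- 2 * \<i> * k * of_real L) * (1 - exp (4 * \<i> * k * of_real L))"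
  by (simp add: Del_def algebra_simps flip: exp_add)

lemma Del_nonzero_iff: "Del L k \<noteq> 0 \<longleftrightarrow> exp (4 * \<i> * k * of_real L) \<noteq> 1"
  by (simp add: Del_factor)

text \<open>Since |\<Delta>| = e^{2 Im k L} |1 - e^{4ikL}|, a numerator may grow like e^{-2ikL} in
  the upper half-plane and still leave the decay that closing the contour requires.\<close>

lemma has_lim_contour_integral_quotient:
  assumes con: "contour_D1 L \<gamma>" and L: "0 < L" and hol: "N holomorphic_on UNIV"
    and bound: "\<And>k. 0 \<le> Im k \<Longrightarrow> 1 \<le> cmod k \<Longrightarrow>
      cmod (N k - \<alpha> * Del L k / k) \<le> C * exp (2 * Im k * L) / (cmod k)\<^sup>2"
  shows "has_lim_contour_integral (\<lambda>k. N k / Del L k) (- (\<i> * of_real pi / 2) * \<alpha>) \<gamma>"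
proof (rule has_lim_contour_integral_meromorphic[OF con L])
  have "Del L holomorphic_on UNIV" unfolding Del_def[abs_def] by (intro holomorphic_intros)
  then show "(\<lambda>k. N k / Del L k) holomorphic_on {k. exp (4 * \<i> * k * of_real L) \<noteq> 1}"
    using hol Del_nonzero_iff by (intro holomorphic_on_divide) (auto intro: holomorphic_on_subset)
  fix k assume k: "0 \<le> Im k" "1 \<le> cmod k" "exp (4 * \<i> * k * of_real L) \<noteq> 1"
  have D: "Del L k \<noteq> 0" using k Del_nonzero_iff by blast
  have nD: "cmod (Del L k) = exp (2 * Im k * L) * cmod (1 - exp (4 * \<i> * k * of_real L))"
    unfolding Del_factor norm_mult norm_minus_cancel norm_exp_eq_Re by simp
  have "N k / Del L k - \<alpha> / k = (N k - \<alpha> * Del L k / k) / Del L k" using D by (simp add: diff_divide_distrib)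
  also have "cmod \<dots> \<le> (C * exp (2 * Im k * L) / (cmod k)\<^sup>2) / cmod (Del L k)"
    unfolding norm_divide by (intro divide_right_mono bound k) auto
  also have "\<dots> = C / ((cmod k)\<^sup>2 * cmod (1 - exp (4 * \<i> * k * of_real L)))"
    unfolding nD by simp
  finally show "cmod (N k / Del L k - \<alpha> / k) \<le> C / ((cmod k)\<^sup>2 * cmod (1 - exp (4 * \<i> * k * of_real L)))" .
qed

lemma contour_D1_Del_nonzero:
  assumes con: "contour_D1 L \<gamma>" and L: "0 < L"
  shows "Del L (\<gamma> s) \<noteq> 0" "\<gamma> s \<noteq> 0"
  using contour_D1_exp_neq_1[OF assms, of s] by (auto simp: Del_nonzero_iff)

text \<open>Insert the expansion of c at k and -k. In the combinations multiplied by k, the leading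
  terms cancel against the explicit \<open>G0\<close>, \<open>H0\<close> terms and the next order
  leaves -A \<Delta>/k or -B \<Delta>/k. In the other two, the leading order already is -G0
  \<Delta>/(2ik) or -H0 \<Delta>/(2ik), and \<open>A\<close> and \<open>B\<close> go into the
  remainder.\<close>

lemma global_relation_contour_integrals:
  fixes c :: "complex \<Rightarrow> complex" and G0 H0 A B :: complex
  assumes con: "contour_D1 L \<gamma>" and L: "0 < L" and hol: "c holomorphic_on UNIV" and C: "0 \<le> C"
    and bound: "\<And>k. 1 \<le> cmod k \<Longrightarrow>
      cmod (c k - ((G0 - exp (2 * \<i> * k * of_real L) * H0) / (2 * \<i> * k) + (A - exp (2 * \<i> * k * of_real L) * B) / k^2))
      \<le> C * max 1 (exp (- 2 * Im k * L)) / (cmod k)^3"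
  defines "e \<equiv> \<lambda>k. exp (2 * \<i> * k * of_real L)" and "e' \<equiv> \<lambda>k. exp (- 2 * \<i> * k * of_real L)"
  shows "has_lim_contour_integral (\<lambda>k. (k * (e' k * c k - e k * c (- k)) - (Sig L k * G0 - 2 * H0) / (2 * \<i>)) / Del L k)
      (\<i> * of_real pi / 2 * A) \<gamma>"
    "has_lim_contour_integral (\<lambda>k. (k * (c k - c (- k)) - (2 * G0 - Sig L k * H0) / (2 * \<i>)) / Del L k)
      (\<i> * of_real pi / 2 * B) \<gamma>"
    "has_lim_contour_integral (\<lambda>k. (e' k * c k + e k * c (- k)) / Del L k) (of_real pi / 4 * G0) \<gamma>"
    "has_lim_contour_integral (\<lambda>k. (c k + c (- k)) / Del L k) (of_real pi / 4 * H0) \<gamma>"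
proof -
  have val: "- (\<i> * of_real pi / 2) * (- X / (2 * \<i>)) = of_real pi / 4 * X" for X
    by (simp add: complex_eq_iff)
  have S: "Sig L k = e k + e' k" and D: "Del L k = e k - e' k" for k
    by (simp_all add: Sig_def Del_def e_def e'_def)
  have ee: "e k * e' k = 1" for k by (simp add: e_def e'_def flip: exp_add)
  have em: "e (- k) = e' k" for k by (simp add: e_def e'_def)
  have holm: "(\<lambda>k. c (- k)) holomorphic_on UNIV"
  proof -
    have "(\<lambda>k. - k) holomorphic_on UNIV" by (intro holomorphic_intros)
    from holomorphic_on_compose_gen[OF this hol] show ?thesis by (simp add: o_def)
  qed
  have hole: "e holomorphic_on UNIV" "e' holomorphic_on UNIV" "Sig L holomorphic_on UNIV"
    unfolding e_def e'_def Sig_def[abs_def] by (intro holomorphic_intros)+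
  define r where "r k = c k - ((G0 - e k * H0) / (2 * \<i> * k) + (A - e k * B) / k^2)" for k
  define W where "W k = exp (2 * Im k * L)" for k
  have ne: "cmod (e k) \<le> 1" "cmod (e' k) = W k" "1 \<le> W k" if "0 \<le> Im k" for k
    unfolding e_def e'_def W_def norm_exp_eq_Re using that L by simp_all
  \<comment> \<open>For k in the upper half-plane the remainder at -k is taken in the lower one,
    where the expansion allows growth by the factor \<open>W k\<close>.\<close>
  have nr: "cmod (r k) \<le> C / (cmod k)^3" "cmod (r (- k)) \<le> C * W k / (cmod k)^3" if k: "0 \<le> Im k" "1 \<le> cmod k" for k
  proof -
    have "exp (- 2 * Im k * L) \<le> 1" using k L by simp
    then have "max 1 (exp (- 2 * Im k * L)) = 1" by (simp add: max_def)
    then show "cmod (r k) \<le> C / (cmod k)^3" using bound[OF k(2)] unfolding r_def e_def by simp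
    have "max 1 (exp (- 2 * Im (- k) * L)) = W k" using ne(3)[OF k(1)] unfolding W_def by (simp add: max_def)
    then show "cmod (r (- k)) \<le> C * W k / (cmod k)^3" using bound[of "- k"] k unfolding r_def e_def by simp
  qed
  have cr: "c k = r k + ((G0 - e k * H0) / (2 * \<i> * k) + (A - e k * B) / k^2)"
    and cr': "c (- k) = r (- k) + (- (G0 - e' k * H0) / (2 * \<i> * k) + (A - e' k * B) / k^2)" for k
  proof -
    have neg: "X / (2 * \<i> * (- k)) = - X / (2 * \<i> * k)" for X by simp
    show "c k = r k + ((G0 - e k * H0) / (2 * \<i> * k) + (A - e k * B) / k^2)" by (simp add: r_def)
    show "c (- k) = r (- k) + (- (G0 - e' k * H0) / (2 * \<i> * k) + (A - e' k * B) / k^2)"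
      unfolding r_def em neg by simp
  qed
  \<comment> \<open>\<open>s\<close> is 1 for the differences and -1 for the sums of the values at k
    and -k.\<close>
  have mW: "cmod (e' k * r k - s * (e k * r (- k))) \<le> 2 * C * W k / (cmod k)^3"
    "cmod (r k - s * r (- k)) \<le> 2 * C * W k / (cmod k)^3" if k: "0 \<le> Im k" "1 \<le> cmod k" and s: "cmod s = 1" for k s
  proof -
    have W: "1 \<le> W k" using ne k by simp
    have k3: "0 \<le> C / (cmod k)^3" using C by simp
    define Z where "Z = C * W k / (cmod k)^3"
    have Z2: "2 * C * W k / (cmod k)^3 = Z + Z" by (simp add: Z_def)
    have "cmod (e' k) * cmod (r k) \<le> W k * (C / (cmod k)^3)"
      using ne[OF k(1)] nr[OF k] W by (intro mult_mono) auto
    then have 1: "cmod (e' k * r k) \<le> Z" by (simp add: norm_mult Z_def mult_ac)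
    have "cmod (e k) * cmod (r (- k)) \<le> 1 * (C * W k / (cmod k)^3)"
      using ne(1)[OF k(1)] nr(2)[OF k] by (intro mult_mono) auto
    then have 2: "cmod (s * (e k * r (- k))) \<le> Z" by (simp add: norm_mult s Z_def)
    show "cmod (e' k * r k - s * (e k * r (- k))) \<le> 2 * C * W k / (cmod k)^3"
      unfolding Z2 using norm_triangle_ineq4[of "e' k * r k" "s * (e k * r (- k))"] 1 2 by linarith
    have 3: "cmod (r k) \<le> Z" using nr(1)[OF k] mult_right_mono[OF W k3] unfolding Z_def by (simp add: mult_ac)
    have 4: "cmod (s * r (- k)) \<le> Z" unfolding norm_mult s Z_def using nr(2)[OF k] by simp
    show "cmod (r k - s * r (- k)) \<le> 2 * C * W k / (cmod k)^3"
      unfolding Z2 using norm_triangle_ineq4[of "r k" "s * r (- k)"] 3 4 by linarith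
  qed
  have k3: "2 * C * W k / (cmod k)^3 \<le> 2 * C * W k / (cmod k)^2" if k: "1 \<le> cmod k" for k
    using k C by (intro divide_left_mono power_increasing mult_nonneg_nonneg) (auto simp: W_def intro: mult_pos_pos)
  have kk3: "cmod k * (2 * C * W k / (cmod k)^3) = 2 * C * W k / (cmod k)^2" if k: "1 \<le> cmod k" for k
    using k by (simp add: power2_eq_square power3_eq_cube)
  have lin: "cmod ((X * (e k + e' k) - 2 * Y) / k^2) \<le> (2 * cmod X + 2 * cmod Y) * W k / (cmod k)^2"
    if k: "0 \<le> Im k" "1 \<le> cmod k" for X Y k
  proof -
    have "cmod (e k + e' k) \<le> 2 * W k" using ne[OF k(1)] norm_triangle_ineq[of "e k" "e' k"] by linarith
    then have "cmod (X * (e k + e' k)) \<le> cmod X * (2 * W k)" unfolding norm_mult by (intro mult_left_mono) auto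
    moreover have "cmod (2 * Y) \<le> 2 * cmod Y * W k" using mult_left_mono[OF ne(3)[OF k(1)], of "2 * cmod Y"] by (simp add: norm_mult)
    ultimately have "cmod (X * (e k + e' k) - 2 * Y) \<le> (2 * cmod X + 2 * cmod Y) * W k"
      using norm_triangle_ineq4[of "X * (e k + e' k)" "2 * Y"] by (simp add: algebra_simps)
    then show ?thesis unfolding norm_divide norm_power by (intro divide_right_mono) auto
  qed
  have "has_lim_contour_integral (\<lambda>k. (k * (e' k * c k - e k * c (- k)) - (Sig L k * G0 - 2 * H0) / (2 * \<i>)) / Del L k)
      (- (\<i> * of_real pi / 2) * (- A)) \<gamma>"
  proof (rule has_lim_contour_integral_quotient[OF con L, where C = "2 * C"])
    show "(\<lambda>k. k * (e' k * c k - e k * c (- k)) - (Sig L k * G0 - 2 * H0) / (2 * \<i>)) holomorphic_on UNIV"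
      by (intro holomorphic_intros hol holm hole) auto
    fix k assume k: "0 \<le> Im k" "1 \<le> cmod k"
    then have k0: "k \<noteq> 0" by auto
    have "k * (e' k * c k - e k * c (- k)) - (Sig L k * G0 - 2 * H0) / (2 * \<i>) - (- A) * Del L k / k =
        k * (e' k * r k - 1 * (e k * r (- k)))
        + (k * (e' k * ((G0 - e k * H0) / (2 * \<i> * k) + (A - e k * B) / k^2) - e k * (- (G0 - e' k * H0) / (2 * \<i> * k) + (A - e' k * B) / k^2))
        - ((e k + e' k) * G0 - 2 * H0) / (2 * \<i>) + A * (e k - e' k) / k)"
      unfolding cr[of k] cr' S D by (simp add: algebra_simps diff_divide_distrib)
    also have "k * (e' k * ((G0 - e k * H0) / (2 * \<i> * k) + (A - e k * B) / k^2) - e k * (- (G0 - e' k * H0) / (2 * \<i> * k) + (A - e' k * B) / k^2))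
        - ((e k + e' k) * G0 - 2 * H0) / (2 * \<i>) + A * (e k - e' k) / k =
        (e k * e' k - 1) * (- H0 / \<i>)"
      using k0 by (simp add: field_simps power2_eq_square)
    also have "(e k * e' k - 1) * (- H0 / \<i>) = 0" by (simp add: ee)
    also have "cmod (k * (e' k * r k - 1 * (e k * r (- k))) + 0) \<le> cmod k * (2 * C * W k / (cmod k)^3)"
      unfolding add_0_right norm_mult[of k] by (intro mult_left_mono mW k) auto
    also have "\<dots> = 2 * C * W k / (cmod k)^2" by (rule kk3[OF k(2)])
    finally show "cmod (k * (e' k * c k - e k * c (- k)) - (Sig L k * G0 - 2 * H0) / (2 * \<i>) - (- A) * Del L k / k)
        \<le> 2 * C * exp (2 * Im k * L) / (cmod k)\<^sup>2" by (simp add: W_def)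
  qed
  then show "has_lim_contour_integral (\<lambda>k. (k * (e' k * c k - e k * c (- k)) - (Sig L k * G0 - 2 * H0) / (2 * \<i>)) / Del L k)
      (\<i> * of_real pi / 2 * A) \<gamma>" by simp
  have "has_lim_contour_integral (\<lambda>k. (k * (c k - c (- k)) - (2 * G0 - Sig L k * H0) / (2 * \<i>)) / Del L k)
      (- (\<i> * of_real pi / 2) * (- B)) \<gamma>"
  proof (rule has_lim_contour_integral_quotient[OF con L, where C = "2 * C"])
    show "(\<lambda>k. k * (c k - c (- k)) - (2 * G0 - Sig L k * H0) / (2 * \<i>)) holomorphic_on UNIV"
      by (intro holomorphic_intros hol holm hole) auto
    fix k assume k: "0 \<le> Im k" "1 \<le> cmod k"
    then have k0: "k \<noteq> 0" by auto
    have "k * (c k - c (- k)) - (2 * G0 - Sig L k * H0) / (2 * \<i>) - (- B) * Del L k / k =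
        k * (r k - 1 * r (- k))
        + (k * (((G0 - e k * H0) / (2 * \<i> * k) + (A - e k * B) / k^2) - (- (G0 - e' k * H0) / (2 * \<i> * k) + (A - e' k * B) / k^2))
        - (2 * G0 - (e k + e' k) * H0) / (2 * \<i>) + B * (e k - e' k) / k)"
      unfolding cr[of k] cr' S D by (simp add: algebra_simps diff_divide_distrib)
    also have "k * (((G0 - e k * H0) / (2 * \<i> * k) + (A - e k * B) / k^2) - (- (G0 - e' k * H0) / (2 * \<i> * k) + (A - e' k * B) / k^2))
        - (2 * G0 - (e k + e' k) * H0) / (2 * \<i>) + B * (e k - e' k) / k = 0"
      using k0 by (simp add: field_simps power2_eq_square)
    also have "cmod (k * (r k - 1 * r (- k)) + 0) \<le> cmod k * (2 * C * W k / (cmod k)^3)"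
      unfolding add_0_right norm_mult[of k] by (intro mult_left_mono mW k) auto
    also have "\<dots> = 2 * C * W k / (cmod k)^2" by (rule kk3[OF k(2)])
    finally show "cmod (k * (c k - c (- k)) - (2 * G0 - Sig L k * H0) / (2 * \<i>) - (- B) * Del L k / k)
        \<le> 2 * C * exp (2 * Im k * L) / (cmod k)\<^sup>2" by (simp add: W_def)
  qed
  then show "has_lim_contour_integral (\<lambda>k. (k * (c k - c (- k)) - (2 * G0 - Sig L k * H0) / (2 * \<i>)) / Del L k)
      (\<i> * of_real pi / 2 * B) \<gamma>" by simp
  have "has_lim_contour_integral (\<lambda>k. (e' k * c k + e k * c (- k)) / Del L k) (- (\<i> * of_real pi / 2) * (- G0 / (2 * \<i>))) \<gamma>"
  proof (rule has_lim_contour_integral_quotient[OF con L, where C = "2 * C + (2 * cmod A + 2 * cmod B)"])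
    show "(\<lambda>k. e' k * c k + e k * c (- k)) holomorphic_on UNIV"
      by (intro holomorphic_intros hol holm hole)
    fix k assume k: "0 \<le> Im k" "1 \<le> cmod k"
    then have k0: "k \<noteq> 0" by auto
    have "e' k * c k + e k * c (- k) - (- G0 / (2 * \<i>)) * Del L k / k =
        (e' k * r k - (- 1) * (e k * r (- k)))
        + ((e' k * ((G0 - e k * H0) / (2 * \<i> * k) + (A - e k * B) / k^2) + e k * (- (G0 - e' k * H0) / (2 * \<i> * k) + (A - e' k * B) / k^2))
        + G0 / (2 * \<i>) * (e k - e' k) / k)"
      unfolding cr[of k] cr' S D by (simp add: algebra_simps diff_divide_distrib)
    also have "e' k * ((G0 - e k * H0) / (2 * \<i> * k) + (A - e k * B) / k^2) + e k * (- (G0 - e' k * H0) / (2 * \<i> * k) + (A - e' k * B) / k^2)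
        + G0 / (2 * \<i>) * (e k - e' k) / k = (A * (e k + e' k) - 2 * (e k * e' k) * B) / k^2"
      using k0 by (simp add: field_simps power2_eq_square)
    also have "\<dots> = (A * (e k + e' k) - 2 * B) / k^2" by (simp add: ee)
    also have "cmod ((e' k * r k - (- 1) * (e k * r (- k))) + (A * (e k + e' k) - 2 * B) / k^2)
        \<le> 2 * C * W k / (cmod k)^2 + (2 * cmod A + 2 * cmod B) * W k / (cmod k)^2"
      by (intro norm_triangle_le add_mono lin k order_trans[OF mW(1) k3]) auto
    also have "\<dots> = (2 * C + (2 * cmod A + 2 * cmod B)) * exp (2 * Im k * L) / (cmod k)^2"
      by (simp add: W_def add_divide_distrib distrib_right)
    finally show "cmod (e' k * c k + e k * c (- k) - (- G0 / (2 * \<i>)) * Del L k / k)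
        \<le> (2 * C + (2 * cmod A + 2 * cmod B)) * exp (2 * Im k * L) / (cmod k)\<^sup>2" .
  qed
  then show "has_lim_contour_integral (\<lambda>k. (e' k * c k + e k * c (- k)) / Del L k) (of_real pi / 4 * G0) \<gamma>" unfolding val .
  have "has_lim_contour_integral (\<lambda>k. (c k + c (- k)) / Del L k) (- (\<i> * of_real pi / 2) * (- H0 / (2 * \<i>))) \<gamma>"
  proof (rule has_lim_contour_integral_quotient[OF con L, where C = "2 * C + (2 * cmod B + 2 * cmod A)"])
    show "(\<lambda>k. c k + c (- k)) holomorphic_on UNIV"
      by (intro holomorphic_intros hol holm)
    fix k assume k: "0 \<le> Im k" "1 \<le> cmod k"
    then have k0: "k \<noteq> 0" by auto
    have "c k + c (- k) - (- H0 / (2 * \<i>)) * Del L k / k =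
        (r k - (- 1) * r (- k))
        + ((((G0 - e k * H0) / (2 * \<i> * k) + (A - e k * B) / k^2) + (- (G0 - e' k * H0) / (2 * \<i> * k) + (A - e' k * B) / k^2))
        + H0 / (2 * \<i>) * (e k - e' k) / k)"
      unfolding cr[of k] cr' S D by (simp add: algebra_simps diff_divide_distrib)
    also have "((G0 - e k * H0) / (2 * \<i> * k) + (A - e k * B) / k^2) + (- (G0 - e' k * H0) / (2 * \<i> * k) + (A - e' k * B) / k^2)
        + H0 / (2 * \<i>) * (e k - e' k) / k = - ((B * (e k + e' k) - 2 * A) / k^2)"
      using k0 by (simp add: field_simps power2_eq_square)
    also have "cmod ((r k - (- 1) * r (- k)) + - ((B * (e k + e' k) - 2 * A) / k^2))
        \<le> 2 * C * W k / (cmod k)^2 + (2 * cmod B + 2 * cmod A) * W k / (cmod k)^2"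
      by (rule norm_triangle_le, unfold norm_minus_cancel) (intro add_mono lin k order_trans[OF mW(2) k3], auto)
    also have "\<dots> = (2 * C + (2 * cmod B + 2 * cmod A)) * exp (2 * Im k * L) / (cmod k)^2"
      by (simp add: W_def add_divide_distrib distrib_right)
    finally show "cmod (c k + c (- k) - (- H0 / (2 * \<i>)) * Del L k / k)
        \<le> (2 * C + (2 * cmod B + 2 * cmod A)) * exp (2 * Im k * L) / (cmod k)\<^sup>2" .
  qed
  then show "has_lim_contour_integral (\<lambda>k. (c k + c (- k)) / Del L k) (of_real pi / 4 * H0) \<gamma>" unfolding val .
qed

text \<open>\<open>Y\<close> stands for the combination of c(k) and c(-k), the remaining letters for
  transforms, boundary values, \<Delta> and \<Sigma>. The transforms \<open>m\<close>,
  \<open>m'\<close> weighted with k^2 cancel against the linear terms of F; what survives is the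
  quotient evaluated above and k times the transform \<open>l\<close> of \<open>L1\<close> or its
  counterpart.\<close>

lemma dirichlet_integrand_eq:
  fixes k D S :: complex
  assumes "k \<noteq> 0" "D \<noteq> 0"
  shows "- (2 * k\<^sup>2 / D) * (m' - h / (2 * \<i> * k\<^sup>2)) + k\<^sup>2 * S / D * (m - g / (2 * \<i> * k\<^sup>2))
      + k / D * (Y + D * l - k * S * m + 2 * k * m') = (k * Y - (S * g - 2 * h) / (2 * \<i>)) / D + k * l"
    "2 * k\<^sup>2 / D * (m - g / (2 * \<i> * k\<^sup>2)) - k\<^sup>2 * S / D * (m' - h / (2 * \<i> * k\<^sup>2))
      + k / D * (Y + D * l - 2 * k * m + k * S * m') = (k * Y - (2 * g - S * h) / (2 * \<i>)) / D + k * l"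
  using assms by (simp_all add: field_simps power2_eq_square)

lemma neumann_integrand_eq:
  fixes k D S :: complex
  assumes "D \<noteq> 0"
  shows "1 / D * (S * l - 2 * l' + (Y - S * l + k * D * m + 2 * l')) = Y / D + k * m"
    "1 / D * (- S * l' + 2 * l + (Y - 2 * l + S * l' + k * D * m)) = Y / D + k * m"
  using assms by (simp_all add: field_simps)

lemma nls_interval_boundary_values:
  assumes L: "0 < L" and lam: "lam \<in> {1, -1}"
    and Ck: "Ck2_on 3 {0..L} {0..<T} q" and nls: "nls_solution T L lam q"
    and q0: "\<forall>x\<in>{0..L}. q x 0 = 0" and bv: "boundary_values T L q g0 g1 h0 h1"
    and ef: "eigenfunctions T lam g0 g1 Phi1 Phi2" and glmK: "glm_kernels T lam g0 g1 Phi1 Phi2 K"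
    and ef': "eigenfunctions T lam h0 h1 phi1 phi2" and glmJ: "glm_kernels T lam h0 h1 phi1 phi2 J"
    and con: "contour_D1 L \<gamma>" and t: "0 < t" "t < T"
  shows "\<exists>I. has_lim_contour_integral
        (\<lambda>k. - (2 * k\<^sup>2 / Del L k) * (hat (M1 J) t k - h0 t / (2 * \<i> * k\<^sup>2))
              + k\<^sup>2 * Sig L k / Del L k * (hat (M1 K) t k - g0 t / (2 * \<i> * k\<^sup>2))
              + k / Del L k
                * minus_part (\<lambda>k. exp (- 2 * \<i> * k * of_real L) * Ffun L lam g0 h0 K J t k) k
              + \<i> * g0 t / 2 * k * hat (M2 K) t k
              + k * g0 t / (2 * \<i>) * hatc (M2 J) t k) I \<gamma> \<and>
        g1 t = 4 / (\<i> * of_real pi) * I" (is ?g1)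
    "\<exists>I. has_lim_contour_integral
        (\<lambda>k. 2 * k\<^sup>2 / Del L k * (hat (M1 K) t k - g0 t / (2 * \<i> * k\<^sup>2))
              - k\<^sup>2 * Sig L k / Del L k * (hat (M1 J) t k - h0 t / (2 * \<i> * k\<^sup>2))
              + k / Del L k * minus_part (\<lambda>k. Ffun L lam g0 h0 K J t k) k
              + \<i> * h0 t / 2 * k * hat (M2 J) t k
              + k * h0 t / (2 * \<i>) * hatc (M2 K) t k) I \<gamma> \<and>
        h1 t = 4 / (\<i> * of_real pi) * I" (is ?h1)
    "\<exists>I. has_lim_contour_integral
        (\<lambda>k. 1 / Del L k *
              (Sig L k * hat (L1 K) t k - 2 * hat (L1 J) t k
               + plus_part (\<lambda>k. exp (- 2 * \<i> * k * of_real L) * Ffun L lam g0 h0 K J t k) k)) I \<gamma> \<and>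
        g0 t = 2 / of_real pi * I" (is ?g0)
    "\<exists>I. has_lim_contour_integral
        (\<lambda>k. 1 / Del L k *
              (- Sig L k * hat (L1 J) t k + 2 * hat (L1 K) t k
               + plus_part (\<lambda>k. Ffun L lam g0 h0 K J t k) k)) I \<gamma> \<and>
        h0 t = 2 / of_real pi * I" (is ?h0)
proof -
  have lam1: "\<bar>lam\<bar> = 1" using lam by auto
  have K: "C1_triangle T (L1 K)" "C1_triangle T (L2 K)" "C1_triangle T (M1 K)" "C1_triangle T (M2 K)"
      "glm_representation T lam g0 Phi1 Phi2 K" "goursat T lam g0 g1 K"
    and J: "C1_triangle T (L1 J)" "C1_triangle T (L2 J)" "C1_triangle T (M1 J)" "C1_triangle T (M2 J)"
      "glm_representation T lam h0 phi1 phi2 J" "goursat T lam h0 h1 J"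
    using glmK glmJ unfolding glm_kernels_def by auto
  have diagK: "L1 K t t = \<i> / 2 * g1 t" "M1 K t t = g0 t" and diagJ: "L1 J t t = \<i> / 2 * h1 t" "M1 J t t = h0 t"
    using K(6) J(6) t unfolding goursat_def Let_def by auto
  define e where "e k = exp (2 * \<i> * k * of_real L)" for k
  define e' where "e' k = exp (- 2 * \<i> * k * of_real L)" for k
  have ee: "e k * e' k = 1" for k by (simp add: e_def e'_def flip: exp_add)
  have em: "e (- k) = e' k" "e' (- k) = e k" for k by (simp_all add: e_def e'_def)
  have DS: "Del L k = e k - e' k" "Sig L k = e k + e' k" for k by (simp_all add: Del_def Sig_def e_def e'_def)
  define c where "c k = Phi1 t k * cnj (phi2 t (cnj k)) - e k * phi1 t k * cnj (Phi2 t (cnj k))" for k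
  have rep: "Phi1 t k = hat (L1 K) t k - \<i> / 2 * g0 t * hat (M2 K) t k + k * hat (M1 K) t k"
    "phi1 t k = hat (L1 J) t k - \<i> / 2 * h0 t * hat (M2 J) t k + k * hat (M1 J) t k"
    "cnj (Phi2 t (cnj k)) = 1 + (hatc (L2 K) t k - \<i> * of_real lam * (g0 t / 2) * hatc (M1 K) t k + k * hatc (M2 K) t k)"
    "cnj (phi2 t (cnj k)) = 1 + (hatc (L2 J) t k - \<i> * of_real lam * (h0 t / 2) * hatc (M1 J) t k + k * hatc (M2 J) t k)" for k
    using K(5) J(5) t unfolding glm_representation_def hatc_def by simp_all
  \<comment> \<open>By \<open>rep\<close> each product in \<open>Ffun\<close> is an eigenfunction
    times a conjugated one minus 1. The -1 leaves the eigenfunctions themselves, whose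
    \<open>M2\<close> terms cancel with the first two terms of \<open>Ffun\<close>.\<close>
  have F: "Ffun L lam g0 h0 K J t k = c k - hat (L1 K) t k - k * hat (M1 K) t k + e k * (hat (L1 J) t k + k * hat (M1 J) t k)" for k
    unfolding Ffun_def c_def rep e_def[symmetric] by (simp add: algebra_simps add_divide_distrib)
  have hol: "c holomorphic_on UNIV"
    unfolding c_def[abs_def] rep e_def
    by (intro holomorphic_intros hat_holomorphic[OF _ t] K J)
  define m where "m = of_real lam * integral {0..t} (\<lambda>t. \<i> * (h1 t * cnj (h0 t) - h0 t * cnj (h1 t)) - \<i> * (g1 t * cnj (g0 t) - g0 t * cnj (g1 t)))"
  define A where "A = (g1 t + g0 t * m) / 4"
  define B where "B = (h1 t - h0 t * m) / 4"
  obtain C where C: "0 \<le> C" "\<forall>k. 1 \<le> cmod k \<longrightarrow>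
      cmod (c k - ((g0 t - exp (2 * \<i> * k * of_real L) * h0 t) / (2 * \<i> * k) + (A - exp (2 * \<i> * k * of_real L) * B) / k^2))
      \<le> C * max 1 (exp (- 2 * Im k * L)) / (cmod k)^3"
    using nls_global_relation_asymptotics[OF L lam1 t Ck nls q0 bv ef ef']
    unfolding c_def e_def A_def B_def m_def by (elim exE conjE)
  note lims = global_relation_contour_integrals[OF con L hol C(1) C(2)[rule_format], folded e_def e'_def]
  note hatK = has_lim_contour_integral_hat[OF con _ t, OF K(1)] has_lim_contour_integral_hat[OF con _ t, OF K(3)]
      has_lim_contour_integral_hat[OF con _ t, OF K(4)]
  note hatJ = has_lim_contour_integral_hat[OF con _ t, OF J(1)] has_lim_contour_integral_hat[OF con _ t, OF J(3)]
      has_lim_contour_integral_hat[OF con _ t, OF J(4)]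
  note M2K = goursat_M2_diagonal[OF K(1,3,4,6) t] and M2J = goursat_M2_diagonal[OF J(1,3,4,6) t]
  have cg: "continuous_on {0..t} g0" "continuous_on {0..t} g1" "continuous_on {0..t} h0" "continuous_on {0..t} h1"
    using boundary_values_continuous[OF Ck nls q0 bv L t] by auto
  \<comment> \<open>The integrand on the diagonal is i\<lambda> times a number minus its conjugate,
    hence real; the conjugated transform of \<open>M2\<close> therefore returns the same value as
    the plain one.\<close>
  have real: "cnj (M2 K t t) = M2 K t t" "cnj (M2 J t t) = M2 J t t"
    unfolding M2K M2J integral_cnj by (rule integral_cong, simp add: algebra_simps)+
  \<comment> \<open>This identity matches the mass term of the expansion with the \<open>M2\<close>
    terms of the Dirichlet integrands.\<close>
  have m: "m = M2 J t t - M2 K t t"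
  proof -
    have "M2 J t t - M2 K t t = integral {0..t} (\<lambda>r. \<i> * of_real lam * (cnj (h0 r) * h1 r - cnj (h1 r) * h0 r)
        - \<i> * of_real lam * (cnj (g0 r) * g1 r - cnj (g1 r) * g0 r))"
      unfolding M2K M2J
      by (rule integral_diff[symmetric]) (intro integrable_continuous_interval continuous_intros cg)+
    also have "\<dots> = integral {0..t} (\<lambda>t. of_real lam * (\<i> * (h1 t * cnj (h0 t) - h0 t * cnj (h1 t)) - \<i> * (g1 t * cnj (g0 t) - g0 t * cnj (g1 t))))"
      by (rule integral_cong) (simp add: algebra_simps)
    finally show ?thesis unfolding m_def by simp
  qed
  have D0: "Del L (\<gamma> s) \<noteq> 0" and k0: "\<gamma> s \<noteq> 0" for s using contour_D1_Del_nonzero[OF con L] by auto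
  have parts: "minus_part (\<lambda>k. exp (- 2 * \<i> * k * of_real L) * Ffun L lam g0 h0 K J t k) k =
      (e' k * c k - e k * c (- k)) + Del L k * hat (L1 K) t k - k * Sig L k * hat (M1 K) t k + 2 * k * hat (M1 J) t k"
    "minus_part (\<lambda>k. Ffun L lam g0 h0 K J t k) k =
      (c k - c (- k)) + Del L k * hat (L1 J) t k - 2 * k * hat (M1 K) t k + k * Sig L k * hat (M1 J) t k"
    "plus_part (\<lambda>k. exp (- 2 * \<i> * k * of_real L) * Ffun L lam g0 h0 K J t k) k =
      (e' k * c k + e k * c (- k)) - Sig L k * hat (L1 K) t k + k * Del L k * hat (M1 K) t k + 2 * hat (L1 J) t k"
    "plus_part (\<lambda>k. Ffun L lam g0 h0 K J t k) k =
      (c k + c (- k)) - 2 * hat (L1 K) t k + Sig L k * hat (L1 J) t k + k * Del L k * hat (M1 J) t k" for k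
    unfolding minus_part_def plus_part_def e'_def[symmetric] F em hat_minus DS
    using ee[of k] by - (algebra | simp add: algebra_simps)+
  have pi0: "complex_of_real pi \<noteq> 0" by simp
  let ?I1 = "\<i> * of_real pi / 2 * A + of_real (pi / 4) * L1 K t t + \<i> * g0 t / 2 * (of_real (pi / 4) * M2 K t t)
      + g0 t / (2 * \<i>) * (of_real (pi / 4) * cnj (M2 J t t))"
  \<comment> \<open>After multiplication by 4/(i\<pi>), \<open>A\<close> gives g1/2 + g0 m/2,
    \<open>L1 K t t\<close> gives g1/2, and the two \<open>M2\<close> terms give -g0 m/2. For
    \<open>v2\<close> the sign of \<open>m\<close> is reversed in both places.\<close>
  have v1: "g1 t = 4 / (\<i> * of_real pi) * ?I1"
    unfolding A_def diagK real m using pi0 by (simp add: field_simps)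
  show ?g1
  proof (intro exI conjI, rule has_lim_contour_integral_cong[OF _ has_lim_contour_integral_add[OF has_lim_contour_integral_add[OF
      has_lim_contour_integral_add[OF lims(1) hatK(1)] has_lim_contour_integral_mult[OF hatK(5), of "\<i> * g0 t / 2"]]
      has_lim_contour_integral_mult[OF hatJ(6), of "g0 t / (2 * \<i>)"]] refl])
    show "g1 t = 4 / (\<i> * of_real pi) * ?I1" by (rule v1)
  qed (simp only: parts dirichlet_integrand_eq(1)[OF k0 D0], simp add: mult_ac)
  let ?I2 = "\<i> * of_real pi / 2 * B + of_real (pi / 4) * L1 J t t + \<i> * h0 t / 2 * (of_real (pi / 4) * M2 J t t)
      + h0 t / (2 * \<i>) * (of_real (pi / 4) * cnj (M2 K t t))"
  have v2: "h1 t = 4 / (\<i> * of_real pi) * ?I2"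
    unfolding B_def diagJ real m using pi0 by (simp add: field_simps)
  show ?h1
  proof (intro exI conjI, rule has_lim_contour_integral_cong[OF _ has_lim_contour_integral_add[OF has_lim_contour_integral_add[OF
      has_lim_contour_integral_add[OF lims(2) hatJ(1)] has_lim_contour_integral_mult[OF hatJ(5), of "\<i> * h0 t / 2"]]
      has_lim_contour_integral_mult[OF hatK(6), of "h0 t / (2 * \<i>)"]] refl])
    show "h1 t = 4 / (\<i> * of_real pi) * ?I2" by (rule v2)
  qed (simp only: parts dirichlet_integrand_eq(2)[OF k0 D0], simp add: mult_ac)
  have v3: "g0 t = 2 / of_real pi * (of_real pi / 4 * g0 t + of_real (pi / 4) * M1 K t t)"
    "h0 t = 2 / of_real pi * (of_real pi / 4 * h0 t + of_real (pi / 4) * M1 J t t)"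
    unfolding diagK diagJ using pi0 by (simp_all add: field_simps)
  show ?g0
  proof (intro exI conjI, rule has_lim_contour_integral_cong[OF _ has_lim_contour_integral_add[OF lims(3) hatK(3)] refl])
    show "g0 t = 2 / of_real pi * (of_real pi / 4 * g0 t + of_real (pi / 4) * M1 K t t)" by (rule v3(1))
  qed (simp only: parts neumann_integrand_eq(1)[OF D0])
  show ?h0
  proof (intro exI conjI, rule has_lim_contour_integral_cong[OF _ has_lim_contour_integral_add[OF lims(4) hatJ(3)] refl])
    show "h0 t = 2 / of_real pi * (of_real pi / 4 * h0 t + of_real (pi / 4) * M1 J t t)" by (rule v3(2))
  qed (simp only: parts neumann_integrand_eq(2)[OF D0])
qed

theorem theorem4p1:
  "\<exists>N::nat. \<forall>(T::real) (L::real) (lam::real) (q :: real \<Rightarrow> real \<Rightarrow> complex)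
      (g0 :: real \<Rightarrow> complex) (g1 :: real \<Rightarrow> complex) (h0 :: real \<Rightarrow> complex) (h1 :: real \<Rightarrow> complex)
      (Phi1 :: real \<Rightarrow> complex \<Rightarrow> complex) (Phi2 :: real \<Rightarrow> complex \<Rightarrow> complex)
      (phi1 :: real \<Rightarrow> complex \<Rightarrow> complex) (phi2 :: real \<Rightarrow> complex \<Rightarrow> complex)
      (K :: glm) (J :: glm) (\<gamma> :: real \<Rightarrow> complex) (t::real).
    0 < T \<and> 0 < L \<and> lam \<in> {1, -1} \<and>
    Ck2_on N {0..L} {0..<T} q \<and> nls_solution T L lam q \<and>
    (\<forall>x\<in>{0..L}. q x 0 = 0) \<and>
    boundary_values T L q g0 g1 h0 h1 \<and>
    eigenfunctions T lam g0 g1 Phi1 Phi2 \<and> glm_kernels T lam g0 g1 Phi1 Phi2 K \<and>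
    eigenfunctions T lam h0 h1 phi1 phi2 \<and> glm_kernels T lam h0 h1 phi1 phi2 J \<and>
    contour_D1 L \<gamma> \<and> 0 < t \<and> t < T
    \<longrightarrow>
    (smooth_compatible N T g0 \<and> smooth_compatible N T h0 \<longrightarrow>
      (\<exists>I. has_lim_contour_integral
        (\<lambda>k. - (2 * k\<^sup>2 / Del L k) * (hat (M1 J) t k - h0 t / (2 * \<i> * k\<^sup>2))
              + k\<^sup>2 * Sig L k / Del L k * (hat (M1 K) t k - g0 t / (2 * \<i> * k\<^sup>2))
              + k / Del L k
                * minus_part (\<lambda>k. exp (- 2 * \<i> * k * of_real L) * Ffun L lam g0 h0 K J t k) k
              + \<i> * g0 t / 2 * k * hat (M2 K) t k
              + k * g0 t / (2 * \<i>) * hatc (M2 J) t k) I \<gamma> \<and>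
        g1 t = 4 / (\<i> * of_real pi) * I) \<and>
      (\<exists>I. has_lim_contour_integral
        (\<lambda>k. 2 * k\<^sup>2 / Del L k * (hat (M1 K) t k - g0 t / (2 * \<i> * k\<^sup>2))
              - k\<^sup>2 * Sig L k / Del L k * (hat (M1 J) t k - h0 t / (2 * \<i> * k\<^sup>2))
              + k / Del L k * minus_part (\<lambda>k. Ffun L lam g0 h0 K J t k) k
              + \<i> * h0 t / 2 * k * hat (M2 J) t k
              + k * h0 t / (2 * \<i>) * hatc (M2 K) t k) I \<gamma> \<and>
        h1 t = 4 / (\<i> * of_real pi) * I)) \<and>
    (smooth_compatible N T g1 \<and> smooth_compatible N T h1 \<longrightarrow>
      (\<exists>I. has_lim_contour_integral
        (\<lambda>k. 1 / Del L k *
              (Sig L k * hat (L1 K) t k - 2 * hat (L1 J) t k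
               + plus_part (\<lambda>k. exp (- 2 * \<i> * k * of_real L) * Ffun L lam g0 h0 K J t k) k)) I \<gamma> \<and>
        g0 t = 2 / of_real pi * I) \<and>
      (\<exists>I. has_lim_contour_integral
        (\<lambda>k. 1 / Del L k *
              (- Sig L k * hat (L1 J) t k + 2 * hat (L1 K) t k
               + plus_part (\<lambda>k. Ffun L lam g0 h0 K J t k) k)) I \<gamma> \<and>
        h0 t = 2 / of_real pi * I))"
  \<comment> \<open>Three x-derivatives of q carry the expansion of c to order k^-3, whence the
    witness 3.\<close>
  by (rule exI[of _ 3], intro allI impI conjI; elim conjE; rule nls_interval_boundary_values; assumption)

end
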